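(* Consider the sequence of (open) infinite-server systems with vector-packing constraints described in the context, indexed by $r$, under the Greedy-DM-AC algorithm with $\alpha>0$. Let $\{x^r_{(k,\hat k)}(\infty)\}$ denote the random complete state of the fluid-scaled process in a stationary regime, and let $x^r(\infty)=\{x^r_k(\infty)\}_{k\in\mathcal K}$ with $x^r_k(\infty)=\sum_{\hat k\le k}x^r_{(k,\hat k)}(\infty)$. Then, as $r\to\infty$, $$d\big(\{x^r_{(k,\hat k)}(\infty)\},\bar{\mathcal X}\big)\Longrightarrow0,\qquad d(x^r(\infty),\mathcal X^* )\Longrightarrow0,$$ where $\mathcal X^*$ is the set of optimal solutions of the convex problem of minimizing $\Phi(x)=\sum_{q\in\mathcal Q}(1+\alpha)^{-1}\big[\sum_{k\in q}x_k\big]^{1+\alpha}$ over $x\in\mathbb R_+^{|\mathcal K|}$ subject to $\sum_{k\in\mathcal K}k_ix_k=\rho_i$ for all $i$.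
   Context: Vector packing. $\mathcal I=\{1,\dots,I\}$ is the set of customer types. There are $N$ resources, with $B_n>0$ the amount of resource $n$ at each server and $b_{i,n}>0$ the requirement of a type $i$ customer. The set of configurations is $\bar{\mathcal K}=\{k\in\mathbb Z_+^I:\sum_ik_ib_{i,n}\le B_n\ \forall n\}$; every unit vector $e_i$ is assumed to lie in $\bar{\mathcal K}$. $\mathcal K=\bar{\mathcal K}\setminus\{0\}$. There are infinitely many servers, each having a configuration $k\in\bar{\mathcal K}$. Aggregate configurations. $k,k'\in\bar{\mathcal K}$ are equivalent if $\sum_ik_ib_{i,n}=\sum_ik'_ib_{i,n}$ for all $n$. An equivalence class is an a-configuration. $\bar{\mathcal Q}$ is the set of all a-configurations; the class of $k=0$ is denoted $q=0$; $\mathcal Q=\bar{\mathcal Q}\setminus\{0\}$. $X_k$ is the number of servers in configuration $k$ and $X_q=\sum_{k\in q}X_k$. For $q$ to which a type $i$ customer can be added without violating the constraints, $q+e_i$ is the a-configuration containing all $k+e_i$, $k\in q$. Parameters. $\lambda_i>0$, $\mu_i>0$, $\rho_i=\lambda_i/\mu_i$, $\sum_i\rho_i=1$; $\mu_0>0$ is a fixed parameter. The scaling parameter $r\ge1$ increases to infinity along a discrete sequence. In the system with parameter $r$, actual type $i$ customers arrive as a Poisson process of rate $\lambda_ir$ and have exponential service times with mean $1/\mu_i$; all arrival processes and service times are mutually independent, and service is unaffected by other customers in the same server. Greedy-DM-AC discipline. There are two kinds of type $i$ customers: actual customers and tokens; for defining configurations $k$ and counts $X_k$, $X_q$, tokens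 are treated as customers of their type. "AC-placement" of a type $i$ item at time $t$ means: it is added to an available a-configuration $q$ ($q=0$ or $X_q(t-)>0$) such that the addition does not violate the packing constraints and $X_{q+e_i}(t-)^\alpha-I\{q\ne0\}X_q(t-)^\alpha$ is smallest; ties between a-configurations are broken by an arbitrary deterministic rule; the server within the chosen a-configuration is chosen uniformly at random. (1) When an actual type $i$ customer completes service, it leaves (its server's configuration changes from $k$ to $k-e_i$), and a new type $i$ token is immediately created and AC-placed ($t-$ meaning after the service completion but before the token placement). (2) A newly arriving actual type $i$ customer replaces an arbitrarily chosen type $i$ token (anywhere in the system) if there is one; otherwise it is AC-placed ($t-$ meaning just before the arrival). (3) Each token independently "completes service" at rate $\mu_0$; it then leaves and its server's configuration changes from $k$ to $k-e_i$, and no new token is created. Complete state. A complete server configuration is a pair $(k,\hat k)$ with $k\in\mathcal K$, $\hat k\in\bar{\mathcal K}$, $\hat k\le k$, where $k$ counts all customers (actual and tokens) and $\hat k$ counts actual customers. $X^r_{(k,\hat k)}(t)$ is the number of servers in complete configuration $(k,\hat k)$; $x^r_{(k,\hat k)}=X^r_{(k,\hat k)}/r$. Set $\bar{\mathcal X}$. For a vector $\{x_{(k,\hat k)}\}$ with non-negative components put $y_i=\sum_{(k,\hat k)}k_ix_{(k,\hat k)}$, $\hat y_i=\sum_{(k,\hat k)}\hat k_ix_{(k,\hat k)}$. $\bar{\mathcal X}$ is the set of such vectors with $y_i=\hat y_i=\rho_i$ for all $i$. $d(\cdot,U)$ is Euclidean distance to $U$; $\Longrightarrow$ is convergence in distribution.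 *)

theory Defs
  imports "HOL-Analysis.Analysis" "HOL-Probability.Probability"
begin

section \<open>Vector packing: configurations and a-configurations\<close>

type_synonym 'i conf = "nat ^ 'i"
type_synonym 'i cconf = "'i conf \<times> 'i conf"
type_synonym 'i state = "'i cconf \<Rightarrow> nat"

text \<open>
  The unit vector \<open>e_i\<close> is \<open>axis i 1\<close>. In a complete configuration \<open>(k, kh)\<close>, \<open>k\<close> counts all
  customers (actual customers and tokens) and \<open>kh\<close> the actual ones. A complete state records
  the number of servers in each nonempty complete configuration; the infinitely many empty servers
  are not recorded.
\<close>

context
  fixes B :: "'n::finite \<Rightarrow> real" and b :: "'i::finite \<Rightarrow> 'n \<Rightarrow> real"
begin

definition confs0 :: "'i conf set" where
  "confs0 = {k. \<forall>n. (\<Sum>i\<in>UNIV. real (k $ i) * b i n) \<le> B n}"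

definition confs :: "'i conf set" where
  "confs = confs0 - {0}"

definition aconf_rel :: "('i conf \<times> 'i conf) set" where
  "aconf_rel = {(k, k'). k \<in> confs0 \<and> k' \<in> confs0 \<and>
     (\<forall>n. (\<Sum>i\<in>UNIV. real (k $ i) * b i n) = (\<Sum>i\<in>UNIV. real (k' $ i) * b i n))}"

definition aconfs0 :: "'i conf set set" where
  "aconfs0 = confs0 // aconf_rel"

definition aconf_zero :: "'i conf set" where
  "aconf_zero = aconf_rel `` {0}"

definition aconfs :: "'i conf set set" where
  "aconfs = aconfs0 - {aconf_zero}"

definition can_add :: "'i conf set \<Rightarrow> 'i \<Rightarrow> bool" where
  "can_add q i \<longleftrightarrow> (\<forall>k\<in>q. k + axis i 1 \<in> confs0)"

definition aconf_add :: "'i conf set \<Rightarrow> 'i \<Rightarrow> 'i conf set" where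
  "aconf_add q i = aconf_rel `` ((\<lambda>k. k + axis i 1) ` q)"

definition cconfs :: "'i cconf set" where
  "cconfs = {(k, kh). k \<in> confs \<and> kh \<in> confs0 \<and> kh \<le> k}"

definition states :: "'i state set" where
  "states = {X. \<forall>c. c \<notin> cconfs \<longrightarrow> X c = 0}"

text \<open>From the complete vector \<open>x_(k,kh)\<close> to the vector \<open>x_k\<close>; used for counts and for
  fluid-scaled quantities.\<close>

definition marginal :: "('i cconf \<Rightarrow> 'a::comm_monoid_add) \<Rightarrow> 'i conf \<Rightarrow> 'a" where
  "marginal x k = (\<Sum>kh | kh \<le> k. x (k, kh))"

definition aconf_count :: "'i state \<Rightarrow> 'i conf set \<Rightarrow> nat" where
  "aconf_count X q = (\<Sum>k\<in>q. marginal X k)"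

section \<open>AC-placement\<close>

definition available :: "'i state \<Rightarrow> 'i conf set \<Rightarrow> bool" where
  "available X q \<longleftrightarrow> q = aconf_zero \<or> aconf_count X q > 0"

definition ac_candidates :: "'i state \<Rightarrow> 'i \<Rightarrow> 'i conf set set" where
  "ac_candidates X i = {q \<in> aconfs0. available X q \<and> can_add q i}"

definition ac_increment :: "real \<Rightarrow> 'i state \<Rightarrow> 'i \<Rightarrow> 'i conf set \<Rightarrow> real" where
  "ac_increment \<alpha> X i q =
     real (aconf_count X (aconf_add q i)) powr \<alpha> -
     (if q \<noteq> aconf_zero then real (aconf_count X q) powr \<alpha> else 0)"

definition ac_minimizers :: "real \<Rightarrow> 'i state \<Rightarrow> 'i \<Rightarrow> 'i conf set set" where
  "ac_minimizers \<alpha> X i =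
     {q. is_arg_min (ac_increment \<alpha> X i) (\<lambda>q. q \<in> ac_candidates X i) q}"

definition ac_rule :: "real \<Rightarrow> ('i state \<Rightarrow> 'i \<Rightarrow> 'i conf set) \<Rightarrow> bool" where
  "ac_rule \<alpha> sel \<longleftrightarrow> (\<forall>X\<in>states. \<forall>i. sel X i \<in> ac_minimizers \<alpha> X i)"

text \<open>The pairs \<open>(c, j)\<close> with \<open>j < X c\<close> label the individual servers.\<close>

definition pick_server :: "'i state \<Rightarrow> 'i conf set \<Rightarrow> 'i cconf pmf" where
  "pick_server X q =
     (if q = aconf_zero then return_pmf (0, 0)
      else map_pmf fst (pmf_of_set {(c, j). c \<in> cconfs \<and> fst c \<in> q \<and> j < X c}))"

definition move_server :: "'i cconf \<Rightarrow> 'i cconf \<Rightarrow> 'i state \<Rightarrow> 'i state" where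
  "move_server c c' X =
     (let Y = (if c = (0, 0) then X else X(c := X c - 1))
      in if c' = (0, 0) then Y else Y(c' := Y c' + 1))"

definition ac_place_token ::
    "('i state \<Rightarrow> 'i \<Rightarrow> 'i conf set) \<Rightarrow> 'i state \<Rightarrow> 'i \<Rightarrow> 'i state pmf" where
  "ac_place_token sel X i =
     map_pmf (\<lambda>(k, kh). move_server (k, kh) (k + axis i 1, kh) X) (pick_server X (sel X i))"

definition ac_place_actual ::
    "('i state \<Rightarrow> 'i \<Rightarrow> 'i conf set) \<Rightarrow> 'i state \<Rightarrow> 'i \<Rightarrow> 'i state pmf" where
  "ac_place_actual sel X i =
     map_pmf (\<lambda>(k, kh). move_server (k, kh) (k + axis i 1, kh + axis i 1) X)
       (pick_server X (sel X i))"

section \<open>Transition rates under Greedy-DM-AC\<close>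

definition token_places :: "'i state \<Rightarrow> 'i \<Rightarrow> 'i cconf set" where
  "token_places X i = {(k, kh) \<in> cconfs. X (k, kh) > 0 \<and> kh $ i < k $ i}"

text \<open>The rule for choosing the token to be replaced may be randomized; only the complete
  configuration of the server holding that token affects the complete state.\<close>

definition replacement_rule :: "('i state \<Rightarrow> 'i \<Rightarrow> 'i cconf pmf) \<Rightarrow> bool" where
  "replacement_rule rep \<longleftrightarrow>
     (\<forall>X\<in>states. \<forall>i. token_places X i \<noteq> {} \<longrightarrow> set_pmf (rep X i) \<subseteq> token_places X i)"

definition after_arrival ::
    "('i state \<Rightarrow> 'i \<Rightarrow> 'i conf set) \<Rightarrow> ('i state \<Rightarrow> 'i \<Rightarrow> 'i cconf pmf) \<Rightarrow>
     'i state \<Rightarrow> 'i \<Rightarrow> 'i state pmf" where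
  "after_arrival sel rep X i =
     (if token_places X i \<noteq> {}
      then map_pmf (\<lambda>(k, kh). move_server (k, kh) (k, kh + axis i 1) X) (rep X i)
      else ac_place_actual sel X i)"

definition after_service ::
    "('i state \<Rightarrow> 'i \<Rightarrow> 'i conf set) \<Rightarrow> 'i state \<Rightarrow> 'i cconf \<Rightarrow> 'i \<Rightarrow> 'i state pmf" where
  "after_service sel X c i =
     (case c of (k, kh) \<Rightarrow>
        ac_place_token sel (move_server (k, kh) (k - axis i 1, kh - axis i 1) X) i)"

definition after_token_expiry :: "'i state \<Rightarrow> 'i cconf \<Rightarrow> 'i \<Rightarrow> 'i state" where
  "after_token_expiry X c i = (case c of (k, kh) \<Rightarrow> move_server (k, kh) (k - axis i 1, kh) X)"

definition greedy_rate ::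
    "('i \<Rightarrow> real) \<Rightarrow> ('i \<Rightarrow> real) \<Rightarrow> real \<Rightarrow> real \<Rightarrow>
     ('i state \<Rightarrow> 'i \<Rightarrow> 'i conf set) \<Rightarrow> ('i state \<Rightarrow> 'i \<Rightarrow> 'i cconf pmf) \<Rightarrow>
     'i state \<Rightarrow> 'i state \<Rightarrow> real" where
  "greedy_rate lam mu mu0 r sel rep X X' =
     (\<Sum>i\<in>UNIV. lam i * r * pmf (after_arrival sel rep X i) X')
   + (\<Sum>i\<in>UNIV. \<Sum>(k, kh)\<in>cconfs.
        mu i * real (kh $ i) * real (X (k, kh)) * pmf (after_service sel X (k, kh) i) X')
   + (\<Sum>i\<in>UNIV. \<Sum>(k, kh)\<in>cconfs.
        mu0 * real (k $ i - kh $ i) * real (X (k, kh)) *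
        (if after_token_expiry X (k, kh) i = X' then 1 else 0))"

section \<open>Target sets\<close>

definition balanced_set :: "('i \<Rightarrow> real) \<Rightarrow> ('i cconf \<Rightarrow> real) set" where
  "balanced_set rho = {x. (\<forall>c\<in>cconfs. x c \<ge> 0) \<and> (\<forall>c. c \<notin> cconfs \<longrightarrow> x c = 0) \<and>
     (\<forall>i. (\<Sum>(k, kh)\<in>cconfs. real (k $ i) * x (k, kh)) = rho i \<and>
          (\<Sum>(k, kh)\<in>cconfs. real (kh $ i) * x (k, kh)) = rho i)}"

definition feasible_set :: "('i \<Rightarrow> real) \<Rightarrow> ('i conf \<Rightarrow> real) set" where
  "feasible_set rho = {x. (\<forall>k\<in>confs. x k \<ge> 0) \<and> (\<forall>k. k \<notin> confs \<longrightarrow> x k = 0) \<and>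
     (\<forall>i. (\<Sum>k\<in>confs. real (k $ i) * x k) = rho i)}"

definition Phi :: "real \<Rightarrow> ('i conf \<Rightarrow> real) \<Rightarrow> real" where
  "Phi \<alpha> x = (\<Sum>q\<in>aconfs. inverse (1 + \<alpha>) * (\<Sum>k\<in>q. x k) powr (1 + \<alpha>))"

definition optimal_set :: "real \<Rightarrow> ('i \<Rightarrow> real) \<Rightarrow> ('i conf \<Rightarrow> real) set" where
  "optimal_set \<alpha> rho = {x. is_arg_min (Phi \<alpha>) (\<lambda>x. x \<in> feasible_set rho) x}"

end

section \<open>Continuous-time Markov chains\<close>

text \<open>\<open>P t s\<close> is the law at time \<open>t\<close> of the chain started in \<open>s\<close>.\<close>

definition markov_transition_function :: "'s set \<Rightarrow> (real \<Rightarrow> 's \<Rightarrow> 's pmf) \<Rightarrow> bool" where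
  "markov_transition_function S P \<longleftrightarrow>
     (\<forall>s\<in>S. P 0 s = return_pmf s) \<and>
     (\<forall>t\<ge>0. \<forall>s\<in>S. set_pmf (P t s) \<subseteq> S) \<and>
     (\<forall>t\<ge>0. \<forall>u\<ge>0. \<forall>s\<in>S. P (t + u) s = bind_pmf (P t s) (P u))"

text \<open>The transition function has right derivative at \<open>0\<close> equal to the conservative rate matrix
  with off-diagonal entries \<open>rate\<close>.\<close>

definition has_transition_rates ::
    "'s set \<Rightarrow> (real \<Rightarrow> 's \<Rightarrow> 's pmf) \<Rightarrow> ('s \<Rightarrow> 's \<Rightarrow> real) \<Rightarrow> bool" where
  "has_transition_rates S P rate \<longleftrightarrow>
     (\<forall>s\<in>S. (\<forall>s'\<in>S - {s}. ((\<lambda>h. pmf (P h s) s' / h) \<longlongrightarrow> rate s s') (at_right 0)) \<and>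
        rate s summable_on (S - {s}) \<and>
        ((\<lambda>h. (1 - pmf (P h s) s) / h) \<longlongrightarrow> infsum (rate s) (S - {s})) (at_right 0))"

definition stationary_distribution :: "'s set \<Rightarrow> (real \<Rightarrow> 's \<Rightarrow> 's pmf) \<Rightarrow> 's pmf \<Rightarrow> bool" where
  "stationary_distribution S P p \<longleftrightarrow> set_pmf p \<subseteq> S \<and> (\<forall>t\<ge>0. bind_pmf p (P t) = p)"

section \<open>Distance\<close>

text \<open>Euclidean distance, over the coordinates in the finite index set \<open>A\<close>, from \<open>x\<close> to the set
  \<open>U\<close>.\<close>

definition vec_setdist :: "'a set \<Rightarrow> ('a \<Rightarrow> real) \<Rightarrow> ('a \<Rightarrow> real) set \<Rightarrow> real" where
  "vec_setdist A x U = (INF u\<in>U. L2_set (\<lambda>a. x a - u a) A)"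

end

theory Submission
  imports Defs
begin

text \<open>
  No fluid limit is taken: everything is read off from the inequality \<open>0 \<le> E (L f)\<close> for the
  generator \<open>L\<close> in stationarity, applied to three kinds of test functions \<open>f\<close>.

  A quadratic function of the numbers of actual customers and of tokens shows that both deviate from
  \<open>rho i * r\<close> and \<open>0\<close> only by \<open>O(sqrt r)\<close>.

  The potential \<open>\<Phi>\<close>, with its derivative cut off at \<open>2\<close>, cannot grow at a service completion, since
  the token may always go back. Subtracting a multiple of the number of tokens cancels the growth at
  arrivals that find no token. Hence in the limit no customer can be moved to an available
  a-configuration with a smaller increment.

  This does not yet force optimality, since a class may be occupied only by the wrong configurations.
  For \<open>q\<close> the class of \<open>\<kappa>\<close>, the function \<open>(max 0 (X_q - M * X_\<kappa>))\<^sup>2\<close> shows that an occupied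
  \<open>\<kappa> + e_j\<close> feeds \<open>\<kappa>\<close>, so that \<open>\<kappa>\<close> is occupied as soon as \<open>q\<close> is. With this closure property,
  local stability implies the Karush-Kuhn-Tucker conditions. Compactness turns the exact statement
  about the limit into one about neighbourhoods.
\<close>

section \<open>Generator inequalities for stationary Markov chains\<close>

text \<open>The only moment estimate at hand is \<open>E Q \<le> moment_const * r\<close>, where
  \<open>Q\<close> sums the squared deviations. Every drift must therefore be bounded by a constant
  plus a multiple of \<open>Q\<close>. This dictates the cut-off in the potential: with an unbounded
  derivative, states with many customers would contribute powers beyond \<open>Q\<close>. The level
  2 lies above the limiting scaled mass, which is 1, so the cut-off disappears in the limit. For the
  potential, the error terms are small against \<open>r\<close> once \<open>r\<close> is large. For
  the spread function they are of the same order \<open>r^2\<close> as the gain, and only a factor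
  \<open>1 / M\<close> makes them small; so \<open>M\<close> is fixed before \<open>r\<close> grows.
  Increments belong to classes, whereas the service completions from which the gain is extracted
  take place in configurations. Dismantling a configuration customer by customer needs each
  intermediate configuration itself to be occupied, not merely its class; this is what the closure
  property provides. It holds only with probability near 1, with a threshold depending on that
  probability, and this shapes the final choice of constants.\<close>

lemma infsum_finite_support:
  fixes g :: "'s \<Rightarrow> real"
  assumes "finite T" "T \<subseteq> S" "\<And>s'. s' \<in> S - T \<Longrightarrow> g s' = 0"
  shows "infsum g (S - {s}) = sum g (T - {s})"
proof -
  have "infsum g (S - {s}) = infsum g (T - {s})"
    by (rule infsum_cong_neutral) (use assms in auto)
  then show ?thesis using assms by simp
qed

text \<open>The exit rate from \<open>s\<close> is the sum of the rates into the finite set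
  \<open>T\<close>, so the mass that \<open>P h s\<close> puts outside \<open>T\<close> and
  \<open>s\<close> is \<open>o(h)\<close>, and a bounded \<open>f\<close> does not feel it.\<close>

lemma rate_limit:
  fixes f :: "'s \<Rightarrow> real"
  assumes mt: "markov_transition_function S P" and tr: "has_transition_rates S P rate"
    and s: "s \<in> S" and fin: "finite T" "T \<subseteq> S"
    and z: "\<And>s'. s' \<in> S - T \<Longrightarrow> rate s s' = 0"
    and bd: "\<And>s. s \<in> S \<Longrightarrow> \<bar>f s\<bar> \<le> C"
  shows "((\<lambda>h. (measure_pmf.expectation (P h s) f - f s) / h) \<longlongrightarrow>
          (\<Sum>s'\<in>T. rate s s' * (f s' - f s))) (at_right 0)"
proof -
  define T' where "T' = T - {s}"
  have T': "finite T'" "T' \<subseteq> S - {s}" using fin by (auto simp: T'_def)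
  have sT: "s \<notin> T'" by (simp add: T'_def)
  have C0: "0 \<le> C" using bd[OF s] by linarith
  have lim1: "((\<lambda>h. pmf (P h s) s' / h) \<longlongrightarrow> rate s s') (at_right 0)" if "s' \<in> T'" for s'
    using tr s that T' unfolding has_transition_rates_def by blast
  have lim2: "((\<lambda>h. (1 - pmf (P h s) s) / h) \<longlongrightarrow> sum (rate s) T') (at_right 0)"
  proof -
    have "((\<lambda>h. (1 - pmf (P h s) s) / h) \<longlongrightarrow> infsum (rate s) (S - {s})) (at_right 0)"
      using tr s unfolding has_transition_rates_def by blast
    then show ?thesis
      using infsum_finite_support[where g="rate s" and s=s, OF fin z] by (simp add: T'_def)
  qed
  \<comment> \<open>This is \<open>2 * C / h\<close> times the mass of \<open>P h s\<close> outside
    \<open>insert s T'\<close>; it vanishes because the limits in \<open>lim1\<close> and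
    \<open>lim2\<close> cancel.\<close>
  define e where "e h = 2 * C * ((1 - pmf (P h s) s) / h - (\<Sum>s'\<in>T'. pmf (P h s) s' / h))" for h
  have e0: "(e \<longlongrightarrow> 0) (at_right 0)"
    unfolding e_def by (rule tendsto_eq_intros lim1 lim2 refl | simp)+
  define g where "g h = (\<Sum>s'\<in>T'. pmf (P h s) s' / h * (f s' - f s))" for h
  have glim: "(g \<longlongrightarrow> (\<Sum>s'\<in>T'. rate s s' * (f s' - f s))) (at_right 0)"
    unfolding g_def by (intro tendsto_intros lim1)
  have bound: "\<bar>(measure_pmf.expectation (P h s) f - f s) / h - g h\<bar> \<le> e h" if h: "h > 0" for h
  proof -
    let ?M = "measure_pmf (P h s)"
    have supp: "set_pmf (P h s) \<subseteq> S"
      using mt s h unfolding markov_transition_function_def by simp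
    have AEb: "AE x in ?M. \<bar>f x\<bar> \<le> C" using supp bd by (auto simp: AE_measure_pmf_iff)
    have intf: "integrable ?M f"
      by (rule measure_pmf.integrable_const_bound[where B=C]) (use AEb in auto)
    let ?R = "- insert s T'"
    have decomp: "f x - f s = (\<Sum>s'\<in>T'. indicator {s'} x * (f s' - f s)) + indicator ?R x * (f x - f s)"
      for x
    proof (cases "x \<in> T'")
      case True
      then have "(\<Sum>s'\<in>T'. indicator {s'} x * (f s' - f s)) = (\<Sum>s'\<in>T'. if s' = x then f x - f s else 0)"
        by (intro sum.cong) (auto simp: indicator_def)
      then show ?thesis using True T' by (simp add: sum.delta)
    next
      case False
      then have "(\<Sum>s'\<in>T'. indicator {s'} x * (f s' - f s)) = 0"
        by (intro sum.neutral) (auto simp: indicator_def)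
      then show ?thesis using False by (auto simp: indicator_def)
    qed
    have int1: "integrable ?M (\<lambda>x. indicator ?R x * (f x - f s))"
      by (rule measure_pmf.integrable_const_bound[where B="2 * C"])
        (use AEb bd[OF s] C0 in \<open>auto simp: AE_measure_pmf_iff indicator_def abs_le_iff\<close>)
    have int2: "integrable ?M (\<lambda>x. \<Sum>s'\<in>T'. indicator {s'} x * (f s' - f s))"
      by (intro Bochner_Integration.integrable_sum integrable_mult_left
            measure_pmf.integrable_const_bound[where B=1]) (auto simp: indicator_def)
    have "measure_pmf.expectation (P h s) f - f s = (\<integral>x. f x - f s \<partial>?M)"
      using intf by simp
    also have "\<dots> = (\<integral>x. (\<Sum>s'\<in>T'. indicator {s'} x * (f s' - f s)) + indicator ?R x * (f x - f s) \<partial>?M)"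
      using decomp by presburger
    also have "\<dots> = (\<Sum>s'\<in>T'. pmf (P h s) s' * (f s' - f s)) + (\<integral>x. indicator ?R x * (f x - f s) \<partial>?M)"
    proof -
      have "(\<integral>x. (\<Sum>s'\<in>T'. indicator {s'} x * (f s' - f s)) \<partial>?M) = (\<Sum>s'\<in>T'. pmf (P h s) s' * (f s' - f s))"
      proof -
        have "(\<integral>x. (\<Sum>s'\<in>T'. indicator {s'} x * (f s' - f s)) \<partial>?M)
           = (\<Sum>s'\<in>T'. (\<integral>x. indicator {s'} x * (f s' - f s) \<partial>?M))"
          by (intro Bochner_Integration.integral_sum integrable_mult_left
            measure_pmf.integrable_const_bound[where B=1]) (auto simp: indicator_def)
        also have "\<dots> = (\<Sum>s'\<in>T'. pmf (P h s) s' * (f s' - f s))"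
          by (intro sum.cong) (auto simp: measure_pmf_single)
        finally show ?thesis .
      qed
      then show ?thesis using int1 int2 by simp
    qed
    finally have E: "measure_pmf.expectation (P h s) f - f s =
        (\<Sum>s'\<in>T'. pmf (P h s) s' * (f s' - f s)) + (\<integral>x. indicator ?R x * (f x - f s) \<partial>?M)" .
    have "\<bar>\<integral>x. indicator ?R x * (f x - f s) \<partial>?M\<bar> \<le> (\<integral>x. \<bar>indicator ?R x * (f x - f s)\<bar> \<partial>?M)"
      by (rule integral_abs_bound)
    also have "\<dots> \<le> (\<integral>x. indicator ?R x * (2 * C) \<partial>?M)"
    proof (rule integral_mono_AE)
      show "integrable ?M (\<lambda>x. indicator ?R x * (2 * C))"
        by (intro integrable_mult_left measure_pmf.integrable_const_bound[where B=1]) (auto simp: indicator_def)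
      show "AE x in ?M. \<bar>indicator ?R x * (f x - f s)\<bar> \<le> indicator ?R x * (2 * C)"
        using AEb bd[OF s] by (auto simp: AE_measure_pmf_iff indicator_def)
    qed (use int1 in auto)
    also have "\<dots> = 2 * C * measure ?M ?R" by simp
    also have "measure ?M ?R = 1 - measure ?M (insert s T')"
      by (subst measure_pmf.prob_compl[symmetric]) (auto simp: Compl_eq_Diff_UNIV)
    also have "measure ?M (insert s T') = pmf (P h s) s + (\<Sum>s'\<in>T'. pmf (P h s) s')"
      using T' sT by (subst measure_measure_pmf_finite) auto
    finally have "\<bar>\<integral>x. indicator ?R x * (f x - f s) \<partial>?M\<bar> \<le>
      2 * C * (1 - (pmf (P h s) s + (\<Sum>s'\<in>T'. pmf (P h s) s')))" .
    then have "\<bar>\<integral>x. indicator ?R x * (f x - f s) \<partial>?M\<bar> / h \<le>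
      2 * C * (1 - (pmf (P h s) s + (\<Sum>s'\<in>T'. pmf (P h s) s'))) / h"
      using h by (simp add: divide_right_mono)
    also have "\<dots> = e h" unfolding e_def by (simp add: sum_divide_distrib[symmetric] diff_divide_distrib add_divide_distrib algebra_simps)
    finally have fin': "\<bar>\<integral>x. indicator ?R x * (f x - f s) \<partial>?M\<bar> / h \<le> e h" .
    have "(measure_pmf.expectation (P h s) f - f s) / h - g h = (\<integral>x. indicator ?R x * (f x - f s) \<partial>?M) / h"
      unfolding E g_def by (simp add: add_divide_distrib sum_divide_distrib)
    then show ?thesis using fin' h by simp
  qed
  have "((\<lambda>h. (measure_pmf.expectation (P h s) f - f s) / h - g h) \<longlongrightarrow> 0) (at_right 0)"
    by (rule Lim_null_comparison[OF _ e0])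
      (use bound in \<open>auto simp: eventually_at_right_less intro: eventually_at_rightI[of 0 1]\<close>)
  from tendsto_add[OF this glim]
  have "((\<lambda>h. (measure_pmf.expectation (P h s) f - f s) / h) \<longlongrightarrow> (\<Sum>s'\<in>T'. rate s s' * (f s' - f s))) (at_right 0)"
    by simp
  moreover have "(\<Sum>s'\<in>T'. rate s s' * (f s' - f s)) = (\<Sum>s'\<in>T. rate s s' * (f s' - f s))"
    unfolding T'_def using fin by (intro sum.mono_neutral_left) auto
  ultimately show ?thesis by simp
qed

section \<open>Stationary chains with finitely many successors per state\<close>

locale stationary_chain =
  fixes S :: "'s set" and P :: "real \<Rightarrow> 's \<Rightarrow> 's pmf" and rate :: "'s \<Rightarrow> 's \<Rightarrow> real"
    and p :: "'s pmf" and T :: "'s \<Rightarrow> 's set"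
  assumes markov: "markov_transition_function S P"
    and rates: "has_transition_rates S P rate"
    and stationary: "stationary_distribution S P p"
    and finite_successors: "\<And>s. s \<in> S \<Longrightarrow> finite (T s)"
    and successors_subset: "\<And>s. s \<in> S \<Longrightarrow> T s \<subseteq> S"
    and rate_outside: "\<And>s s'. s \<in> S \<Longrightarrow> s' \<in> S - T s \<Longrightarrow> rate s s' = 0"
    and rate_nonneg: "\<And>s s'. s \<in> S \<Longrightarrow> s' \<in> S \<Longrightarrow> rate s s' \<ge> 0"
begin

definition generator :: "('s \<Rightarrow> real) \<Rightarrow> 's \<Rightarrow> real" where
  "generator f s = (\<Sum>s'\<in>T s. rate s s' * (f s' - f s))"

lemma set_pmf_stationary: "set_pmf p \<subseteq> S"
  using stationary by (simp add: stationary_distribution_def)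

text \<open>By stationarity the mean change of the bounded function \<open>f = min V n\<close> over
  time \<open>h\<close> is 0. Outside the sublevel set \<open>f\<close> already has its largest
  value, so those states contribute nothing positive. What remains is a finite sum, which may be
  divided by \<open>h\<close> and passed to the limit.\<close>

lemma truncated_drift_nonneg:
  assumes V0: "\<And>s. s \<in> S \<Longrightarrow> V s \<ge> 0" and fin: "finite {s\<in>S. V s < (n::real)}"
  shows "0 \<le> (\<Sum>s\<in>{s\<in>S. V s < n}. pmf p s * generator V s)"
proof -
  define A where "A = {s\<in>S. V s < n}"
  define f where "f s = (if s \<in> S then min (V s) n else 0)" for s
  have n: "\<bar>f s\<bar> \<le> \<bar>n\<bar>" for s using V0[of s] by (auto simp: f_def)
  define G where "G f s = (\<Sum>s'\<in>T s. rate s s' * (f s' - f s))" for f s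
  have lim: "((\<lambda>h. \<Sum>s\<in>A. pmf p s * ((measure_pmf.expectation (P h s) f - f s) / h)) \<longlongrightarrow>
     (\<Sum>s\<in>A. pmf p s * generator f s)) (at_right 0)"
    unfolding generator_def
    by (intro tendsto_intros rate_limit[OF markov rates _ _ _ _ n])
      (auto simp: A_def finite_successors successors_subset[THEN subsetD] intro: rate_outside)
  have pos: "0 \<le> (\<Sum>s\<in>A. pmf p s * ((measure_pmf.expectation (P h s) f - f s) / h))" if h: "h > 0" for h
  proof -
    have supp: "set_pmf (P h s) \<subseteq> S" if "s \<in> S" for s
      using markov that h unfolding markov_transition_function_def by simp
    have Ebd: "\<bar>measure_pmf.expectation (P h s) f\<bar> \<le> \<bar>n\<bar>" if s: "s \<in> S" for s
    proof -
      have ae: "AE x in measure_pmf (P h s). \<bar>f x\<bar> \<le> \<bar>n\<bar>"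
        using supp[OF s] n by (auto simp: AE_measure_pmf_iff)
      have "integrable (measure_pmf (P h s)) f"
        by (rule measure_pmf.integrable_const_bound[where B="\<bar>n\<bar>"]) (use ae in auto)
      then have "measure_pmf.expectation (P h s) (\<lambda>x. \<bar>f x\<bar>) \<le> \<bar>n\<bar>"
        by (intro measure_pmf.integral_le_const) (use ae in auto)
      moreover have "\<bar>measure_pmf.expectation (P h s) f\<bar> \<le> measure_pmf.expectation (P h s) (\<lambda>x. \<bar>f x\<bar>)"
        by (rule integral_abs_bound)
      ultimately show ?thesis by linarith
    qed
    have Ele: "measure_pmf.expectation (P h s) f \<le> n" if s: "s \<in> S" for s
    proof (rule measure_pmf.integral_le_const)
      show "integrable (measure_pmf (P h s)) f"
        by (rule measure_pmf.integrable_const_bound[where B="\<bar>n\<bar>"])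
          (use supp[OF s] n in \<open>auto simp: AE_measure_pmf_iff\<close>)
    qed (use supp[OF s] in \<open>auto simp: f_def AE_measure_pmf_iff\<close>)
    have bp: "bind_pmf p (P h) = p" using stationary h by (simp add: stationary_distribution_def)
    have "measure_pmf.expectation p (\<lambda>s. measure_pmf.expectation (P h s) f) =
          measure_pmf.expectation (bind_pmf p (P h)) f"
      unfolding measure_pmf_bind
      by (rule integral_bind[symmetric, where K="count_space UNIV" and B="\<bar>n\<bar>" and B'=1])
        (use n supp set_pmf_stationary in
          \<open>auto simp: AE_measure_pmf_iff measure_pmf.emeasure_space_1[unfolded space_measure_pmf]
             measure_pmf_in_subprob_algebra intro!: \<close>)
    then have eq: "measure_pmf.expectation p (\<lambda>s. measure_pmf.expectation (P h s) f) = measure_pmf.expectation p f"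
      by (simp add: bp)
    have i1: "integrable p (\<lambda>s. measure_pmf.expectation (P h s) f)"
      by (rule measure_pmf.integrable_const_bound[where B="\<bar>n\<bar>"])
        (use set_pmf_stationary Ebd in \<open>auto simp: AE_measure_pmf_iff\<close>)
    have i2: "integrable p f"
      by (rule measure_pmf.integrable_const_bound[where B="\<bar>n\<bar>"])
        (use set_pmf_stationary n in \<open>auto simp: AE_measure_pmf_iff\<close>)
    have "0 = measure_pmf.expectation p (\<lambda>s. measure_pmf.expectation (P h s) f - f s)"
      using i1 i2 eq by simp
    also have "\<dots> \<le> measure_pmf.expectation p (\<lambda>s. (measure_pmf.expectation (P h s) f - f s) * indicator A s)"
    proof (rule integral_mono_AE)
      show "integrable p (\<lambda>s. (measure_pmf.expectation (P h s) f - f s) * indicator A s)"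
        using integrable_mult_indicator[of A "measure_pmf p" "\<lambda>s. measure_pmf.expectation (P h s) f - f s"] i1 i2
        by (simp add: mult.commute)
      show "AE s in p. measure_pmf.expectation (P h s) f - f s
           \<le> (measure_pmf.expectation (P h s) f - f s) * indicator A s"
        using set_pmf_stationary Ele by (force simp: AE_measure_pmf_iff indicator_def A_def f_def)
    qed (use i1 i2 in auto)
    also have "\<dots> = (\<Sum>s\<in>A. (measure_pmf.expectation (P h s) f - f s) * indicator A s * pmf p s)"
      by (rule integral_measure_pmf_real) (use fin in \<open>auto simp: A_def indicator_def split: if_splits\<close>)
    finally have "0 \<le> (\<Sum>s\<in>A. (measure_pmf.expectation (P h s) f - f s) * indicator A s * pmf p s) / h"
      using h by simp
    also have "\<dots> = (\<Sum>s\<in>A. pmf p s * ((measure_pmf.expectation (P h s) f - f s) / h))"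
      unfolding sum_divide_distrib by (intro sum.cong) auto
    finally show ?thesis .
  qed
  have "0 \<le> (\<Sum>s\<in>A. pmf p s * generator f s)"
    by (rule tendsto_lowerbound[OF lim], rule eventually_at_rightI[of 0 1], rule pos) auto
  \<comment> \<open>On the sublevel set \<open>f = V\<close>, and \<open>f \<le> V\<close> at all
    successors, so replacing \<open>f\<close> by \<open>V\<close> can only raise the
    generator.\<close>
  also have "\<dots> \<le> (\<Sum>s\<in>A. pmf p s * generator V s)"
    unfolding generator_def
    by (intro sum_mono mult_left_mono)
      (use successors_subset in \<open>auto simp: A_def f_def min_def intro: rate_nonneg\<close>)
  finally show ?thesis unfolding A_def .
qed

text \<open>Foster-Lyapunov argument: on each finite sublevel set the truncated drift inequality
  bounds the partial mean of \<open>U\<close> by \<open>C\<close>, and Fatou's lemma removes the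
  truncation.\<close>

lemma foster_bound:
  fixes U V :: "'s \<Rightarrow> real"
  assumes V0: "\<And>s. s \<in> S \<Longrightarrow> V s \<ge> 0" and fin: "\<And>n. finite {s\<in>S. V s < (n::real)}"
    and drift: "\<And>s. s \<in> S \<Longrightarrow> generator V s \<le> C - U s"
    and U0: "\<And>s. U s \<ge> 0" and C0: "C \<ge> 0"
  shows "integrable p U" "measure_pmf.expectation p U \<le> C"
proof -
  define A where "A n = {s\<in>S. V s < real n}" for n
  have fA: "finite (A n)" for n using fin by (simp add: A_def)
  have sub: "(\<Sum>s\<in>A n. pmf p s * U s) \<le> C" for n
  proof -
    have "0 \<le> (\<Sum>s\<in>A n. pmf p s * generator V s)"
      unfolding A_def by (rule truncated_drift_nonneg[OF V0 fin])
    also have "\<dots> \<le> (\<Sum>s\<in>A n. pmf p s * (C - U s))"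
      by (intro sum_mono mult_left_mono drift) (auto simp: A_def)
    also have "\<dots> = C * (\<Sum>s\<in>A n. pmf p s) - (\<Sum>s\<in>A n. pmf p s * U s)"
      by (simp add: sum_subtractf sum_distrib_left algebra_simps)
    finally have "(\<Sum>s\<in>A n. pmf p s * U s) \<le> C * (\<Sum>s\<in>A n. pmf p s)" by simp
    also have "(\<Sum>s\<in>A n. pmf p s) = measure p (A n)" using fA by (simp add: measure_measure_pmf_finite)
    also have "C * measure p (A n) \<le> C * 1" by (intro mult_left_mono C0) auto
    finally show ?thesis by simp
  qed
  have conv: "(\<lambda>n. U s * indicator (A n) s) \<longlonglongrightarrow> U s" if "s \<in> S" for s
  proof (rule tendsto_eventually)
    obtain N where N: "V s < real N" using reals_Archimedean2 by blast
    then show "\<forall>\<^sub>F n in sequentially. U s * indicator (A n) s = U s"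
      using that by (intro eventually_sequentiallyI[of N]) (auto simp: A_def indicator_def)
  qed
  have nn: "(\<integral>\<^sup>+ s. ennreal (U s) \<partial>p) \<le> ennreal C"
  proof -
    have "(\<integral>\<^sup>+ s. ennreal (U s) \<partial>p) = (\<integral>\<^sup>+ s. liminf (\<lambda>n. ennreal (U s * indicator (A n) s)) \<partial>p)"
    proof (rule nn_integral_cong_AE)
      show "AE s in p. ennreal (U s) = liminf (\<lambda>n. ennreal (U s * indicator (A n) s))"
        unfolding AE_measure_pmf_iff
      proof
        fix s assume "s \<in> set_pmf p"
        then have "(\<lambda>n. ennreal (U s * indicator (A n) s)) \<longlonglongrightarrow> ennreal (U s)"
          using conv set_pmf_stationary by (intro tendsto_ennrealI) auto
        then show "ennreal (U s) = liminf (\<lambda>n. ennreal (U s * indicator (A n) s))"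
          by (simp add: lim_imp_Liminf)
      qed
    qed
    also have "\<dots> \<le> liminf (\<lambda>n. (\<integral>\<^sup>+ s. ennreal (U s * indicator (A n) s) \<partial>p))"
      by (rule nn_integral_liminf) simp
    also have "\<dots> \<le> liminf (\<lambda>n. ennreal C)"
    proof (rule Liminf_mono, rule always_eventually, rule allI)
      fix n
      have "U s * indicator (A n) s \<le> (\<Sum>a\<in>A n. U a)" for s
        using member_le_sum[OF _ _ fA, of s n U] sum_nonneg[of "A n" U] U0 by (auto simp: indicator_def)
      then have "integrable p (\<lambda>s. U s * indicator (A n) s)"
        using U0 by (intro measure_pmf.integrable_const_bound[where B="\<Sum>a\<in>A n. U a"]) auto
      then have "(\<integral>\<^sup>+ s. ennreal (U s * indicator (A n) s) \<partial>p) = ennreal (\<integral>s. U s * indicator (A n) s \<partial>p)"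
        using U0 by (intro nn_integral_eq_integral) auto
      also have "(\<integral>s. U s * indicator (A n) s \<partial>p) = (\<Sum>s\<in>A n. pmf p s * U s)"
        by (subst integral_measure_pmf[OF fA]) (auto simp: indicator_def split: if_splits)
      finally show "(\<integral>\<^sup>+ s. ennreal (U s * indicator (A n) s) \<partial>p) \<le> ennreal C"
        using sub by (simp add: ennreal_leI)
    qed
    finally show ?thesis by (simp add: Liminf_const)
  qed
  show int: "integrable p U"
    using U0 le_less_trans[OF nn] by (intro integrableI_nonneg) auto
  have "ennreal (measure_pmf.expectation p U) = (\<integral>\<^sup>+ s. ennreal (U s) \<partial>p)"
    by (rule nn_integral_eq_integral[symmetric, OF int]) (use U0 in auto)
  then show "measure_pmf.expectation p U \<le> C"
    using nn C0 by (metis ennreal_le_iff)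
qed

lemma generator_add: "generator (\<lambda>s. f s + c * g s + d) s = generator f s + c * generator g s"
  unfolding generator_def
  by (simp add: sum_distrib_left algebra_simps sum_subtractf sum.distrib)

text \<open>The penalty \<open>e * V\<close> makes the sublevel sets of \<open>f + e * V\<close> finite, so that
  \<open>f\<close> itself may be unbounded from below.\<close>

lemma stationary_generator_nonneg:
  fixes f V W :: "'s \<Rightarrow> real"
  assumes V0: "\<And>s. s \<in> S \<Longrightarrow> V s \<ge> 0" and fin: "\<And>n. finite {s\<in>S. V s < (n::real)}"
    and drift: "\<And>s. s \<in> S \<Longrightarrow> generator V s \<le> C"
    and low: "\<And>e. e > 0 \<Longrightarrow> \<exists>c. \<forall>s\<in>S. f s \<ge> - c - e * V s"
    and fW: "\<And>s. s \<in> S \<Longrightarrow> generator f s \<le> W s"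
    and int: "integrable p W"
  shows "0 \<le> measure_pmf.expectation p W"
proof -
  define C' where "C' = max C 0"
  have C': "C' \<ge> 0" "\<And>s. s \<in> S \<Longrightarrow> generator V s \<le> C'" using drift by (auto simp: C'_def le_max_iff_disj)
  have *: "0 \<le> measure_pmf.expectation p W + 2 * e * C'" if e: "e > 0" for e
  proof -
    obtain c where c: "\<forall>s\<in>S. f s \<ge> - c - e * V s" using low[OF e] by blast
    \<comment> \<open>One \<open>e * V\<close> together with \<open>c\<close> offsets the lower
      bound \<open>low\<close>; the other one survives, so that \<open>F \<ge> e * V\<close> is
      non-negative with finite sublevel sets.\<close>
    define F where "F s = f s + (2 * e) * V s + c" for s
    have F: "F s \<ge> e * V s" if "s \<in> S" for s using c that by (auto simp: F_def)
    have F0: "F s \<ge> 0" if "s \<in> S" for s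
    proof -
      have "0 \<le> e * V s" using V0[OF that] e by simp
      then show ?thesis using F[OF that] by linarith
    qed
    have finF: "finite {s\<in>S. F s < n}" for n
    proof (rule finite_subset[OF _ fin[of "n / e"]])
      show "{s \<in> S. F s < n} \<subseteq> {s \<in> S. V s < n / e}"
        using F e by (force simp: field_simps)
    qed
    define A where "A n = {s\<in>S. F s < real n}" for n
    have fA: "finite (A n)" for n using finF by (simp add: A_def)
    have step: "0 \<le> measure_pmf.expectation p (\<lambda>s. W s * indicator (A n) s) + 2 * e * C'" for n
    proof -
      have "0 \<le> (\<Sum>s\<in>A n. pmf p s * generator F s)"
        unfolding A_def by (rule truncated_drift_nonneg[OF F0 finF])
      also have "\<dots> \<le> (\<Sum>s\<in>A n. pmf p s * (W s + (2 * e) * C'))"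
        unfolding F_def generator_add
        by (intro sum_mono mult_left_mono add_mono fW C') (use e in \<open>auto simp: A_def\<close>)
      also have "\<dots> = (\<Sum>s\<in>A n. pmf p s * W s) + (2 * e) * C' * (\<Sum>s\<in>A n. pmf p s)"
        by (simp add: sum.distrib sum_distrib_left algebra_simps)
      also have "(\<Sum>s\<in>A n. pmf p s) = measure p (A n)" using fA by (simp add: measure_measure_pmf_finite)
      also have "(2 * e) * C' * measure p (A n) \<le> (2 * e) * C' * 1"
        using e C' by (intro mult_left_mono) auto
      also have "(\<Sum>s\<in>A n. pmf p s * W s) = measure_pmf.expectation p (\<lambda>s. W s * indicator (A n) s)"
        by (subst integral_measure_pmf[OF fA]) (auto simp: indicator_def split: if_splits)
      finally show ?thesis by simp
    qed
    have "(\<lambda>n. measure_pmf.expectation p (\<lambda>s. W s * indicator (A n) s)) \<longlonglongrightarrow> measure_pmf.expectation p W"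
    proof (rule integral_dominated_convergence[where w="\<lambda>s. \<bar>W s\<bar>"])
      show "AE s in p. (\<lambda>n. W s * indicator (A n) s) \<longlonglongrightarrow> W s"
        unfolding AE_measure_pmf_iff
      proof
        fix s assume "s \<in> set_pmf p"
        then have s: "s \<in> S" using set_pmf_stationary by auto
        obtain N where N: "F s < real N" using reals_Archimedean2 by blast
        then show "(\<lambda>n. W s * indicator (A n) s) \<longlonglongrightarrow> W s"
          using s by (intro tendsto_eventually eventually_sequentiallyI[of N]) (auto simp: A_def indicator_def)
      qed
    qed (use int in \<open>auto simp: indicator_def\<close>)
    then have "(\<lambda>n. measure_pmf.expectation p (\<lambda>s. W s * indicator (A n) s) + 2 * e * C')
       \<longlonglongrightarrow> measure_pmf.expectation p W + 2 * e * C'" by (intro tendsto_intros)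
    then show ?thesis by (rule LIMSEQ_le_const) (use step in auto)
  qed
  show ?thesis
  proof (rule field_le_epsilon)
    fix d :: real assume d: "d > 0"
    have "0 \<le> measure_pmf.expectation p W + 2 * (d / (2 * (C' + 1))) * C'"
      using C' d by (intro *) auto
    also have "2 * (d / (2 * (C' + 1))) * C' \<le> d" using C' d by (simp add: field_simps)
    finally show "0 \<le> measure_pmf.expectation p W + d" by simp
  qed
qed

end

section \<open>Configurations and placement\<close>

text \<open>Keeps the unit vectors \<open>axis i 1\<close> in the form in which the definitions use them.\<close>

declare One_nat_def [simp del]

lemma finite_vec_bounded: "finite {k :: nat ^ 'i::finite. \<forall>i. k $ i \<le> m}"
proof -
  have "{k :: nat ^ 'i. \<forall>i. k $ i \<le> m} \<subseteq> (\<lambda>f. \<chi> i. f i) ` (UNIV \<rightarrow>\<^sub>E {..m})"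
  proof
    fix k :: "nat ^ 'i" assume "k \<in> {k. \<forall>i. k $ i \<le> m}"
    then have "(\<lambda>i. k $ i) \<in> UNIV \<rightarrow>\<^sub>E {..m}" "k = (\<chi> i. k $ i)" by auto
    then show "k \<in> (\<lambda>f. \<chi> i. f i) ` (UNIV \<rightarrow>\<^sub>E {..m})" by blast
  qed
  then show ?thesis by (rule finite_subset) (simp add: finite_PiE)
qed

lemma finite_vec_le: "finite {kh :: nat ^ 'i::finite. kh \<le> k}"
proof (rule finite_subset[OF _ finite_vec_bounded])
  show "{kh. kh \<le> k} \<subseteq> {kh. \<forall>i. kh $ i \<le> (\<Sum>i\<in>UNIV. k $ i)}"
    using le_trans[OF _ member_le_sum[of _ UNIV "\<lambda>i. k $ i"]] by (auto simp: less_eq_vec_def)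
qed

lemma vec_eq_zero_iff_nat: "(k :: nat ^ 'i::finite) = 0 \<longleftrightarrow> (\<forall>i. k $ i = 0)"
  by (simp add: vec_eq_iff)

lemma diff_add_axis: "k $ i > 0 \<Longrightarrow> k - axis i 1 + axis i 1 = (k :: nat ^ 'i::finite)"
  by (auto simp: vec_eq_iff axis_def)

lemma axis_component: "(axis i (m::nat) :: nat ^ 'i::finite) $ j = (if j = i then m else 0)"
  by (simp add: axis_def)

locale packing =
  fixes B :: "'n::finite \<Rightarrow> real" and b :: "'i::finite \<Rightarrow> 'n \<Rightarrow> real"
  assumes B_pos: "\<And>n. B n > 0" and b_pos: "\<And>i n. b i n > 0"
    and unit_conf: "\<And>i. axis i 1 \<in> confs0 B b"
begin

abbreviation "K0 \<equiv> confs0 B b"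
abbreviation "K \<equiv> confs B b"
abbreviation "CK \<equiv> cconfs B b"
abbreviation "St \<equiv> states B b"

section \<open>Loads, and classes of equal load\<close>

definition load :: "'i conf \<Rightarrow> 'n \<Rightarrow> real" where
  "load k n = (\<Sum>i\<in>UNIV. real (k $ i) * b i n)"

text \<open>The a-configuration of \<open>k\<close>, so that statements about a-configurations can
  be made through representatives. It is empty for \<open>k\<close> outside
  \<open>K0\<close>.\<close>

definition cls :: "'i conf \<Rightarrow> 'i conf set" where
  "cls k = aconf_rel B b `` {k}"

lemma load_zero [simp]: "load 0 n = 0" by (simp add: load_def)

lemma load_axis: "load (axis i 1) n = b i n"
proof -
  have "load (axis i 1) n = (\<Sum>j\<in>UNIV. if j = i then b i n else 0)"
    unfolding load_def by (intro sum.cong) (auto simp: axis_component)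
  then show ?thesis by simp
qed

lemma load_add: "load (k + k') n = load k n + load k' n"
  by (simp add: load_def sum.distrib algebra_simps)

lemma load_mono: "k \<le> k' \<Longrightarrow> load k n \<le> load k' n"
  unfolding load_def using b_pos[THEN less_imp_le] by (intro sum_mono mult_right_mono) (auto simp: less_eq_vec_def)

lemma load_pos: "k \<noteq> 0 \<Longrightarrow> load k n > 0"
proof -
  assume "k \<noteq> 0"
  then obtain i where i: "k $ i \<noteq> 0" by (auto simp: vec_eq_zero_iff_nat)
  have "0 < real (k $ i) * b i n" using i b_pos by simp
  also have "\<dots> \<le> load k n"
    unfolding load_def using less_imp_le[OF b_pos] by (intro member_le_sum) auto
  finally show ?thesis .
qed

lemma K0_iff: "k \<in> K0 \<longleftrightarrow> (\<forall>n. load k n \<le> B n)"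
  by (simp add: confs0_def load_def)

lemma K0_mono: "k \<in> K0 \<Longrightarrow> k' \<le> k \<Longrightarrow> k' \<in> K0"
  unfolding K0_iff using load_mono order_trans by blast

lemma zero_K0 [simp]: "0 \<in> K0" using B_pos by (simp add: K0_iff less_imp_le)

lemma K_iff: "k \<in> K \<longleftrightarrow> k \<in> K0 \<and> k \<noteq> 0" by (auto simp: confs_def)

lemma finite_K0: "finite K0"
proof -
  fix n :: 'n
  define m where "m = nat \<lceil>Max (range (\<lambda>i. B n / b i n))\<rceil>"
  have "k $ i \<le> m" if "k \<in> K0" for k i
  proof -
    have "real (k $ i) * b i n \<le> load k n"
      unfolding load_def using less_imp_le[OF b_pos] by (intro member_le_sum) auto
    also have "\<dots> \<le> B n" using that by (simp add: K0_iff)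
    finally have "real (k $ i) \<le> B n / b i n" using b_pos by (simp add: pos_le_divide_eq)
    also have "\<dots> \<le> Max (range (\<lambda>i. B n / b i n))" by (rule Max_ge) auto
    finally show ?thesis unfolding m_def by linarith
  qed
  then have "K0 \<subseteq> {k. \<forall>i. k $ i \<le> m}" by auto
  then show ?thesis using finite_vec_bounded by (rule finite_subset)
qed

lemma finite_K: "finite K" using finite_K0 by (simp add: confs_def)

lemma CK_iff: "c \<in> CK \<longleftrightarrow> fst c \<in> K \<and> snd c \<le> fst c"
  by (cases c) (auto simp: cconfs_def K_iff intro: K0_mono)

lemma finite_CK: "finite CK"
proof -
  have "CK \<subseteq> K0 \<times> K0" by (auto simp: cconfs_def confs_def)
  then show ?thesis by (rule finite_subset) (simp add: finite_K0)
qed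

lemma mem_cls: "k' \<in> cls k \<longleftrightarrow> k \<in> K0 \<and> k' \<in> K0 \<and> load k = load k'"
  by (auto simp: cls_def aconf_rel_def load_def fun_eq_iff)

lemma cls_self [simp]: "k \<in> K0 \<Longrightarrow> k \<in> cls k" by (simp add: mem_cls)

lemma cls_eq_iff: "k \<in> K0 \<Longrightarrow> k' \<in> K0 \<Longrightarrow> cls k = cls k' \<longleftrightarrow> load k = load k'"
  by (auto simp: mem_cls set_eq_iff)

lemma cls_eq: "k' \<in> cls k \<Longrightarrow> cls k' = cls k"
  by (auto simp: mem_cls set_eq_iff)

lemma zero_cls: "aconf_zero B b = cls 0" by (simp add: aconf_zero_def cls_def)

text \<open>Every customer needs a positive amount of each resource, so a nonempty configuration has
  positive load; \<open>undefined\<close> stands for an arbitrary resource.\<close>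

lemma cls_eq_zero_iff: "k \<in> K0 \<Longrightarrow> cls k = cls 0 \<longleftrightarrow> k = 0"
  using load_pos[of k undefined] cls_eq_iff[of k 0] by (metis less_irrefl load_zero zero_K0)

lemma cls_zero: "cls 0 = {0}"
proof -
  have "k = 0" if "k \<in> cls 0" for k
  proof -
    have "k \<in> K0" using that by (simp add: mem_cls)
    then show ?thesis using cls_eq[OF that] cls_eq_zero_iff by simp
  qed
  then show ?thesis by auto
qed

lemma aconfs0_iff: "q \<in> aconfs0 B b \<longleftrightarrow> (\<exists>k\<in>K0. q = cls k)"
  by (auto simp: aconfs0_def quotient_def cls_def)

lemma aconfs_iff: "q \<in> aconfs B b \<longleftrightarrow> (\<exists>k\<in>K. q = cls k)"
  by (auto simp: aconfs_def aconfs0_iff zero_cls K_iff cls_eq_zero_iff)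

lemma cls_subset: "cls k \<subseteq> K0" by (auto simp: mem_cls)

lemma cls_subset_K: "k \<in> K \<Longrightarrow> cls k \<subseteq> K"
proof
  fix k' assume k: "k \<in> K" "k' \<in> cls k"
  then have "cls k' = cls k" "k' \<in> K0" "k \<in> K0" "k \<noteq> 0" by (auto simp: cls_eq K_iff mem_cls)
  then show "k' \<in> K" using cls_eq_zero_iff by (metis K_iff)
qed

lemma finite_aconfs: "finite (aconfs B b)"
proof -
  have "aconfs B b = cls ` K" using aconfs_iff by auto
  then show ?thesis using finite_K by simp
qed

lemma can_add_cls: "k \<in> K0 \<Longrightarrow> can_add B b (cls k) i \<longleftrightarrow> k + axis i 1 \<in> K0"
  by (auto simp: can_add_def mem_cls K0_iff load_add)

lemma aconf_add_cls: "k + axis i 1 \<in> K0 \<Longrightarrow> k \<in> K0 \<Longrightarrow> aconf_add B b (cls k) i = cls (k + axis i 1)"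
  by (auto simp: aconf_add_def cls_def aconf_rel_def load_def[symmetric] load_add K0_iff Image_def)

lemma cls_add_neq: "k \<in> K0 \<Longrightarrow> k + axis i 1 \<in> K0 \<Longrightarrow> cls (k + axis i 1) \<noteq> cls k"
  using b_pos[of i undefined] cls_eq_iff[of "k + axis i 1" k]
  by (metis add_cancel_left_right less_irrefl load_add load_axis)

lemma add_axis_nonzero: "(k :: 'i conf) + axis i 1 \<noteq> 0"
  by (auto simp: vec_eq_iff axis_component intro!: exI[of _ i])

lemma minus_K0: "k \<in> K0 \<Longrightarrow> k - k' \<in> K0"
  by (erule K0_mono) (auto simp: less_eq_vec_def)

section \<open>Counts as linear functionals of the complete state, and their change when one server
  moves\<close>

definition lin :: "('i cconf \<Rightarrow> real) \<Rightarrow> ('i cconf \<Rightarrow> real) \<Rightarrow> real" where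
  "lin a x = (\<Sum>c\<in>CK. a c * x c)"

definition cnt :: "'i conf set \<Rightarrow> ('i cconf \<Rightarrow> real) \<Rightarrow> real" where
  "cnt q x = lin (\<lambda>c. if fst c \<in> q then 1 else 0) x"

lemma sum_marginal:
  fixes x :: "'i cconf \<Rightarrow> 'a::comm_monoid_add"
  assumes x: "\<And>c. c \<notin> CK \<Longrightarrow> x c = 0" and q: "q \<subseteq> K0"
  shows "(\<Sum>k\<in>q. marginal x k) = (\<Sum>c\<in>CK. if fst c \<in> q then x c else 0)"
proof -
  have fq: "finite q" using q finite_K0 finite_subset by blast
  have "(\<Sum>k\<in>q. marginal x k) = (\<Sum>c\<in>Sigma q (\<lambda>k. {kh. kh \<le> k}). x c)"
    unfolding marginal_def using fq finite_vec_le by (subst sum.Sigma) auto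
  also have "\<dots> = (\<Sum>c\<in>CK. if fst c \<in> q then x c else 0)"
    using fq finite_CK x finite_vec_le
    by (intro sum.mono_neutral_cong) (auto simp: CK_iff split: if_splits)
  finally show ?thesis .
qed

lemma sum_marginal_cnt:
  fixes x :: "'i cconf \<Rightarrow> real"
  assumes x: "\<And>c. c \<notin> CK \<Longrightarrow> x c = 0" and q: "q \<subseteq> K0"
  shows "(\<Sum>k\<in>q. marginal x k) = cnt q x"
proof -
  have "(\<Sum>k\<in>q. marginal x k) = (\<Sum>c\<in>CK. if fst c \<in> q then x c else 0)"
    by (rule sum_marginal[OF assms])
  also have "\<dots> = cnt q x" unfolding cnt_def lin_def by (intro sum.cong) auto
  finally show ?thesis .
qed

lemma marginal_cnt:
  fixes x :: "'i cconf \<Rightarrow> real"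
  assumes "\<And>c. c \<notin> CK \<Longrightarrow> x c = 0" and "k \<in> K0"
  shows "marginal x k = cnt {k} x"
  using sum_marginal_cnt[where q="{k}", OF assms(1)] assms(2) by simp

lemma St_zero: "X \<in> St \<Longrightarrow> c \<notin> CK \<Longrightarrow> X c = 0" unfolding states_def by blast

lemma aconf_count_cnt:
  assumes "X \<in> St" "q \<subseteq> K0"
  shows "real (aconf_count X q) = cnt q (\<lambda>c. real (X c))"
proof -
  have "real (aconf_count X q) = (\<Sum>c\<in>CK. real (if fst c \<in> q then X c else 0))"
    unfolding aconf_count_def using sum_marginal[of X q, OF St_zero[OF assms(1)] assms(2)] by simp
  also have "\<dots> = cnt q (\<lambda>c. real (X c))" unfolding cnt_def lin_def by (intro sum.cong) auto
  finally show ?thesis .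
qed

lemma lin_nonneg: "(\<And>c. c \<in> CK \<Longrightarrow> a c \<ge> 0) \<Longrightarrow> (\<And>c. c \<in> CK \<Longrightarrow> x c \<ge> 0) \<Longrightarrow> lin a x \<ge> 0"
  unfolding lin_def by (intro sum_nonneg) auto

lemma lin_mono: "(\<And>c. c \<in> CK \<Longrightarrow> a c \<le> a' c) \<Longrightarrow> (\<And>c. c \<in> CK \<Longrightarrow> x c \<ge> 0) \<Longrightarrow> lin a x \<le> lin a' x"
  unfolding lin_def by (intro sum_mono mult_right_mono) auto

lemma cnt_nonneg: "(\<And>c. c \<in> CK \<Longrightarrow> x c \<ge> 0) \<Longrightarrow> cnt q x \<ge> 0"
  unfolding cnt_def by (rule lin_nonneg) auto

lemma lin_scale: "lin a (\<lambda>c. x c / r) = lin a x / r"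
  by (simp add: lin_def sum_divide_distrib)

lemma cnt_scale: "cnt q (\<lambda>c. x c / r) = cnt q x / r"
  by (simp add: cnt_def lin_scale)

abbreviation rl :: "'i state \<Rightarrow> 'i cconf \<Rightarrow> real" where "rl X \<equiv> (\<lambda>c. real (X c))"

text \<open>On either side \<open>(0,0)\<close> stands for an empty server. Empty servers are
  unlimited and not recorded, so only a nonempty source has to be present in
  \<open>X\<close>.\<close>

definition movable :: "'i state \<Rightarrow> 'i cconf \<Rightarrow> 'i cconf \<Rightarrow> bool" where
  "movable X c c' \<longleftrightarrow> (c = (0,0) \<or> c \<in> CK \<and> X c > 0) \<and> (c' = (0,0) \<or> c' \<in> CK)"

lemma zero_notin_CK: "(0, kh) \<notin> CK" by (simp add: CK_iff K_iff)

lemma move_in_St: "X \<in> St \<Longrightarrow> movable X c c' \<Longrightarrow> move_server c c' X \<in> St"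
  by (auto simp: states_def movable_def move_server_def Let_def)

lemma lin_upd: "c \<in> CK \<Longrightarrow> lin a (x(c := v)) = lin a x + a c * (v - x c)"
  unfolding lin_def using finite_CK
  by (simp add: sum.remove[of CK c] algebra_simps)

text \<open>The condition \<open>a (0,0) = 0\<close> lets one formula cover also the moves that open
  a new server or empty one.\<close>

lemma lin_move:
  assumes "movable X c c'" and a0: "a (0,0) = 0"
  shows "lin a (rl (move_server c c' X)) = lin a (rl X) - a c + a c'"
proof -
  have upd: "lin a (rl (X(c := n))) = lin a (rl X) + a c * (real n - real (X c))"
    if "c \<in> CK" for X :: "'i state" and c n
  proof -
    have "rl (X(c := n)) = (rl X)(c := real n)" by auto
    then show ?thesis using lin_upd[OF that] by simp
  qed
  define Y where "Y = (if c = (0,0) then X else X(c := X c - 1))"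
  have Y: "lin a (rl Y) = lin a (rl X) - a c"
    using assms zero_notin_CK unfolding Y_def movable_def
    by (auto simp: upd of_nat_diff algebra_simps simp del: fun_upd_apply)
  have "move_server c c' X = (if c' = (0,0) then Y else Y(c' := Y c' + 1))"
    by (simp add: move_server_def Y_def Let_def)
  then show ?thesis
    using assms Y unfolding movable_def by (auto simp: upd algebra_simps simp del: fun_upd_apply)
qed

lemma cnt_move:
  assumes "movable X c c'" and q: "0 \<notin> q"
  shows "cnt q (rl (move_server c c' X)) = cnt q (rl X) - (if fst c \<in> q then 1 else 0) + (if fst c' \<in> q then 1 else 0)"
  unfolding cnt_def using q by (subst lin_move[OF assms(1)]) auto

definition actual :: "'i \<Rightarrow> ('i cconf \<Rightarrow> real) \<Rightarrow> real" where
  "actual i x = lin (\<lambda>c. real (snd c $ i)) x"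

definition tokens :: "'i \<Rightarrow> ('i cconf \<Rightarrow> real) \<Rightarrow> real" where
  "tokens i x = lin (\<lambda>c. real (fst c $ i - snd c $ i)) x"

definition total :: "('i cconf \<Rightarrow> real) \<Rightarrow> real" where
  "total x = (\<Sum>i\<in>UNIV. actual i x + tokens i x)"

lemma actual_move:
  "movable X c c' \<Longrightarrow> actual i (rl (move_server c c' X)) = actual i (rl X) - real (snd c $ i) + real (snd c' $ i)"
  unfolding actual_def by (rule lin_move) auto

lemma tokens_move:
  "movable X c c' \<Longrightarrow> tokens i (rl (move_server c c' X)) =
     tokens i (rl X) - real (fst c $ i - snd c $ i) + real (fst c' $ i - snd c' $ i)"
  unfolding tokens_def by (subst lin_move) auto

lemma actual_nonneg: "actual i (rl X) \<ge> 0" unfolding actual_def by (rule lin_nonneg) auto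

lemma tokens_nonneg: "tokens i (rl X) \<ge> 0" unfolding tokens_def by (rule lin_nonneg) auto

lemma real_conf_split: "c \<in> CK \<Longrightarrow> real (snd c $ i) + real (fst c $ i - snd c $ i) = real (fst c $ i)"
  by (auto simp: CK_iff less_eq_vec_def of_nat_diff)

lemma total_lin: "total x = lin (\<lambda>c. \<Sum>i\<in>UNIV. real (fst c $ i)) x"
proof -
  have "total x = (\<Sum>i\<in>UNIV. \<Sum>c\<in>CK. real (fst c $ i) * x c)"
    unfolding total_def actual_def tokens_def lin_def sum.distrib[symmetric]
    by (intro sum.cong refl) (simp add: real_conf_split distrib_right[symmetric])
  also have "\<dots> = lin (\<lambda>c. \<Sum>i\<in>UNIV. real (fst c $ i)) x"
    unfolding lin_def by (subst sum.swap) (simp add: sum_distrib_right)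
  finally show ?thesis .
qed

lemma conf_size_ge_1: "k \<noteq> 0 \<Longrightarrow> 1 \<le> (\<Sum>i\<in>UNIV. real ((k :: 'i conf) $ i))"
proof -
  assume "k \<noteq> 0"
  then obtain i where "k $ i \<noteq> 0" by (auto simp: vec_eq_zero_iff_nat)
  then have "1 \<le> real (k $ i)" by simp
  also have "\<dots> \<le> (\<Sum>i\<in>UNIV. real (k $ i))" by (rule member_le_sum) auto
  finally show ?thesis .
qed

lemma sum_le_total: "(\<And>c. c \<in> CK \<Longrightarrow> x c \<ge> 0) \<Longrightarrow> (\<Sum>c\<in>CK. x c) \<le> total x"
proof -
  assume "\<And>c. c \<in> CK \<Longrightarrow> x c \<ge> 0"
  then have "lin (\<lambda>_. 1) x \<le> total x"
    unfolding total_lin by (intro lin_mono) (auto simp: CK_iff K_iff intro: conf_size_ge_1)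
  then show ?thesis by (simp add: lin_def)
qed

lemma cnt_le_total: "(\<And>c. c \<in> CK \<Longrightarrow> x c \<ge> 0) \<Longrightarrow> cnt q x \<le> total x"
proof -
  assume x: "\<And>c. c \<in> CK \<Longrightarrow> x c \<ge> 0"
  have "cnt q x \<le> lin (\<lambda>_. 1) x" unfolding cnt_def by (rule lin_mono) (use x in auto)
  also have "\<dots> \<le> total x" using sum_le_total[OF x] by (simp add: lin_def)
  finally show ?thesis .
qed

text \<open>Each recorded server holds at least one customer, so \<open>total\<close> bounds the
  number of servers in each of the finitely many complete configurations.\<close>

lemma finite_total_less: "finite {X \<in> St. total (rl X) < n}"
proof -
  have "{X \<in> St. total (rl X) < n} \<subseteq> {X. \<forall>c. (c \<in> CK \<longrightarrow> X c \<in> {..nat \<lceil>n\<rceil>}) \<and> (c \<notin> CK \<longrightarrow> X c = 0)}"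
  proof clarsimp
    fix X c assume X: "X \<in> St" "total (rl X) < n"
    have "real (X c) \<le> (\<Sum>c\<in>CK. real (X c))" if "c \<in> CK"
      using that finite_CK by (intro member_le_sum) auto
    also have "(\<Sum>c\<in>CK. real (X c)) \<le> total (rl X)" by (rule sum_le_total) auto
    finally show "(c \<in> CK \<longrightarrow> X c \<le> nat \<lceil>n\<rceil>) \<and> (c \<notin> CK \<longrightarrow> X c = 0)"
      using X St_zero by (auto, linarith)
  qed
  then show ?thesis by (rule finite_subset) (rule finite_set_of_finite_funs, use finite_CK in auto)
qed

section \<open>The support of a placement\<close>

lemma pick_server_finite: "X \<in> St \<Longrightarrow> finite {(c, j). c \<in> CK \<and> fst c \<in> q \<and> j < X c}"
proof -
  have "{(c, j). c \<in> CK \<and> fst c \<in> q \<and> j < X c} \<subseteq> Sigma CK (\<lambda>c. {..<X c})" by auto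
  then show ?thesis by (rule finite_subset) (use finite_CK in auto)
qed

lemma candidates_iff:
  "q \<in> ac_candidates B b X i \<longleftrightarrow>
     (\<exists>k\<in>K0. q = cls k \<and> k + axis i 1 \<in> K0 \<and> (k = 0 \<or> aconf_count X q > 0))"
  unfolding ac_candidates_def available_def
  using can_add_cls cls_eq_zero_iff by (auto simp: aconfs0_iff zero_cls)

lemma pick_server_nonempty:
  assumes X: "X \<in> St" and q: "q \<subseteq> K0" "aconf_count X q > 0"
  shows "{(c, j). c \<in> CK \<and> fst c \<in> q \<and> j < X c} \<noteq> {}"
proof -
  have "(\<Sum>c\<in>CK. if fst c \<in> q then X c else 0) > 0"
    using q(2) sum_marginal[of X q, OF St_zero[OF X] q(1)] unfolding aconf_count_def by simp
  then have "(\<Sum>c\<in>CK. if fst c \<in> q then X c else 0) \<noteq> 0" by simp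
  then obtain c where c: "c \<in> CK" "(if fst c \<in> q then X c else 0) \<noteq> 0" by (rule sum.not_neutral_contains_not_neutral)
  then have "(c, 0) \<in> {(c, j). c \<in> CK \<and> fst c \<in> q \<and> j < X c}" by (simp split: if_splits)
  then show ?thesis by blast
qed

lemma pick_server_support:
  assumes X: "X \<in> St" and q: "q \<in> ac_candidates B b X i" and c: "c \<in> set_pmf (pick_server B b X q)"
  shows "c = (0,0) \<or> c \<in> CK \<and> X c > 0" "fst c \<in> q" "fst c + axis i 1 \<in> K0" "snd c \<le> fst c" "fst c \<in> K0"
proof -
  obtain k where k: "k \<in> K0" "q = cls k" "k + axis i 1 \<in> K0" "k = 0 \<or> aconf_count X q > 0"
    using q by (auto simp: candidates_iff)
  have *: "(c = (0,0) \<or> c \<in> CK \<and> X c > 0) \<and> fst c \<in> q \<and> snd c \<le> fst c"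
  proof (cases "k = 0")
    case True
    then show ?thesis using c k by (auto simp: pick_server_def zero_cls)
  next
    case False
    then have "aconf_count X q > 0" "q \<noteq> aconf_zero B b" using k by (auto simp: zero_cls cls_eq_zero_iff)
    then show ?thesis
      using c k pick_server_finite[OF X, of q] pick_server_nonempty[OF X, of q] cls_subset
      by (auto simp: pick_server_def CK_iff)
  qed
  then show "c = (0,0) \<or> c \<in> CK \<and> X c > 0" "fst c \<in> q" "snd c \<le> fst c" by auto
  show "fst c \<in> K0" using * k cls_subset by auto
  show "fst c + axis i 1 \<in> K0" using * k can_add_cls[of k i] unfolding can_add_def by auto
qed

lemma finite_pick_server:
  assumes X: "X \<in> St" and q: "q \<in> ac_candidates B b X i"
  shows "finite (set_pmf (pick_server B b X q))"
proof (rule finite_subset)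
  show "set_pmf (pick_server B b X q) \<subseteq> insert (0,0) CK"
    using pick_server_support(1)[OF assms] by blast
qed (use finite_CK in auto)

lemma tokens_pos_iff: "X \<in> St \<Longrightarrow> tokens i (rl X) > 0 \<longleftrightarrow> token_places B b X i \<noteq> {}"
proof -
  assume X: "X \<in> St"
  have "tokens i (rl X) = 0 \<longleftrightarrow> (\<forall>c\<in>CK. real (fst c $ i - snd c $ i) * real (X c) = 0)"
    unfolding tokens_def lin_def using finite_CK by (subst sum_nonneg_eq_0_iff) auto
  also have "\<dots> \<longleftrightarrow> token_places B b X i = {}"
    by (force simp: token_places_def)
  finally show ?thesis using tokens_nonneg[of i X] by auto
qed

end

section \<open>The generator of the Greedy-DM-AC chain\<close>

lemma expectation_le_const:
  fixes f :: "'a \<Rightarrow> real"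
  assumes "finite (set_pmf p)" "\<And>x. x \<in> set_pmf p \<Longrightarrow> f x \<le> c"
  shows "measure_pmf.expectation p f \<le> c"
  by (rule measure_pmf.integral_le_const)
    (use assms in \<open>auto simp: integrable_measure_pmf_finite AE_measure_pmf_iff\<close>)

lemma expectation_diff_sum:
  fixes f :: "'a \<Rightarrow> real"
  assumes "finite T" "set_pmf p \<subseteq> T"
  shows "(\<Sum>x\<in>T. pmf p x * (f x - c)) = measure_pmf.expectation p f - c"
proof -
  have fin: "finite (set_pmf p)" using assms finite_subset by blast
  have "measure_pmf.expectation p (\<lambda>x. f x - c) = (\<Sum>x\<in>T. pmf p x *\<^sub>R (f x - c))"
    using assms by (intro integral_measure_pmf) auto
  then show ?thesis using fin by (simp add: integrable_measure_pmf_finite)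
qed

locale vector_packing = packing B b for B :: "'n::finite \<Rightarrow> real" and b :: "'i::finite \<Rightarrow> 'n \<Rightarrow> real" +
  fixes lam mu rho :: "'i \<Rightarrow> real" and mu0 \<alpha> :: real
  assumes lam_pos: "\<And>i. lam i > 0" and mu_pos: "\<And>i. mu i > 0" and rho_def: "\<And>i. rho i = lam i / mu i"
    and rho_sum: "(\<Sum>i\<in>UNIV. rho i) = 1" and mu0_pos: "mu0 > 0" and alpha_pos: "\<alpha> > 0"

locale greedy = vector_packing B b lam mu rho mu0 \<alpha>
  for B :: "'n::finite \<Rightarrow> real" and b :: "'i::finite \<Rightarrow> 'n \<Rightarrow> real"
  and lam mu rho :: "'i \<Rightarrow> real" and mu0 \<alpha> :: real +
  fixes r :: real and sel :: "'i state \<Rightarrow> 'i \<Rightarrow> 'i conf set" and rep :: "'i state \<Rightarrow> 'i \<Rightarrow> 'i cconf pmf"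
  assumes r_ge_1: "r \<ge> 1" and ac_rule: "ac_rule B b \<alpha> sel" and replacement: "replacement_rule B b rep"
begin

abbreviation "arrive X i \<equiv> after_arrival B b sel rep X i"
abbreviation "serve X c i \<equiv> after_service B b sel X c i"
abbreviation "place X i \<equiv> pick_server B b X (sel X i)"
abbreviation "departed c i X \<equiv> move_server c (fst c - axis i 1, snd c - axis i 1) X"

lemma sel_candidate: "X \<in> St \<Longrightarrow> sel X i \<in> ac_candidates B b X i"
  using ac_rule by (auto simp: ac_rule_def ac_minimizers_def is_arg_min_def)

lemma sel_minimal:
  "X \<in> St \<Longrightarrow> q \<in> ac_candidates B b X i \<Longrightarrow> ac_increment B b \<alpha> X i (sel X i) \<le> ac_increment B b \<alpha> X i q"
  using ac_rule by (force simp: ac_rule_def ac_minimizers_def is_arg_min_def)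

lemma placed_movable:
  assumes X: "X \<in> St" and c: "c \<in> set_pmf (place X i)"
  shows "movable X c (fst c + axis i 1, snd c + axis i 1)" "movable X c (fst c + axis i 1, snd c)"
proof -
  note s = pick_server_support[OF X sel_candidate[OF X] c]
  have "fst c + axis i 1 \<in> K" using s(3) by (simp add: K_iff add_axis_nonzero)
  moreover have "snd c + axis i 1 \<le> fst c + axis i 1" "snd c \<le> fst c + axis i 1"
    using s(4) by (auto simp: less_eq_vec_def intro: le_trans trans_le_add1)
  ultimately show "movable X c (fst c + axis i 1, snd c + axis i 1)" "movable X c (fst c + axis i 1, snd c)"
    using s(1) by (auto simp: movable_def CK_iff)
qed

lemma departed_movable:
  assumes "c \<in> CK" "X c > 0"
  shows "movable X c (fst c - axis i 1, snd c - axis i 1)"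
proof -
  have le: "snd c \<le> fst c" "fst c \<in> K" using assms by (auto simp: CK_iff)
  then have "snd c - axis i 1 \<le> fst c - axis i 1" by (auto simp: less_eq_vec_def intro: diff_le_mono)
  moreover have "fst c - axis i 1 \<in> K0" using le by (auto simp: K_iff intro: minus_K0)
  ultimately show ?thesis
    using assms le by (auto simp: movable_def CK_iff K_iff less_eq_vec_def vec_eq_iff)
qed

lemma expired_movable:
  assumes "c \<in> CK" "X c > 0" "snd c $ i < fst c $ i"
  shows "movable X c (fst c - axis i 1, snd c)"
proof -
  have le: "snd c \<le> fst c" "fst c \<in> K" using assms by (auto simp: CK_iff)
  then have "snd c \<le> fst c - axis i 1"
    using assms(3) by (auto simp: less_eq_vec_def axis_component)
  moreover have "fst c - axis i 1 \<in> K0" using le by (auto simp: K_iff intro: minus_K0)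
  ultimately show ?thesis
    using assms le by (auto simp: movable_def CK_iff K_iff less_eq_vec_def vec_eq_iff)
qed

lemma replaced_movable:
  assumes "c \<in> CK" "X c > 0" "snd c $ i < fst c $ i"
  shows "movable X c (fst c, snd c + axis i 1)"
proof -
  have le: "snd c \<le> fst c" "fst c \<in> K" using assms by (auto simp: CK_iff)
  then have "snd c + axis i 1 \<le> fst c"
    using assms(3) by (auto simp: less_eq_vec_def axis_component)
  then show ?thesis using assms le by (auto simp: movable_def CK_iff)
qed

lemma arrive_cases [consumes 2, case_names replace place]:
  assumes "X \<in> St" "X' \<in> set_pmf (arrive X i)"
  obtains c where "tokens i (rl X) > 0" "c \<in> CK" "X c > 0" "snd c $ i < fst c $ i"
      "X' = move_server c (fst c, snd c + axis i 1) X"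
    | c where "tokens i (rl X) = 0" "c \<in> set_pmf (place X i)"
      "X' = move_server c (fst c + axis i 1, snd c + axis i 1) X"
proof (cases "token_places B b X i = {}")
  case True
  then have "tokens i (rl X) = 0" using tokens_pos_iff[OF assms(1), of i] tokens_nonneg[of i X] by auto
  then show ?thesis using assms(2) True that(2)
    by (auto simp: after_arrival_def ac_place_actual_def split_beta)
next
  case False
  then have "tokens i (rl X) > 0" using tokens_pos_iff[OF assms(1), of i] by auto
  moreover have "set_pmf (rep X i) \<subseteq> token_places B b X i"
    using replacement False assms(1) by (auto simp: replacement_rule_def)
  moreover obtain c where "c \<in> set_pmf (rep X i)" "X' = move_server c (fst c, snd c + axis i 1) X"
    using assms(2) False by (auto simp: after_arrival_def split_beta)
  ultimately show ?thesis by (intro that(1)[of c]) (auto simp: token_places_def)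
qed

lemma serve_eq:
  "serve X c i = map_pmf (\<lambda>c'. move_server c' (fst c' + axis i 1, snd c') (departed c i X)) (place (departed c i X) i)"
  by (cases c) (simp add: after_service_def ac_place_token_def case_prod_unfold)

lemma departed_St: "X \<in> St \<Longrightarrow> c \<in> CK \<Longrightarrow> X c > 0 \<Longrightarrow> departed c i X \<in> St"
  by (intro move_in_St departed_movable)

lemma arrive_St: "X \<in> St \<Longrightarrow> X' \<in> set_pmf (arrive X i) \<Longrightarrow> X' \<in> St"
  by (cases rule: arrive_cases) (auto intro!: move_in_St replaced_movable placed_movable)

lemma serve_St: "X \<in> St \<Longrightarrow> c \<in> CK \<Longrightarrow> X c > 0 \<Longrightarrow> X' \<in> set_pmf (serve X c i) \<Longrightarrow> X' \<in> St"
  by (auto simp: serve_eq intro!: move_in_St placed_movable departed_movable)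

lemma expiry_eq: "after_token_expiry X c i = move_server c (fst c - axis i 1, snd c) X"
  by (cases c) (simp add: after_token_expiry_def)

lemma expiry_St: "X \<in> St \<Longrightarrow> c \<in> CK \<Longrightarrow> X c > 0 \<Longrightarrow> snd c $ i < fst c $ i \<Longrightarrow> after_token_expiry X c i \<in> St"
  unfolding expiry_eq by (intro move_in_St expired_movable)

lemma finite_place: "X \<in> St \<Longrightarrow> finite (set_pmf (place X i))"
  using finite_pick_server sel_candidate by blast

lemma finite_arrive: "X \<in> St \<Longrightarrow> finite (set_pmf (arrive X i))"
proof (cases "token_places B b X i = {}")
  case True
  assume "X \<in> St" then show ?thesis
    using True finite_place by (simp add: after_arrival_def ac_place_actual_def)
next
  case False
  assume X: "X \<in> St"
  have "set_pmf (rep X i) \<subseteq> CK"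
    using replacement False X by (auto simp: replacement_rule_def token_places_def)
  then show ?thesis using False finite_CK finite_subset by (auto simp: after_arrival_def)
qed

lemma finite_serve: "X \<in> St \<Longrightarrow> c \<in> CK \<Longrightarrow> X c > 0 \<Longrightarrow> finite (set_pmf (serve X c i))"
  using finite_place departed_St by (simp add: serve_eq)

abbreviation "rate X X' \<equiv> greedy_rate B b lam mu mu0 r sel rep X X'"

text \<open>Restricted to customers and tokens that exist: elsewhere the transition maps are still
  defined but need not stay in \<open>St\<close>, and the corresponding rate factor is 0.\<close>

definition successors :: "'i state \<Rightarrow> 'i state set" where
  "successors X = (\<Union>i. set_pmf (arrive X i))
     \<union> (\<Union>i. \<Union>c\<in>{c \<in> CK. X c > 0 \<and> snd c $ i > 0}. set_pmf (serve X c i))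
     \<union> (\<Union>i. \<Union>c\<in>{c \<in> CK. X c > 0 \<and> snd c $ i < fst c $ i}. {after_token_expiry X c i})"

text \<open>The generator written without a transition function, so that drift bounds can be proved
  before a stationary law is fixed.\<close>

definition drift :: "('i state \<Rightarrow> real) \<Rightarrow> 'i state \<Rightarrow> real" where
  "drift f X = (\<Sum>X'\<in>successors X. rate X X' * (f X' - f X))"

lemma arrive_successors: "set_pmf (arrive X i) \<subseteq> successors X"
  unfolding successors_def by (intro le_supI1 UN_upper) simp

lemma serve_successors:
  "c \<in> CK \<Longrightarrow> X c > 0 \<Longrightarrow> snd c $ i > 0 \<Longrightarrow> set_pmf (serve X c i) \<subseteq> successors X"
  unfolding successors_def
  by (rule le_supI1, rule le_supI2, rule order_trans[OF _ UN_upper[of i]], rule UN_upper) simp_all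

lemma expiry_successors:
  assumes "c \<in> CK" "X c > 0" "snd c $ i < fst c $ i"
  shows "after_token_expiry X c i \<in> successors X"
proof -
  have "after_token_expiry X c i \<in> (\<Union>c\<in>{c \<in> CK. X c > 0 \<and> snd c $ i < fst c $ i}. {after_token_expiry X c i})"
    using assms by (intro UN_I[of c]) simp_all
  then show ?thesis unfolding successors_def by (intro UnI2 UN_I[of i]) simp_all
qed

lemma finite_successors: "X \<in> St \<Longrightarrow> finite (successors X)"
  unfolding successors_def using finite_CK by (auto intro: finite_arrive finite_serve)

lemma successors_St: "X \<in> St \<Longrightarrow> successors X \<subseteq> St"
  unfolding successors_def by (auto intro: arrive_St serve_St expiry_St)

lemma rate_nonneg: "rate X X' \<ge> 0"
  unfolding greedy_rate_def
  using lam_pos mu_pos mu0_pos r_ge_1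
  by (auto intro!: add_nonneg_nonneg sum_nonneg mult_nonneg_nonneg simp: less_imp_le split: prod.split)

lemma rate_alt:
  "rate X X' = (\<Sum>i\<in>UNIV. lam i * r * pmf (arrive X i) X')
    + (\<Sum>i\<in>UNIV. \<Sum>c\<in>CK. mu i * real (snd c $ i) * real (X c) * pmf (serve X c i) X')
    + (\<Sum>i\<in>UNIV. \<Sum>c\<in>CK. mu0 * real (fst c $ i - snd c $ i) * real (X c) *
        (if after_token_expiry X c i = X' then 1 else 0))"
  by (simp add: greedy_rate_def split_beta)

lemma rate_outside: "X' \<notin> successors X \<Longrightarrow> rate X X' = 0"
proof -
  assume n: "X' \<notin> successors X"
  have "pmf (arrive X i) X' = 0" for i
    using n arrive_successors by (meson pmf_eq_0_set_pmf subsetD)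
  moreover have "mu i * real (snd c $ i) * real (X c) * pmf (serve X c i) X' = 0" if "c \<in> CK" for i c
  proof (cases "X c > 0 \<and> snd c $ i > 0")
    case True
    then have "X' \<notin> set_pmf (serve X c i)" using n serve_successors[of c X i] that by blast
    then show ?thesis by (simp add: pmf_eq_0_set_pmf)
  qed auto
  moreover have "mu0 * real (fst c $ i - snd c $ i) * real (X c) *
        (if after_token_expiry X c i = X' then 1 else 0) = 0" if "c \<in> CK" for i c
  proof (cases "X c > 0 \<and> snd c $ i < fst c $ i")
    case True
    then have "after_token_expiry X c i \<noteq> X'" using n expiry_successors[of c X i] that by blast
    then show ?thesis by simp
  qed auto
  ultimately show ?thesis unfolding rate_alt
    by (simp only: mult_zero_right sum.neutral_const add_0_left sum.neutral[OF ballI] cong: sum.cong)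
qed

lemma drift_eq:
  assumes X: "X \<in> St"
  shows "drift f X = (\<Sum>i\<in>UNIV. lam i * r * (measure_pmf.expectation (arrive X i) f - f X))
    + (\<Sum>i\<in>UNIV. \<Sum>c\<in>CK. mu i * real (snd c $ i) * real (X c) * (measure_pmf.expectation (serve X c i) f - f X))
    + (\<Sum>i\<in>UNIV. \<Sum>c\<in>CK. mu0 * real (fst c $ i - snd c $ i) * real (X c) * (f (after_token_expiry X c i) - f X))"
proof -
  let ?S = "successors X"
  note fin = finite_successors[OF X]
  have 1: "(\<Sum>X'\<in>?S. (\<Sum>i\<in>UNIV. lam i * r * pmf (arrive X i) X') * (f X' - f X)) =
     (\<Sum>i\<in>UNIV. lam i * r * (measure_pmf.expectation (arrive X i) f - f X))"
    unfolding sum_distrib_right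
  proof (subst sum.swap, intro sum.cong refl)
    fix i
    from expectation_diff_sum[OF fin arrive_successors, where f=f and c="f X"]
    show "(\<Sum>X'\<in>?S. lam i * r * pmf (arrive X i) X' * (f X' - f X)) =
      lam i * r * (measure_pmf.expectation (arrive X i) f - f X)"
      by (simp add: mult.assoc sum_distrib_left[symmetric])
  qed
  have 2: "(\<Sum>X'\<in>?S. (\<Sum>i\<in>UNIV. \<Sum>c\<in>CK. mu i * real (snd c $ i) * real (X c) * pmf (serve X c i) X') * (f X' - f X)) =
     (\<Sum>i\<in>UNIV. \<Sum>c\<in>CK. mu i * real (snd c $ i) * real (X c) * (measure_pmf.expectation (serve X c i) f - f X))"
    unfolding sum_distrib_right
  proof (subst sum.swap, intro sum.cong refl, subst sum.swap, intro sum.cong refl)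
    fix i c assume c: "c \<in> CK"
    show "(\<Sum>X'\<in>?S. mu i * real (snd c $ i) * real (X c) * pmf (serve X c i) X' * (f X' - f X)) =
      mu i * real (snd c $ i) * real (X c) * (measure_pmf.expectation (serve X c i) f - f X)"
    proof (cases "X c > 0 \<and> snd c $ i > 0")
      case True
      then have "set_pmf (serve X c i) \<subseteq> ?S" using c serve_successors by simp
      from expectation_diff_sum[OF fin this, of f "f X"] show ?thesis
        by (simp add: mult.assoc sum_distrib_left[symmetric])
    qed auto
  qed
  have 3: "(\<Sum>X'\<in>?S. (\<Sum>i\<in>UNIV. \<Sum>c\<in>CK. mu0 * real (fst c $ i - snd c $ i) * real (X c) *
        (if after_token_expiry X c i = X' then 1 else 0)) * (f X' - f X)) =
     (\<Sum>i\<in>UNIV. \<Sum>c\<in>CK. mu0 * real (fst c $ i - snd c $ i) * real (X c) * (f (after_token_expiry X c i) - f X))"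
    unfolding sum_distrib_right
  proof (subst sum.swap, intro sum.cong refl, subst sum.swap, intro sum.cong refl)
    fix i c assume c: "c \<in> CK"
    show "(\<Sum>X'\<in>?S. mu0 * real (fst c $ i - snd c $ i) * real (X c) *
        (if after_token_expiry X c i = X' then 1 else 0) * (f X' - f X)) =
      mu0 * real (fst c $ i - snd c $ i) * real (X c) * (f (after_token_expiry X c i) - f X)"
    proof (cases "X c > 0 \<and> snd c $ i < fst c $ i")
      case True
      then have m: "after_token_expiry X c i \<in> ?S" using c expiry_successors by simp
      have "(\<Sum>X'\<in>?S. mu0 * real (fst c $ i - snd c $ i) * real (X c) *
        (if after_token_expiry X c i = X' then 1 else 0) * (f X' - f X)) =
        (\<Sum>X'\<in>?S. if after_token_expiry X c i = X' then
           mu0 * real (fst c $ i - snd c $ i) * real (X c) * (f (after_token_expiry X c i) - f X) else 0)"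
        by (intro sum.cong) auto
      then show ?thesis using m fin by simp
    qed auto
  qed
  show ?thesis
    unfolding drift_def rate_alt distrib_right sum.distrib 1 2 3 ..
qed

text \<open>Each kind of event is estimated separately, and only where its rate is positive; at rate
  0 both sides of the comparison vanish.\<close>

lemma drift_le:
  assumes X: "X \<in> St"
    and a: "\<And>i. measure_pmf.expectation (arrive X i) f \<le> f X + a i"
    and s: "\<And>i c. c \<in> CK \<Longrightarrow> X c > 0 \<Longrightarrow> snd c $ i > 0 \<Longrightarrow> measure_pmf.expectation (serve X c i) f \<le> f X + s i c"
    and t: "\<And>i c. c \<in> CK \<Longrightarrow> X c > 0 \<Longrightarrow> snd c $ i < fst c $ i \<Longrightarrow> f (after_token_expiry X c i) \<le> f X + t i c"
  shows "drift f X \<le> (\<Sum>i\<in>UNIV. lam i * r * a i)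
    + (\<Sum>i\<in>UNIV. \<Sum>c\<in>CK. mu i * real (snd c $ i) * real (X c) * s i c)
    + (\<Sum>i\<in>UNIV. \<Sum>c\<in>CK. mu0 * real (fst c $ i - snd c $ i) * real (X c) * t i c)"
proof -
  have "mu i * real (snd c $ i) * real (X c) * (measure_pmf.expectation (serve X c i) f - f X) \<le>
     mu i * real (snd c $ i) * real (X c) * s i c" if "c \<in> CK" for i c
  proof (cases "X c > 0 \<and> snd c $ i > 0")
    case True
    then show ?thesis using s[OF that, of i] mu_pos[of i] by (intro mult_left_mono) auto
  qed auto
  moreover have "mu0 * real (fst c $ i - snd c $ i) * real (X c) * (f (after_token_expiry X c i) - f X) \<le>
     mu0 * real (fst c $ i - snd c $ i) * real (X c) * t i c" if "c \<in> CK" for i c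
  proof (cases "X c > 0 \<and> snd c $ i < fst c $ i")
    case True
    then show ?thesis using t[OF that, of i] mu0_pos by (intro mult_left_mono) auto
  qed auto
  moreover have "lam i * r * (measure_pmf.expectation (arrive X i) f - f X) \<le> lam i * r * a i" for i
    using lam_pos[of i] r_ge_1 a[of i] by (intro mult_left_mono) auto
  ultimately show ?thesis unfolding drift_eq[OF X] by (intro add_mono sum_mono)
qed

lemma sum_actual: "(\<Sum>c\<in>CK. mu i * real (snd c $ i) * real (X c) * s) = mu i * actual i (rl X) * s"
  by (simp add: actual_def lin_def sum_distrib_left sum_distrib_right mult_ac)

lemma sum_tokens: "(\<Sum>c\<in>CK. mu0 * real (fst c $ i - snd c $ i) * real (X c) * t) = mu0 * tokens i (rl X) * t"
  by (simp add: tokens_def lin_def sum_distrib_left sum_distrib_right mult_ac)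

section \<open>Effect of arrivals, services and expiries on the counts\<close>

lemma arrive_counts:
  assumes X: "X \<in> St" and X': "X' \<in> set_pmf (arrive X i)"
  shows "actual j (rl X') = actual j (rl X) + (if j = i then 1 else 0)"
    "tokens j (rl X') = tokens j (rl X) - (if j = i \<and> tokens i (rl X) > 0 then 1 else 0)"
proof -
  have "actual j (rl X') = actual j (rl X) + (if j = i then 1 else 0) \<and>
    tokens j (rl X') = tokens j (rl X) - (if j = i \<and> tokens i (rl X) > 0 then 1 else 0)"
    using X X'
  proof (cases rule: arrive_cases)
    case (replace c)
    note m = replaced_movable[of c X i, OF replace(2-4)]
    show ?thesis
      using replace unfolding replace(5) actual_move[OF m] tokens_move[OF m]
      by (auto simp: axis_component of_nat_diff)
  next
    case (place c)
    note m = placed_movable(1)[OF X place(2)]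
    show ?thesis
      using place unfolding place(3) actual_move[OF m] tokens_move[OF m]
      by (auto simp: axis_component)
  qed
  then show "actual j (rl X') = actual j (rl X) + (if j = i then 1 else 0)"
    "tokens j (rl X') = tokens j (rl X) - (if j = i \<and> tokens i (rl X) > 0 then 1 else 0)"
    by auto
qed

lemma departed_counts:
  assumes X: "X \<in> St" and c: "c \<in> CK" "X c > 0" "snd c $ i > 0"
  shows "actual j (rl (departed c i X)) = actual j (rl X) - (if j = i then 1 else 0)"
    "tokens j (rl (departed c i X)) = tokens j (rl X)"
proof -
  note m = departed_movable[of c X i, OF c(1,2)]
  have "snd c $ i \<le> fst c $ i" using c by (auto simp: CK_iff less_eq_vec_def)
  then show "actual j (rl (departed c i X)) = actual j (rl X) - (if j = i then 1 else 0)"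
    "tokens j (rl (departed c i X)) = tokens j (rl X)"
    using c unfolding actual_move[OF m] tokens_move[OF m]
    by (auto simp: axis_component of_nat_diff)
qed

text \<open>The new token has the type of the departed customer, so the total of each type is
  conserved, wherever the token is placed.\<close>

lemma serve_counts:
  assumes X: "X \<in> St" and c: "c \<in> CK" "X c > 0" "snd c $ i > 0" and X': "X' \<in> set_pmf (serve X c i)"
  shows "actual j (rl X') = actual j (rl X) - (if j = i then 1 else 0)"
    "tokens j (rl X') = tokens j (rl X) + (if j = i then 1 else 0)"
proof -
  let ?Y = "departed c i X"
  note Y = departed_St[OF X c(1,2), of i]
  obtain c' where c': "c' \<in> set_pmf (place ?Y i)" "X' = move_server c' (fst c' + axis i 1, snd c') ?Y"
    using X' by (auto simp: serve_eq)
  note m = placed_movable(2)[OF Y c'(1)]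
  note s = pick_server_support[OF Y sel_candidate[OF Y] c'(1)]
  then have "snd c' $ i \<le> fst c' $ i" by (auto simp: less_eq_vec_def)
  then show "actual j (rl X') = actual j (rl X) - (if j = i then 1 else 0)"
    "tokens j (rl X') = tokens j (rl X) + (if j = i then 1 else 0)"
    unfolding c'(2) actual_move[OF m] tokens_move[OF m] departed_counts[OF X c]
    by (auto simp: axis_component Suc_diff_le)
qed

lemma expiry_counts:
  assumes X: "X \<in> St" and c: "c \<in> CK" "X c > 0" "snd c $ i < fst c $ i"
  shows "actual j (rl (after_token_expiry X c i)) = actual j (rl X)"
    "tokens j (rl (after_token_expiry X c i)) = tokens j (rl X) - (if j = i then 1 else 0)"
  unfolding expiry_eq actual_move[OF expired_movable[of c X i, OF c]] tokens_move[OF expired_movable[of c X i, OF c]]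
  using c by (auto simp: axis_component of_nat_diff)

end

section \<open>Second moments of actual customers and tokens\<close>

lemma sum_change_one:
  fixes g g' :: "'i::finite \<Rightarrow> real"
  assumes "\<And>j. j \<noteq> i \<Longrightarrow> g' j = g j" "g' i \<le> g i + a"
  shows "sum g' UNIV \<le> sum g UNIV + a"
proof -
  have "sum g' (UNIV - {i}) = sum g (UNIV - {i})" using assms(1) by (intro sum.cong) auto
  then show ?thesis using assms(2) by (simp add: sum.remove[of UNIV i])
qed

context vector_packing
begin

text \<open>Chosen so that \<open>weight i * mu i = mu i + 1 + 4 * mu i ^ 2 / mu0\<close>. The last
  summand absorbs the cross term \<open>2 * mu i * T * D\<close>, which arises because each service
  creates a token; the summand 1 leaves a full negative square of \<open>D\<close>.\<close>

definition weight :: "'i \<Rightarrow> real" where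
  "weight i = 1 + 1 / mu i + 4 * mu i / mu0"

text \<open>The stationary bound for \<open>E Q / r\<close>: the constant part of the drift over the
  decay rate \<open>min 1 mu0\<close>.\<close>

definition moment_const :: real where
  "moment_const = (\<Sum>i\<in>UNIV. 2 * (weight i + 1) * lam i + 2 * weight i * mu i + mu0 / 2) / min 1 mu0"

lemma weight_ge_1: "weight i \<ge> 1"
  using mu_pos[of i] mu0_pos by (simp add: weight_def)

lemma moment_const_nonneg: "moment_const \<ge> 0"
  unfolding moment_const_def using weight_ge_1 lam_pos mu_pos mu0_pos
  by (intro divide_nonneg_nonneg sum_nonneg add_nonneg_nonneg mult_nonneg_nonneg)
    (auto simp: less_imp_le intro: order_trans[OF zero_le_one] add_nonneg_nonneg)

text \<open>The coordinatewise drift of \<open>weight i * D\<^sup>2 + T\<^sup>2\<close>, where \<open>D\<close> is the deviation of the number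
  of actual customers from its mean and \<open>T\<close> the number of tokens.\<close>

lemma quadratic_drift:
  assumes r: "r \<ge> (1::real)"
  shows "lam i * r * (weight i * (2 * D + 1) - 2 * T + 1)
      + mu i * (D + rho i * r) * (weight i * (1 - 2 * D) + 2 * T + 1) + mu0 * T * (1 - 2 * T)
    \<le> (2 * (weight i + 1) * lam i + 2 * weight i * mu i + mu0 / 2) * r - min 1 mu0 * (D\<^sup>2 + T\<^sup>2)"
proof -
  let ?K = "weight i" and ?m = "mu i" and ?l = "lam i"
  have m: "?m > 0" and K: "?K \<ge> 1" using mu_pos weight_ge_1 by auto
  have l: "?m * rho i = ?l" using m by (simp add: rho_def)
  have eq: "?l * r * (?K * (2 * D + 1) - 2 * T + 1)
      + ?m * (D + rho i * r) * (?K * (1 - 2 * D) + 2 * T + 1) + mu0 * T * (1 - 2 * T)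
    = - 2 * (?K * ?m) * D\<^sup>2 + (?K + 1) * (2 * ?l * r + ?m * D) + 2 * ?m * T * D - 2 * mu0 * T\<^sup>2 + mu0 * T"
    unfolding l[symmetric] by (simp add: algebra_simps power2_eq_square)
  \<comment> \<open>Completing the square spends \<open>mu0 / 2\<close> of the available
    \<open>2 * mu0\<close> on \<open>T\<close>. The linear term in \<open>b3\<close> takes another
    \<open>mu0 / 2\<close>, which leaves \<open>mu0\<close>.\<close>
  have b1: "2 * ?m * T * D \<le> mu0 / 2 * T\<^sup>2 + 2 * (?m\<^sup>2 / mu0) * D\<^sup>2"
  proof -
    have "0 \<le> (mu0 * T - 2 * ?m * D)\<^sup>2 / (2 * mu0)" using mu0_pos by simp
    also have "\<dots> = mu0 / 2 * T\<^sup>2 + 2 * (?m\<^sup>2 / mu0) * D\<^sup>2 - 2 * ?m * T * D"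
      using mu0_pos by (simp add: field_simps power2_eq_square)
    finally show ?thesis by simp
  qed
  have b2: "(?K + 1) * ?m * D \<le> (?K * ?m) / 2 * D\<^sup>2 + 2 * (?K * ?m)"
  proof -
    have "0 \<le> (D / 2 - 1)\<^sup>2" by simp
    then have "D \<le> D\<^sup>2 / 4 + 1" by (simp add: power2_eq_square algebra_simps)
    then have "(?K + 1) * ?m * D \<le> (?K + 1) * ?m * (D\<^sup>2 / 4 + 1)"
      using m K by (intro mult_left_mono) auto
    also have "\<dots> \<le> (2 * ?K) * ?m * (D\<^sup>2 / 4 + 1)"
      using m K by (intro mult_right_mono) auto
    finally show ?thesis by (simp add: algebra_simps)
  qed
  have b3: "mu0 * T \<le> mu0 / 2 * T\<^sup>2 + mu0 / 2"
  proof -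
    have "0 \<le> mu0 / 2 * (T - 1)\<^sup>2" using mu0_pos by simp
    then show ?thesis by (simp add: power2_eq_square algebra_simps)
  qed
  have Km: "?K * ?m = ?m + 1 + 4 * (?m\<^sup>2 / mu0)"
    using m mu0_pos by (simp add: weight_def field_simps power2_eq_square)
  have q: "2 * (?m\<^sup>2 / mu0) \<ge> 0" using mu0_pos by simp
  have b4: "(2 * (?m\<^sup>2 / mu0) - 3 / 2 * (?K * ?m)) * D\<^sup>2 \<le> (- 1) * D\<^sup>2"
    by (rule mult_right_mono, unfold Km) (use q m in \<open>simp_all add: algebra_simps\<close>)
  have b5: "min 1 mu0 * (D\<^sup>2 + T\<^sup>2) \<le> D\<^sup>2 + mu0 * T\<^sup>2"
  proof -
    have "min 1 mu0 * D\<^sup>2 \<le> 1 * D\<^sup>2" "min 1 mu0 * T\<^sup>2 \<le> mu0 * T\<^sup>2" by (intro mult_right_mono; simp)+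
    then show ?thesis by (simp add: distrib_left)
  qed
  have b6: "2 * (?K * ?m) + mu0 / 2 \<le> (2 * (?K * ?m) + mu0 / 2) * r"
    using r m K mu0_pos mult_left_mono[of 1 r "2 * (?K * ?m) + mu0 / 2"] by simp
  show ?thesis unfolding eq using b1 b2 b3 b4 b5 b6 by (simp add: algebra_simps)
qed

end

context greedy
begin

definition dev :: "'i \<Rightarrow> 'i state \<Rightarrow> real" where
  "dev i X = actual i (rl X) - rho i * r"

definition Q :: "'i state \<Rightarrow> real" where
  "Q X = (\<Sum>i\<in>UNIV. (dev i X)\<^sup>2 + (tokens i (rl X))\<^sup>2)"

definition V :: "'i state \<Rightarrow> real" where
  "V X = (\<Sum>i\<in>UNIV. weight i * (dev i X)\<^sup>2 + (tokens i (rl X))\<^sup>2)"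

definition fluct :: "'i state \<Rightarrow> real" where
  "fluct X = (\<Sum>i\<in>UNIV. \<bar>dev i X\<bar> + tokens i (rl X))"

lemma Q_nonneg: "Q X \<ge> 0" unfolding Q_def by (intro sum_nonneg) auto

lemma V_ge_Q: "Q X \<le> V X"
  unfolding Q_def V_def
proof (intro sum_mono add_mono order_refl)
  fix i show "(dev i X)\<^sup>2 \<le> weight i * (dev i X)\<^sup>2"
    using mult_right_mono[OF weight_ge_1, of "(dev i X)\<^sup>2" i] by simp
qed

lemma V_nonneg: "V X \<ge> 0" using V_ge_Q Q_nonneg order_trans by blast

lemma fluct_nonneg: "fluct X \<ge> 0" unfolding fluct_def using tokens_nonneg by (intro sum_nonneg) auto

lemma total_eq: "total (rl X) = r + (\<Sum>i\<in>UNIV. dev i X + tokens i (rl X))"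
proof -
  have "(\<Sum>i\<in>UNIV. rho i * r) = r" using rho_sum by (simp add: sum_distrib_right[symmetric])
  then show ?thesis by (simp add: total_def dev_def sum.distrib sum_subtractf)
qed

lemma total_le_fluct: "total (rl X) \<le> r + fluct X"
  unfolding total_eq fluct_def by (intro add_left_mono sum_mono) auto

lemma total_nonneg: "total (rl X) \<ge> 0"
  unfolding total_def using actual_nonneg tokens_nonneg by (intro sum_nonneg) auto

text \<open>Young's inequality with a free parameter. The choice \<open>s = 1 / sqrt r\<close> gives
  a mean of order \<open>sqrt r\<close>, \<open>s = 1\<close> a crude bound, and small
  \<open>s\<close> shows that \<open>fluct\<close> is, up to a constant, below any positive multiple
  of \<open>V\<close>.\<close>

lemma fluct_le: "s > 0 \<Longrightarrow> fluct X \<le> s * Q X + real CARD('i) / (2 * s)"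
proof -
  assume s: "s > 0"
  have *: "\<bar>x\<bar> \<le> s * x\<^sup>2 + 1 / (4 * s)" for x :: real
  proof -
    have "0 \<le> s * (\<bar>x\<bar> - 1 / (2 * s))\<^sup>2" using s by simp
    also have "\<dots> = s * x\<^sup>2 + 1 / (4 * s) - \<bar>x\<bar>" using s by (simp add: power2_diff) (simp add: field_simps power2_eq_square)
    finally show ?thesis by simp
  qed
  have "fluct X \<le> (\<Sum>i\<in>(UNIV::'i set). s * ((dev i X)\<^sup>2 + (tokens i (rl X))\<^sup>2) + 1 / (2 * s))"
    unfolding fluct_def
  proof (rule sum_mono)
    fix i
    show "\<bar>dev i X\<bar> + tokens i (rl X) \<le> s * ((dev i X)\<^sup>2 + (tokens i (rl X))\<^sup>2) + 1 / (2 * s)"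
      using add_mono[OF *[of "dev i X"] *[of "tokens i (rl X)"]] tokens_nonneg[of i X] s
      by (simp add: algebra_simps)
  qed
  also have "\<dots> = s * Q X + real CARD('i) / (2 * s)"
    by (simp add: Q_def sum.distrib sum_distrib_left[symmetric])
  finally show ?thesis .
qed

lemma fluct_sq: "(fluct X)\<^sup>2 \<le> 2 * real CARD('i) * Q X"
proof -
  have "(fluct X)\<^sup>2 \<le> real CARD('i) * (\<Sum>i\<in>(UNIV::'i set). (\<bar>dev i X\<bar> + tokens i (rl X))\<^sup>2)"
    unfolding fluct_def using sum_squared_le_sum_of_squares[of "\<lambda>i. \<bar>dev i X\<bar> + tokens i (rl X)" UNIV]
    by (simp add: mult.commute)
  also have "\<dots> \<le> real CARD('i) * (\<Sum>i\<in>(UNIV::'i set). 2 * ((dev i X)\<^sup>2 + (tokens i (rl X))\<^sup>2))"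
  proof (intro mult_left_mono sum_mono)
    fix i
    have "0 \<le> (\<bar>dev i X\<bar> - tokens i (rl X))\<^sup>2" by simp
    then show "(\<bar>dev i X\<bar> + tokens i (rl X))\<^sup>2 \<le> 2 * ((dev i X)\<^sup>2 + (tokens i (rl X))\<^sup>2)"
      by (simp add: power2_sum power2_diff)
  qed simp
  also have "\<dots> = 2 * real CARD('i) * Q X"
    by (simp only: Q_def sum_distrib_left[symmetric] mult_ac)
  finally show ?thesis .
qed

lemma V_sublevel_finite: "finite {X \<in> St. V X < n}"
proof (rule finite_subset[OF _ finite_total_less])
  show "{X \<in> St. V X < n} \<subseteq> {X \<in> St. total (rl X) < r + (n + real CARD('i) / 2)}"
    using total_le_fluct fluct_le[of 1] V_ge_Q by (auto, smt (verit))
qed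

lemma drift_V:
  assumes X: "X \<in> St"
  shows "drift V X \<le> min 1 mu0 * moment_const * r - min 1 mu0 * Q X"
proof -
  let ?T = "\<lambda>i. tokens i (rl X)"
  have a: "measure_pmf.expectation (arrive X i) V \<le> V X + (weight i * (2 * dev i X + 1) - 2 * ?T i + 1)" for i
  proof (rule expectation_le_const[OF finite_arrive[OF X]])
    fix X' assume "X' \<in> set_pmf (arrive X i)"
    note c = arrive_counts[OF X this]
    \<comment> \<open>For an arrival that finds no token: then \<open>?T i = 0\<close>, and the
      unchanged square is within the allowed change \<open>- 2 * ?T i + 1\<close>.\<close>
    have "?T i \<ge> 0" using tokens_nonneg .
    then show "V X' \<le> V X + (weight i * (2 * dev i X + 1) - 2 * ?T i + 1)"
      unfolding V_def dev_def c by (intro sum_change_one) (auto simp: power2_eq_square algebra_simps)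
  qed
  have s: "measure_pmf.expectation (serve X c i) V \<le> V X + (weight i * (1 - 2 * dev i X) + 2 * ?T i + 1)"
    if c: "c \<in> CK" "X c > 0" "snd c $ i > 0" for c i
  proof (rule expectation_le_const[OF finite_serve[OF X c(1,2)]])
    fix X' assume "X' \<in> set_pmf (serve X c i)"
    note c = serve_counts[OF X c this]
    show "V X' \<le> V X + (weight i * (1 - 2 * dev i X) + 2 * ?T i + 1)"
      unfolding V_def dev_def c by (intro sum_change_one) (auto simp: power2_eq_square algebra_simps)
  qed
  have t: "V (after_token_expiry X c i) \<le> V X + (1 - 2 * ?T i)"
    if c: "c \<in> CK" "X c > 0" "snd c $ i < fst c $ i" for c i
    unfolding V_def dev_def expiry_counts[OF X c]
    by (intro sum_change_one) (auto simp: power2_eq_square algebra_simps)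
  have "drift V X \<le> (\<Sum>i\<in>UNIV. lam i * r * (weight i * (2 * dev i X + 1) - 2 * ?T i + 1)
      + mu i * (dev i X + rho i * r) * (weight i * (1 - 2 * dev i X) + 2 * ?T i + 1) + mu0 * ?T i * (1 - 2 * ?T i))"
    using drift_le[OF X a s t] unfolding sum_actual sum_tokens by (simp add: sum.distrib dev_def)
  also have "\<dots> \<le> (\<Sum>i\<in>UNIV. (2 * (weight i + 1) * lam i + 2 * weight i * mu i + mu0 / 2) * r
       - min 1 mu0 * ((dev i X)\<^sup>2 + (?T i)\<^sup>2))"
    by (intro sum_mono quadratic_drift r_ge_1)
  also have "\<dots> = (\<Sum>i\<in>UNIV. 2 * (weight i + 1) * lam i + 2 * weight i * mu i + mu0 / 2) * r - min 1 mu0 * Q X"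
    by (simp only: sum_subtractf Q_def sum_distrib_left sum_distrib_right)
  also have "(\<Sum>i\<in>UNIV. 2 * (weight i + 1) * lam i + 2 * weight i * mu i + mu0 / 2) = min 1 mu0 * moment_const"
    using mu0_pos by (simp add: moment_const_def)
  finally show ?thesis .
qed

end

locale stationary_greedy = greedy B b lam mu rho mu0 \<alpha> r sel rep
  for B :: "'n::finite \<Rightarrow> real" and b :: "'i::finite \<Rightarrow> 'n \<Rightarrow> real"
  and lam mu rho :: "'i \<Rightarrow> real" and mu0 \<alpha> r :: real and sel rep +
  fixes P :: "real \<Rightarrow> 'i state \<Rightarrow> 'i state pmf" and p :: "'i state pmf"
  assumes markov: "markov_transition_function (states B b) P"
    and rates: "has_transition_rates (states B b) P (greedy_rate B b lam mu mu0 r sel rep)"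
    and stationary: "stationary_distribution (states B b) P p"
begin

sublocale chain: stationary_chain St P "greedy_rate B b lam mu mu0 r sel rep" p successors
  by unfold_locales
    (use markov rates stationary finite_successors successors_St rate_outside rate_nonneg in auto)

lemma generator_eq_drift: "chain.generator f X = drift f X"
  by (simp add: chain.generator_def drift_def)

lemma second_moment: "integrable p Q" "measure_pmf.expectation p Q \<le> moment_const * r"
proof -
  let ?c = "min 1 mu0"
  have c: "?c > 0" using mu0_pos by simp
  have *: "integrable p (\<lambda>X. ?c * Q X)" "measure_pmf.expectation p (\<lambda>X. ?c * Q X) \<le> ?c * moment_const * r"
    using chain.foster_bound[where V=V and U="\<lambda>X. ?c * Q X" and C="?c * moment_const * r"]
      V_nonneg V_sublevel_finite drift_V Q_nonneg c moment_const_nonneg r_ge_1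
    by (auto simp: generator_eq_drift)
  from *(1) have "integrable p (\<lambda>X. inverse ?c * (?c * Q X))" by (rule integrable_mult_right)
  then show "integrable p Q" using c by (simp add: mult.assoc[symmetric])
  from *(2) have "?c * measure_pmf.expectation p Q \<le> ?c * (moment_const * r)" by (simp add: mult_ac)
  then show "measure_pmf.expectation p Q \<le> moment_const * r" using c by (simp only: mult_le_cancel_left_pos)
qed

lemma integrable_Q_bound:
  assumes "\<And>X. \<bar>g X\<bar> \<le> c1 + c2 * Q X"
  shows "integrable p g"
proof (rule Bochner_Integration.integrable_bound)
  show "integrable p (\<lambda>X. c1 + c2 * Q X)"
    using second_moment(1) by (intro Bochner_Integration.integrable_add integrable_mult_right) auto
  show "AE X in p. norm (g X) \<le> norm (c1 + c2 * Q X)"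
    using assms abs_ge_self order_trans by (fastforce simp: AE_measure_pmf_iff)
qed simp

text \<open>The form in which stationarity is used from here on: the mean of a gain \<open>g\<close>
  that can be split off from the drift is paid for by the remaining terms. The condition
  \<open>low\<close> admits test functions that are unbounded from below, such as a potential minus
  a multiple of the number of tokens.\<close>

lemma expected_gain_le:
  fixes f g :: "'i state \<Rightarrow> real"
  assumes low: "\<And>e. e > 0 \<Longrightarrow> \<exists>c. \<forall>X\<in>St. f X \<ge> - c - e * V X"
    and drift: "\<And>X. X \<in> St \<Longrightarrow> drift f X \<le> c1 + c2 * Q X - g X"
    and g: "\<And>X. \<bar>g X\<bar> \<le> c3 + c4 * Q X" and c2: "c2 \<ge> 0"
  shows "measure_pmf.expectation p g \<le> c1 + c2 * (moment_const * r)"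
proof -
  have int: "integrable p g" using g by (rule integrable_Q_bound)
  have "0 \<le> measure_pmf.expectation p (\<lambda>X. c1 + c2 * Q X - g X)"
  proof (rule chain.stationary_generator_nonneg[where f=f and V=V and C="min 1 mu0 * moment_const * r"])
    show "chain.generator V X \<le> min 1 mu0 * moment_const * r" if "X \<in> St" for X
      using drift_V[OF that] Q_nonneg[of X] mu0_pos
      by (smt (verit) generator_eq_drift mult_nonneg_nonneg)
    show "integrable p (\<lambda>X. c1 + c2 * Q X - g X)" using int second_moment(1) by auto
  qed (use V_nonneg V_sublevel_finite low drift in \<open>auto simp: generator_eq_drift\<close>)
  also have "\<dots> = c1 + c2 * measure_pmf.expectation p Q - measure_pmf.expectation p g"
    using int second_moment(1) by simp
  finally show ?thesis using mult_left_mono[OF second_moment(2) c2] by linarith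
qed

end

section \<open>The potential of the aggregate configurations\<close>

context vector_packing
begin

text \<open>For \<open>u \<le> 2\<close> this is the derivative of a summand of \<open>Phi\<close>
  with respect to the mass of its class.\<close>

definition h :: "real \<Rightarrow> real" where "h u = min u 2 powr \<alpha>"

definition hmax :: real where "hmax = 2 powr \<alpha>"

definition max_rate :: real where "max_rate = (\<Sum>i\<in>UNIV. lam i + mu i) + mu0"

definition inc :: "('i cconf \<Rightarrow> real) \<Rightarrow> 'i conf \<Rightarrow> 'i \<Rightarrow> real" where
  "inc x k i = h (cnt (cls (k + axis i 1)) x) - h (cnt (cls k) x)"

text \<open>What a type \<open>i\<close> customer of a server in \<open>k\<close> would save by
  joining \<open>k'\<close> instead. Availability is required with a margin \<open>\<theta>\<close>,
  so that the class of \<open>k'\<close> is still occupied after the departure that precedes the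
  placement.\<close>

definition gap :: "real \<Rightarrow> 'i conf \<Rightarrow> 'i \<Rightarrow> 'i conf \<Rightarrow> ('i cconf \<Rightarrow> real) \<Rightarrow> real" where
  "gap \<theta> k i k' x = (if k' = 0 \<or> cnt (cls k') x \<ge> \<theta> then max 0 (inc x (k - axis i 1) i - inc x k' i) else 0)"

lemma h_zero: "h 0 = 0" by (simp add: h_def)

lemma h_nonneg: "h u \<ge> 0" by (simp add: h_def)

lemma h_mono: "0 \<le> u \<Longrightarrow> u \<le> v \<Longrightarrow> h u \<le> h v"
  unfolding h_def using alpha_pos by (intro powr_mono2) auto

lemma h_le_hmax: "0 \<le> u \<Longrightarrow> h u \<le> hmax"
  unfolding h_def hmax_def using alpha_pos by (intro powr_mono2) auto

lemma hmax_pos: "hmax > 0" by (simp add: hmax_def)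

text \<open>For \<open>\<alpha> < 1\<close> the slope at 0 is infinite, so uniform continuity takes
  the place of a Lipschitz bound; hence the unspecified \<open>e\<close> in the later error
  terms.\<close>

lemma h_step_small:
  assumes e: "e > 0"
  shows "\<exists>R. \<forall>r\<ge>R. r > 0 \<longrightarrow> (\<forall>n::nat. h ((real n + 1) / r) \<le> h (real n / r) + e)"
proof -
  have "uniformly_continuous_on {0..2} (\<lambda>u::real. u powr \<alpha>)"
    using alpha_pos by (intro compact_uniformly_continuous continuous_on_powr' continuous_intros) auto
  then obtain d where d: "d > 0" "\<And>u v. u \<in> {0..2} \<Longrightarrow> v \<in> {0..2} \<Longrightarrow> dist u v < d \<Longrightarrow> dist (u powr \<alpha>) (v powr \<alpha>) < e"
    using e unfolding uniformly_continuous_on_def by metis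
  have "h ((real n + 1) / r) \<le> h (real n / r) + e" if r: "r \<ge> 2 / d" "r > 0" for r n
  proof -
    let ?u = "min ((real n + 1) / r) 2" and ?v = "min (real n / r) 2"
    have "1 / r < d" "1 / r > 0" using r d by (simp_all add: field_simps)
    moreover have "\<bar>min (a + t) 2 - min a 2\<bar> \<le> t" if "t > 0" for a t :: real using that by (auto simp: min_def)
    ultimately have "\<bar>min (real n / r + 1 / r) 2 - ?v\<bar> < d" by (meson le_less_trans)
    then have "dist ?u ?v < d" by (simp add: dist_real_def add_divide_distrib)
    then have "dist (?u powr \<alpha>) (?v powr \<alpha>) < e" using r by (intro d) auto
    then show ?thesis by (simp add: h_def dist_real_def)
  qed
  then show ?thesis by blast
qed

lemma max_rate_pos: "max_rate > 0"
  unfolding max_rate_def using lam_pos mu_pos mu0_pos by (intro add_nonneg_pos sum_nonneg) (auto simp: less_imp_le)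

lemma mu_le: "mu i \<le> max_rate" and mu0_le: "mu0 \<le> max_rate"
proof -
  have "lam i + mu i \<le> (\<Sum>i\<in>UNIV. lam i + mu i)"
    using lam_pos mu_pos by (intro member_le_sum) (auto simp: less_imp_le add_nonneg_nonneg)
  then show "mu i \<le> max_rate"
    using lam_pos[of i] mu_pos[of i] mu0_pos by (auto simp: max_rate_def)
  have "(\<Sum>i\<in>UNIV. lam i + mu i) \<ge> 0"
    using lam_pos mu_pos by (intro sum_nonneg) (auto simp: less_imp_le add_nonneg_nonneg)
  then show "mu0 \<le> max_rate" by (simp add: max_rate_def)
qed

lemma sum_lam_le: "(\<Sum>i\<in>UNIV. lam i) \<le> max_rate"
  unfolding max_rate_def sum.distrib using mu0_pos mu_pos sum_nonneg[of UNIV mu] by (simp add: less_imp_le)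

lemma cnt_zero_cls: "cnt (cls 0) x = 0"
  unfolding cnt_def lin_def cls_zero using zero_notin_CK by (intro sum.neutral) (auto simp: prod_eq_iff)

lemma gap_nonneg: "gap \<theta> k i k' x \<ge> 0" by (simp add: gap_def)

lemma gap_le:
  assumes "\<And>c. c \<in> CK \<Longrightarrow> x c \<ge> 0"
  shows "gap \<theta> k i k' x \<le> 2 * hmax"
proof -
  have "0 \<le> h (cnt q x)" "h (cnt q x) \<le> hmax" for q
    using h_nonneg h_le_hmax cnt_nonneg[OF assms] by auto
  then have "inc x k1 i \<le> hmax" "- inc x k1 i \<le> hmax" for k1
    unfolding inc_def by (smt (verit))+
  then show ?thesis unfolding gap_def using hmax_pos by (smt (verit))
qed

end

section \<open>The discretised potential and its change at each event\<close>

context greedy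
begin

abbreviation sc :: "'i state \<Rightarrow> 'i cconf \<Rightarrow> real" where "sc X \<equiv> (\<lambda>c. real (X c) / r)"

abbreviation cn :: "'i conf \<Rightarrow> 'i state \<Rightarrow> real" where "cn k X \<equiv> real (aconf_count X (cls k))"

lemma r_pos: "r > 0" using r_ge_1 by simp

lemma cn_cnt: "X \<in> St \<Longrightarrow> cn k X = cnt (cls k) (rl X)"
  by (rule aconf_count_cnt) (auto simp: cls_subset)

lemma cn_sc: "X \<in> St \<Longrightarrow> cnt (cls k) (sc X) = cn k X / r"
  by (simp add: cn_cnt cnt_scale)

lemma cn_zero: "X \<in> St \<Longrightarrow> cn 0 X = 0"
  using cn_cnt cnt_zero_cls by metis

lemma cn_le_total: "X \<in> St \<Longrightarrow> cn k X \<le> total (rl X)"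
  unfolding cn_cnt by (rule cnt_le_total) simp

lemma cn_move:
  assumes "X \<in> St" "movable X c c'" "k \<in> K"
  shows "cn k (move_server c c' X) = cn k X - (if fst c \<in> cls k then 1 else 0) + (if fst c' \<in> cls k then 1 else 0)"
proof -
  have "0 \<notin> cls k" using cls_subset_K[OF assms(3)] by (auto simp: K_iff)
  then show ?thesis
    using assms by (simp add: cn_cnt move_in_St cnt_move)
qed

text \<open>A Riemann sum for \<open>r\<close> times the primitive of \<open>h\<close>, made so that
  adding or removing one server changes it by exactly one value of \<open>h\<close>.\<close>

definition potsum :: "nat \<Rightarrow> real" where "potsum n = (\<Sum>m=1..n. h (real m / r))"

lemma potsum_Suc: "potsum (Suc n) = potsum n + h ((real n + 1) / r)"
  by (simp add: potsum_def add.commute)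

definition pot :: "'i state \<Rightarrow> real" where
  "pot X = (\<Sum>q\<in>aconfs B b. potsum (aconf_count X q))"

lemma pot_nonneg: "pot X \<ge> 0"
  unfolding pot_def potsum_def using h_nonneg by (intro sum_nonneg) auto

lemma cls_in_aconfs: "k \<in> K0 \<Longrightarrow> cls k \<in> aconfs B b \<longleftrightarrow> k \<noteq> 0"
proof
  assume k: "k \<in> K0" "cls k \<in> aconfs B b"
  then show "k \<noteq> 0" by (auto simp: aconfs_def zero_cls)
qed (auto simp: aconfs_iff K_iff)

text \<open>A class of \<open>n\<close> servers loses \<open>h (n / r)\<close> with one of them and
  gains \<open>h ((n + 1) / r)\<close> with one more. The empty class is not part of the potential:
  as a source it drops out because its count is 0, as a target it needs the case
  distinction.\<close>

lemma pot_move: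
  assumes X: "X \<in> St" and m: "movable X c c'" and k: "fst c \<in> K0" "fst c' \<in> K0"
    and neq: "cls (fst c) \<noteq> cls (fst c')"
  shows "pot (move_server c c' X) = pot X - h (cn (fst c) X / r) +
      (if fst c' = 0 then 0 else h ((cn (fst c') X + 1) / r))"
proof -
  let ?X = "move_server c c' X"
  have "pot ?X - pot X = (\<Sum>q\<in>aconfs B b. potsum (aconf_count ?X q) - potsum (aconf_count X q))"
    by (simp add: pot_def sum_subtractf)
  also have "\<dots> = (\<Sum>q\<in>aconfs B b. (if q = cls (fst c) then - h (cn (fst c) X / r) else 0)
       + (if q = cls (fst c') then h ((cn (fst c') X + 1) / r) else 0))"
  proof (rule sum.cong[OF refl])
    fix q assume "q \<in> aconfs B b"
    then obtain k1 where k1: "k1 \<in> K" "q = cls k1" by (auto simp: aconfs_iff)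
    have mem: "k2 \<in> cls k1 \<longleftrightarrow> cls k2 = cls k1" if "k2 \<in> K0" for k2
      using cls_eq cls_self that by metis
    note cm = cn_move[OF X m k1(1)]
    consider "q = cls (fst c)" "q \<noteq> cls (fst c')" | "q \<noteq> cls (fst c)" "q = cls (fst c')" | "q \<noteq> cls (fst c)" "q \<noteq> cls (fst c')"
      using neq by blast
    then show "potsum (aconf_count ?X q) - potsum (aconf_count X q) =
       (if q = cls (fst c) then - h (cn (fst c) X / r) else 0)
       + (if q = cls (fst c') then h ((cn (fst c') X + 1) / r) else 0)"
    proof cases
      case 1
      then have "cn k1 ?X + 1 = cn k1 X" using cm mem k k1 by auto
      then have "real (aconf_count X q) = real (Suc (aconf_count ?X q))" using k1 by simp
      then have "aconf_count X q = Suc (aconf_count ?X q)" by (simp only: of_nat_eq_iff)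
      then show ?thesis using 1 potsum_Suc[of "aconf_count ?X q"] by (simp add: add.commute)
    next
      case 2
      then have "cn k1 ?X = cn k1 X + 1" using cm mem k k1 by auto
      then have "real (aconf_count ?X q) = real (Suc (aconf_count X q))" using k1 by simp
      then have "aconf_count ?X q = Suc (aconf_count X q)" by (simp only: of_nat_eq_iff)
      then show ?thesis using 2 potsum_Suc[of "aconf_count X q"] by simp
    next
      case 3
      then have "cn k1 ?X = cn k1 X" using cm mem k k1 by auto
      then show ?thesis using 3 k1 by simp
    qed
  qed
  also have "\<dots> = (if fst c = 0 then 0 else - h (cn (fst c) X / r)) +
      (if fst c' = 0 then 0 else h ((cn (fst c') X + 1) / r))"
    using finite_aconfs cls_in_aconfs k by (simp add: sum.distrib sum.delta)
  finally show ?thesis using cn_zero[OF X] h_zero by (auto split: if_splits)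
qed

lemma pot_move_le:
  assumes X: "X \<in> St" and m: "movable X c c'" and k: "fst c \<in> K0" "fst c' \<in> K0"
    and neq: "cls (fst c) \<noteq> cls (fst c')"
  shows "pot (move_server c c' X) \<le> pot X + hmax"
proof -
  have "h (cn (fst c) X / r) \<ge> 0" "h ((cn (fst c') X + 1) / r) \<le> hmax"
    using h_nonneg h_le_hmax r_pos by auto
  then show ?thesis unfolding pot_move[OF assms] using hmax_pos by auto
qed

lemma pot_move_same:
  assumes X: "X \<in> St" and m: "movable X c c'" and same: "fst c = fst c'"
  shows "pot (move_server c c' X) = pot X"
proof -
  have "aconf_count (move_server c c' X) q = aconf_count X q" if q: "q \<in> aconfs B b" for q
  proof -
    obtain k where "k \<in> K" "q = cls k" using q by (auto simp: aconfs_iff)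
    then show ?thesis using cn_move[OF X m, of k] same by simp
  qed
  then show ?thesis by (simp add: pot_def)
qed

text \<open>With at most \<open>2 * r\<close> customers the cut-off is inactive, and powers are
  homogeneous. So the algorithm minimises the first-order change of the potential.\<close>

lemma increment_eq:
  assumes Y: "Y \<in> St" and tot: "total (rl Y) \<le> 2 * r" and k: "k \<in> K0" "k + axis i 1 \<in> K0"
  shows "ac_increment B b \<alpha> Y i (cls k) = r powr \<alpha> * (h (cn (k + axis i 1) Y / r) - h (cn k Y / r))"
proof -
  have *: "cn k Y powr \<alpha> = r powr \<alpha> * h (cn k Y / r)" for k
  proof -
    have "cn k Y / r \<le> 2" using cn_le_total[OF Y, of k] tot r_pos by (simp add: field_simps)
    then have "h (cn k Y / r) = cn k Y powr \<alpha> / r powr \<alpha>" using r_pos by (simp add: h_def powr_divide)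
    then show ?thesis using r_pos by simp
  qed
  have "ac_increment B b \<alpha> Y i (cls k) = cn (k + axis i 1) Y powr \<alpha> - cn k Y powr \<alpha>"
    unfolding ac_increment_def using aconf_add_cls[OF k(2,1)] cls_eq_zero_iff[OF k(1)] cn_zero[OF Y]
    by (simp add: zero_cls)
  then show ?thesis unfolding * by (simp add: algebra_simps)
qed

lemma placed_class:
  assumes Y: "Y \<in> St" and c: "c \<in> set_pmf (place Y i)"
  shows "sel Y i = cls (fst c)"
  using pick_server_support(2)[OF Y sel_candidate[OF Y] c] sel_candidate[OF Y, of i] cls_eq
  by (auto simp: candidates_iff)

lemma place_pot:
  assumes Y: "Y \<in> St" and c: "c \<in> set_pmf (place Y i)" and m: "movable Y c (fst c + axis i 1, l)"
  shows "pot (move_server c (fst c + axis i 1, l) Y) =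
    pot Y - h (cn (fst c) Y / r) + h ((cn (fst c + axis i 1) Y + 1) / r)"
  using pot_move[OF Y m] pick_server_support(3,5)[OF Y sel_candidate[OF Y] c] cls_add_neq[of "fst c" i]
  by (simp add: add_axis_nonzero)

lemma place_pot_le:
  assumes Y: "Y \<in> St" and c: "c \<in> set_pmf (place Y i)" and m: "movable Y c (fst c + axis i 1, l)"
  shows "pot (move_server c (fst c + axis i 1, l) Y) \<le> pot Y + hmax"
proof -
  have "h (cn (fst c) Y / r) \<ge> 0" "h ((cn (fst c + axis i 1) Y + 1) / r) \<le> hmax"
    using h_nonneg h_le_hmax r_pos by auto
  then show ?thesis unfolding place_pot[OF assms] by linarith
qed

lemma removable:
  assumes "c \<in> CK" "fst c $ i > 0"
  shows "fst c - axis i 1 + axis i 1 = fst c" "fst c - axis i 1 \<in> K0" "fst c \<in> K0"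
    "cls (fst c) \<noteq> cls (fst c - axis i 1)"
proof -
  show 1: "fst c - axis i 1 + axis i 1 = fst c" using diff_add_axis assms(2) .
  show 3: "fst c \<in> K0" using assms by (simp add: CK_iff K_iff)
  then show 2: "fst c - axis i 1 \<in> K0" by (rule minus_K0)
  show "cls (fst c) \<noteq> cls (fst c - axis i 1)" using cls_add_neq[OF 2, of i] 1 3 by simp
qed

lemma departed_pot:
  assumes X: "X \<in> St" and c: "c \<in> CK" "X c > 0" "snd c $ i > 0"
  shows "pot (departed c i X) = pot X - h (cn (fst c) X / r)
    + (if fst c - axis i 1 = 0 then 0 else h ((cn (fst c - axis i 1) X + 1) / r))"
proof -
  have "fst c $ i > 0" using c by (auto simp: CK_iff less_eq_vec_def intro: less_le_trans)
  note rm = removable[OF c(1) this]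
  show ?thesis using pot_move[OF X departed_movable[of c X i, OF c(1,2)]] rm by simp
qed

lemma departed_cn:
  assumes X: "X \<in> St" and c: "c \<in> CK" "X c > 0" "snd c $ i > 0" and k: "k \<in> K"
  shows "cn k (departed c i X) = cn k X - (if fst c \<in> cls k then 1 else 0) + (if fst c - axis i 1 \<in> cls k then 1 else 0)"
  using cn_move[OF X departed_movable[of c X i, OF c(1,2)] k] by simp

text \<open>A service is a departure followed by a placement in the resulting state
  \<open>?Y\<close>, and the chosen class minimises the increment in \<open>?Y\<close>. Comparison
  with the class just entered by the departing server excludes growth; comparison with
  \<open>k'\<close> exhibits the gain.\<close>

lemma serve_pot:
  assumes X: "X \<in> St" and c: "c \<in> CK" "X c > 0" "snd c $ i > 0" and X': "X' \<in> set_pmf (serve X c i)"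
    and tot: "total (rl X) \<le> 2 * r" and e: "\<And>n::nat. h ((real n + 1) / r) \<le> h (real n / r) + e" "e \<ge> 0"
    and k': "k' \<in> K0" "k' + axis i 1 \<in> K0" and th: "2 \<le> \<theta> * r"
  shows "pot X' \<le> pot X + 4 * e - gap \<theta> (fst c) i k' (sc X)"
proof -
  let ?Y = "departed c i X"
  let ?k = "fst c" and ?l = "fst c - axis i 1"
  note Y = departed_St[OF X c(1,2), of i]
  have "?k $ i > 0" using c by (auto simp: CK_iff less_eq_vec_def intro: less_le_trans)
  note rm = removable[OF c(1) this]
  have kK: "?k \<in> K" using c by (simp add: CK_iff)
  have totY: "total (rl ?Y) \<le> 2 * r"
  proof -
    have "total (rl ?Y) \<le> total (rl X)"
      unfolding total_def by (intro sum_mono) (simp add: departed_counts[OF X c])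
    then show ?thesis using tot by simp
  qed
  obtain c' where c': "c' \<in> set_pmf (place ?Y i)" "X' = move_server c' (fst c' + axis i 1, snd c') ?Y"
    using X' by (auto simp: serve_eq)
  note sup = pick_server_support[OF Y sel_candidate[OF Y] c'(1)]
  define I where "I k2 = h (cn (k2 + axis i 1) ?Y / r) - h (cn k2 ?Y / r)" for k2
  have min: "I (fst c') \<le> I k2" if "k2 \<in> K0" "k2 + axis i 1 \<in> K0" "k2 = 0 \<or> cn k2 ?Y > 0" for k2
  proof -
    have "cls k2 \<in> ac_candidates B b ?Y i" using that by (auto simp: candidates_iff)
    then have "ac_increment B b \<alpha> ?Y i (cls (fst c')) \<le> ac_increment B b \<alpha> ?Y i (cls k2)"
      using sel_minimal[OF Y] placed_class[OF Y c'(1)] by metis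
    then have "r powr \<alpha> * I (fst c') \<le> r powr \<alpha> * I k2"
      unfolding I_def using increment_eq[OF Y totY] that sup by simp
    then show ?thesis using r_pos by (simp add: mult_le_cancel_left_pos)
  qed
  have pX': "pot X' \<le> pot ?Y + e + I (fst c')"
    unfolding c'(2) I_def using place_pot[OF Y c'(1) placed_movable(2)[OF Y c'(1)]]
      e(1)[of "aconf_count ?Y (cls (fst c' + axis i 1))"] by linarith
  have kl: "?k \<notin> cls ?l" "?l \<notin> cls ?k" using rm cls_eq by metis+
  have cnk: "cn ?k ?Y = cn ?k X - 1"
    using departed_cn[OF X c kK] kl rm by simp
  \<comment> \<open>The token may return to the class of \<open>?l\<close>, which is occupied by the
    server that it left; the contributions of \<open>?l\<close> to departure and placement then
    cancel.\<close>
  have first: "pot X' \<le> pot X + e"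
  proof -
    have "cn ?l ?Y = cn ?l X + 1" if "?l \<noteq> 0"
      using departed_cn[OF X c, of ?l] kl rm that by (simp add: K_iff)
    moreover have "cn ?l ?Y = 0" if "?l = 0" using cn_zero[OF Y] that by simp
    moreover have "I (fst c') \<le> I ?l"
    proof (rule min)
      show "?l = 0 \<or> cn ?l ?Y > 0" using calculation(1) of_nat_0_le_iff[of "aconf_count X (cls ?l)"] by linarith
    qed (use rm in auto)
    moreover have "h (cn ?k ?Y / r) \<le> h (cn ?k X / r)"
      using r_pos cnk by (intro h_mono) (auto simp: divide_right_mono)
    ultimately show ?thesis
      using pX' departed_pot[OF X c] h_zero unfolding I_def rm(1) by (cases "?l = 0") auto
  qed
  \<comment> \<open>The \<open>4 * e\<close> consists of one \<open>e\<close> for the placement, two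
    for reading the increment at \<open>k'\<close> in \<open>X\<close> instead of \<open>?Y\<close>,
    and one for the departure.\<close>
  have second: "pot X' \<le> pot X + 4 * e - (inc (sc X) ?l i - inc (sc X) k' i)"
    if av: "k' = 0 \<or> cnt (cls k') (sc X) \<ge> \<theta>"
  proof -
    have hstep: "h ((n + 1) / r) \<le> h (n / r) + e" if "n = real m" for n m using e(1)[of m] that by simp
    have up: "h (cn k2 ?Y / r) \<le> h (cn k2 X / r) + e" if "k2 \<in> K" for k2
    proof -
      have "h (cn k2 ?Y / r) \<le> h ((cn k2 X + 1) / r)"
        using departed_cn[OF X c that] r_pos by (intro h_mono divide_right_mono) auto
      then show ?thesis using e(1)[of "aconf_count X (cls k2)"] by linarith
    qed
    have down: "h (cn k2 X / r) \<le> h (cn k2 ?Y / r) + e" if "k2 \<in> K" for k2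
    proof -
      have "h (cn k2 X / r) \<le> h ((cn k2 ?Y + 1) / r)"
        using departed_cn[OF X c that] r_pos by (intro h_mono divide_right_mono) auto
      then show ?thesis using e(1)[of "aconf_count ?Y (cls k2)"] by linarith
    qed
    \<comment> \<open>By \<open>th\<close> the class has at least two servers in \<open>X\<close>,
      and the departure takes away at most one.\<close>
    have "cn k' ?Y > 0" if "k' \<noteq> 0"
    proof -
      have "cn k' X \<ge> \<theta> * r" using av that r_pos by (simp add: cn_sc[OF X] field_simps)
      then show ?thesis using th departed_cn[OF X c, of k'] k' that by (auto simp: K_iff)
    qed
    then have "k' = 0 \<or> cn k' ?Y > 0" by blast
    then have "I (fst c') \<le> I k'" by (rule min[OF k'])
    also have "I k' \<le> inc (sc X) k' i + 2 * e"
    proof -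
      have "k' + axis i 1 \<in> K" using k' by (simp add: K_iff add_axis_nonzero)
      note up[OF this]
      moreover have "h (cn k' X / r) \<le> h (cn k' ?Y / r) + e"
        using down[of k'] k' e(2) cn_zero[OF X] cn_zero[OF Y] by (cases "k' = 0") (auto simp: K_iff)
      ultimately show ?thesis unfolding I_def inc_def cn_sc[OF X] by linarith
    qed
    finally have 1: "I (fst c') \<le> inc (sc X) k' i + 2 * e" .
    have "pot ?Y \<le> pot X - inc (sc X) ?l i + e"
      using departed_pot[OF X c] e(1)[of "aconf_count X (cls ?l)"] e(2) h_zero cn_zero[OF X]
      unfolding inc_def cn_sc[OF X] rm(1) by auto
    then show ?thesis using 1 pX' by linarith
  qed
  show ?thesis using first second e(2) unfolding gap_def by (auto simp: max_def)
qed

end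

text \<open>Multiplied by \<open>mu i\<close>, the rate at which type \<open>i\<close> services hit
  servers of configuration \<open>k\<close>; it is the weight with which a gap at \<open>k\<close>
  is seen.\<close>

definition (in packing) served :: "'i conf \<Rightarrow> 'i \<Rightarrow> ('i cconf \<Rightarrow> real) \<Rightarrow> real" where
  "served k i x = lin (\<lambda>c. if fst c = k then real (snd c $ i) else 0) x"

context vector_packing
begin

text \<open>The factor 24 is \<open>4 * 3 * 2\<close>, from the states with more than
  \<open>2 * r\<close> customers in \<open>drift_token_pot\<close>; it also covers the other
  states.\<close>

definition gap_const :: real where "gap_const = 24 * real CARD('i) * hmax * max_rate"

text \<open>The error \<open>4 * e\<close> per service times the total service rate, with
  \<open>r + Q X\<close> and \<open>e\<close> factored out.\<close>

definition step_const :: real where "step_const = 4 * max_rate * (1 + real CARD('i))"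

end

section \<open>Drift of the potential compensated by the tokens\<close>

context greedy
begin

lemma served_nonneg: "served k i (rl X) \<ge> 0"
  unfolding served_def by (rule lin_nonneg) auto

lemma served_le_total: "served k i (rl X) \<le> total (rl X)"
proof -
  have "served k i (rl X) \<le> actual i (rl X)"
    unfolding served_def actual_def by (rule lin_mono) auto
  also have "\<dots> \<le> actual i (rl X) + tokens i (rl X)" using tokens_nonneg by simp
  also have "\<dots> \<le> total (rl X)"
    unfolding total_def using actual_nonneg tokens_nonneg by (intro member_le_sum add_nonneg_nonneg) auto
  finally show ?thesis .
qed

lemma sum_served:
  "(\<Sum>i\<in>UNIV. \<Sum>c\<in>CK. mu i * real (snd c $ i) * real (X c) * (if fst c = k \<and> i = j then v else 0))
     = mu j * served k j (rl X) * v"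
proof -
  have "(\<Sum>i\<in>UNIV. \<Sum>c\<in>CK. mu i * real (snd c $ i) * real (X c) * (if fst c = k \<and> i = j then v else 0)) =
     (\<Sum>i\<in>UNIV. if i = j then mu j * served k j (rl X) * v else 0)"
  proof (rule sum.cong[OF refl])
    fix i
    show "(\<Sum>c\<in>CK. mu i * real (snd c $ i) * real (X c) * (if fst c = k \<and> i = j then v else 0)) =
      (if i = j then mu j * served k j (rl X) * v else 0)"
    proof (cases "i = j")
      case True
      have "mu j * served k j (rl X) * v =
          (\<Sum>c\<in>CK. mu j * ((if fst c = k then real (snd c $ j) else 0) * real (X c)) * v)"
        by (simp add: served_def lin_def sum_distrib_left sum_distrib_right)
      also have "\<dots> = (\<Sum>c\<in>CK. mu i * real (snd c $ i) * real (X c) * (if fst c = k \<and> i = j then v else 0))"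
        using True by (intro sum.cong) auto
      finally show ?thesis using True by simp
    qed simp
  qed
  then show ?thesis by simp
qed

definition total_rate :: "'i state \<Rightarrow> real" where
  "total_rate X = (\<Sum>i\<in>UNIV. lam i * r) + (\<Sum>i\<in>UNIV. mu i * actual i (rl X)) + (\<Sum>i\<in>UNIV. mu0 * tokens i (rl X))"

lemma total_rate_le: "total_rate X \<le> max_rate * (r + total (rl X))"
proof -
  have "(\<Sum>i\<in>UNIV. lam i * r) \<le> max_rate * r"
    using sum_lam_le r_pos by (simp add: sum_distrib_right[symmetric])
  moreover have "(\<Sum>i\<in>UNIV. mu i * actual i (rl X)) \<le> (\<Sum>i\<in>UNIV. max_rate * actual i (rl X))"
    using mu_le actual_nonneg by (intro sum_mono mult_right_mono) auto
  moreover have "(\<Sum>i\<in>UNIV. mu0 * tokens i (rl X)) \<le> (\<Sum>i\<in>UNIV. max_rate * tokens i (rl X))"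
    using mu0_le tokens_nonneg by (intro sum_mono mult_right_mono) auto
  moreover have "max_rate * total (rl X) = (\<Sum>i\<in>UNIV. max_rate * actual i (rl X)) + (\<Sum>i\<in>UNIV. max_rate * tokens i (rl X))"
    by (simp add: total_def sum.distrib sum_distrib_left distrib_left)
  ultimately show ?thesis unfolding total_rate_def by (simp add: distrib_left)
qed

lemma sqrt_r: "sqrt r > 0" "sqrt r \<le> r" "r = sqrt r * sqrt r"
proof -
  show "sqrt r \<le> r" using r_ge_1 real_sqrt_le_iff[of r "r\<^sup>2"] power_increasing[of 1 2 r] r_pos by (simp add: power2_eq_square)
qed (use r_pos in auto)

lemma fluct_le_sqrt: "fluct X \<le> Q X / sqrt r + real CARD('i) * sqrt r"
proof -
  have "fluct X \<le> 1 / sqrt r * Q X + real CARD('i) / (2 * (1 / sqrt r))"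
    using sqrt_r by (intro fluct_le) simp
  also have "\<dots> \<le> Q X / sqrt r + real CARD('i) * sqrt r" using sqrt_r by simp
  finally show ?thesis .
qed

lemma fluct_le_r: "fluct X \<le> Q X + real CARD('i) * r"
proof -
  have "fluct X \<le> Q X + real CARD('i) / 2" using fluct_le[of 1] by simp
  also have "real CARD('i) / 2 \<le> real CARD('i) * r" using mult_left_mono[OF r_ge_1, of "real CARD('i)"] by simp
  finally show ?thesis by simp
qed

text \<open>With \<open>hmax\<close> per token, an arrival adds at most \<open>hmax\<close> in both
  cases: a replacement removes a token at constant potential, and a placement raises the potential
  by at most \<open>hmax\<close>. A service subtracts \<open>hmax\<close> apart from the change of
  the potential. Since \<open>lam i = mu i * rho i\<close>, these contributions balance up to the
  deviations.\<close>

definition token_pot :: "'i state \<Rightarrow> real" where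
  "token_pot X = pot X + (- hmax) * (\<Sum>i\<in>UNIV. tokens i (rl X))"

lemma token_pot_arrive:
  assumes X: "X \<in> St" and X': "X' \<in> set_pmf (arrive X i)"
  shows "token_pot X' \<le> token_pot X + hmax"
proof -
  have tok: "(\<Sum>j\<in>UNIV. tokens j (rl X')) = (\<Sum>j\<in>UNIV. tokens j (rl X)) - (if tokens i (rl X) > 0 then 1 else 0)"
    unfolding arrive_counts(2)[OF X X'] sum_subtractf by (cases "tokens i (rl X) > 0") simp_all
  from X X' show ?thesis
  proof (cases rule: arrive_cases)
    case (replace c)
    then have "pot X' = pot X" using pot_move_same[OF X replaced_movable[of c X i, OF replace(2-4)]] by simp
    then show ?thesis unfolding token_pot_def tok using hmax_pos replace by (simp add: algebra_simps)
  next
    case (place c)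
    then have "pot X' \<le> pot X + hmax" using place_pot_le[OF X place(2) placed_movable(1)[OF X place(2)]] by simp
    then show ?thesis unfolding token_pot_def tok using place by simp
  qed
qed

lemma token_pot_serve:
  assumes X: "X \<in> St" and c: "c \<in> CK" "X c > 0" "snd c $ i > 0" and X': "X' \<in> set_pmf (serve X c i)"
  shows "token_pot X' = token_pot X + (pot X' - pot X) - hmax"
proof -
  have "(\<Sum>j\<in>UNIV. tokens j (rl X')) = (\<Sum>j\<in>UNIV. tokens j (rl X)) + 1"
    unfolding serve_counts(2)[OF X c X'] by (simp add: sum.distrib)
  then show ?thesis by (simp add: token_pot_def algebra_simps)
qed

text \<open>For states with more than \<open>2 * r\<close> customers, where the cut-off separates
  the potential from the increments that the algorithm compares.\<close>

lemma serve_pot_crude: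
  assumes X: "X \<in> St" and c: "c \<in> CK" "X c > 0" "snd c $ i > 0" and X': "X' \<in> set_pmf (serve X c i)"
  shows "pot X' \<le> pot X + 2 * hmax"
proof -
  let ?Y = "departed c i X"
  note Y = departed_St[OF X c(1,2), of i]
  have "fst c $ i > 0" using c by (auto simp: CK_iff less_eq_vec_def intro: less_le_trans)
  note rm = removable[OF c(1) this]
  obtain c' where c': "c' \<in> set_pmf (place ?Y i)" "X' = move_server c' (fst c' + axis i 1, snd c') ?Y"
    using X' by (auto simp: serve_eq)
  have "pot ?Y \<le> pot X + hmax"
    using rm by (intro pot_move_le[OF X departed_movable[of c X i, OF c(1,2)]]) auto
  moreover have "pot X' \<le> pot ?Y + hmax"
    using place_pot_le[OF Y c'(1) placed_movable(2)[OF Y c'(1)]] c'(2) by simp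
  ultimately show ?thesis by simp
qed

lemma token_pot_expiry:
  assumes X: "X \<in> St" and c: "c \<in> CK" "X c > 0" "snd c $ i < fst c $ i"
  shows "token_pot (after_token_expiry X c i) \<le> token_pot X + 2 * hmax"
proof -
  have "fst c $ i > 0" using c by auto
  note rm = removable[OF c(1) this]
  have "pot (after_token_expiry X c i) \<le> pot X + hmax"
    unfolding expiry_eq using rm by (intro pot_move_le[OF X expired_movable[of c X i, OF c]]) auto
  moreover have tok: "(\<Sum>j\<in>UNIV. tokens j (rl (after_token_expiry X c i))) = (\<Sum>j\<in>UNIV. tokens j (rl X)) - 1"
    unfolding expiry_counts(2)[OF X c] by (simp add: sum_subtractf)
  ultimately show ?thesis unfolding token_pot_def tok by (simp add: algebra_simps)
qed

text \<open>Up to \<open>2 * r\<close> customers, \<open>serve_pot\<close> applies and the rest is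
  of order \<open>fluct\<close> or \<open>e\<close>. Beyond that, \<open>fluct X > r\<close>, so
  \<open>r * fluct X\<close> is below the square of \<open>fluct X\<close> and thus of order
  \<open>Q X\<close>; all rates are then so small against \<open>Q X\<close> that crude estimates of
  the jumps suffice.\<close>

lemma drift_token_pot:
  assumes X: "X \<in> St" and e: "\<And>n::nat. h ((real n + 1) / r) \<le> h (real n / r) + e" "e \<ge> 0"
    and k': "k' \<in> K0" "k' + axis i 1 \<in> K0" and th: "2 \<le> \<theta> * r"
  shows "drift token_pot X \<le> (gap_const * sqrt r + e * step_const * r) + (gap_const / sqrt r + e * step_const) * Q X
     - mu i * (served k i (rl X) * gap \<theta> k i k' (sc X))"
proof -
  let ?g = "gap \<theta> k i k' (sc X)" and ?n = "real CARD('i)"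
  have g: "0 \<le> ?g" "?g \<le> 2 * hmax" using gap_nonneg gap_le r_pos by auto
  have a: "measure_pmf.expectation (arrive X i) token_pot \<le> token_pot X + hmax" for i
    by (rule expectation_le_const[OF finite_arrive[OF X]]) (rule token_pot_arrive[OF X])
  note t = token_pot_expiry[OF X]
  have n: "?n \<ge> 1" using zero_less_card_finite[where 'a='i] by linarith
  note hp = hmax_pos max_rate_pos
  show ?thesis
  proof (cases "total (rl X) \<le> 2 * r")
    case True
    have s: "measure_pmf.expectation (serve X c j) token_pot \<le> token_pot X + ((4 * e - hmax) - (if fst c = k \<and> j = i then ?g else 0))"
      if c: "c \<in> CK" "X c > 0" "snd c $ j > 0" for c j
    proof (rule expectation_le_const[OF finite_serve[OF X c(1,2)]])
      fix X' assume X': "X' \<in> set_pmf (serve X c j)"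
      \<comment> \<open>For the other pairs of configuration and type only the absence of growth
        matters, and the empty server, which is always available, serves as the alternative
        place.\<close>
      have z: "0 + axis j 1 \<in> K0" using unit_conf by simp
      have "pot X' \<le> pot X + 4 * e - (if fst c = k \<and> j = i then ?g else 0)"
      proof (cases "fst c = k \<and> j = i")
        case True
        then show ?thesis using serve_pot[OF X c X' \<open>total (rl X) \<le> 2 * r\<close> e, of k' \<theta>] k' th by simp
      next
        case False
        have "pot X' \<le> pot X + 4 * e - gap \<theta> (fst c) j 0 (sc X)"
          using serve_pot[OF X c X' \<open>total (rl X) \<le> 2 * r\<close> e zero_K0 z th] .
        then show ?thesis unfolding if_not_P[OF False] using gap_nonneg[of \<theta> "fst c" j 0 "sc X"] by linarith
      qed
      then show "token_pot X' \<le> token_pot X + ((4 * e - hmax) - (if fst c = k \<and> j = i then ?g else 0))"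
        unfolding token_pot_serve[OF X c X'] by linarith
    qed
    have "drift token_pot X \<le> (\<Sum>i\<in>UNIV. lam i * r * hmax) + (\<Sum>i\<in>UNIV. mu i * actual i (rl X) * (4 * e - hmax))
       - mu i * served k i (rl X) * ?g + (\<Sum>i\<in>UNIV. mu0 * tokens i (rl X) * (2 * hmax))"
      using drift_le[OF X a s t] unfolding right_diff_distrib[of _ "4 * e - hmax"] sum_subtractf sum_served sum_actual sum_tokens
      by linarith
    also have "(\<Sum>i\<in>UNIV. lam i * r * hmax) + (\<Sum>i\<in>UNIV. mu i * actual i (rl X) * (4 * e - hmax)) =
       (\<Sum>i\<in>UNIV. - hmax * (mu i * dev i X)) + 4 * e * (\<Sum>i\<in>UNIV. mu i * actual i (rl X))"
    proof -
      have "lam i * r * hmax + mu i * actual i (rl X) * (4 * e - hmax) = - hmax * (mu i * dev i X) + 4 * e * (mu i * actual i (rl X))" for i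
        using rho_def[of i] mu_pos[of i] by (simp add: dev_def field_simps)
      then show ?thesis by (simp add: sum.distrib[symmetric] sum_distrib_left)
    qed
    finally have 1: "drift token_pot X \<le> ((\<Sum>i\<in>UNIV. - hmax * (mu i * dev i X)) + (\<Sum>i\<in>UNIV. mu0 * tokens i (rl X) * (2 * hmax)))
       + 4 * e * (\<Sum>i\<in>UNIV. mu i * actual i (rl X)) - mu i * served k i (rl X) * ?g" by linarith
    have "(\<Sum>i\<in>UNIV. - hmax * (mu i * dev i X)) + (\<Sum>i\<in>UNIV. mu0 * tokens i (rl X) * (2 * hmax)) \<le> 2 * hmax * max_rate * fluct X"
      unfolding fluct_def sum_distrib_left sum.distrib[symmetric]
    proof (rule sum_mono)
      fix i
      have "- hmax * (mu i * dev i X) = hmax * (mu i * (- dev i X))" by simp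
      also have "\<dots> \<le> hmax * (mu i * \<bar>dev i X\<bar>)"
        using hp mu_pos[of i] by (intro mult_left_mono) auto
      also have "\<dots> \<le> hmax * (max_rate * \<bar>dev i X\<bar>)" using hp mu_le by (intro mult_left_mono mult_right_mono) auto
      also have "\<dots> \<le> 2 * (hmax * (max_rate * \<bar>dev i X\<bar>))" using hp by simp
      finally have "- hmax * (mu i * dev i X) \<le> 2 * (hmax * (max_rate * \<bar>dev i X\<bar>))" .
      moreover have "mu0 * tokens i (rl X) * (2 * hmax) \<le> max_rate * tokens i (rl X) * (2 * hmax)"
        using hp mu0_le tokens_nonneg by (intro mult_right_mono) auto
      ultimately show "- hmax * (mu i * dev i X) + mu0 * tokens i (rl X) * (2 * hmax) \<le>
         2 * hmax * max_rate * (\<bar>dev i X\<bar> + tokens i (rl X))" by (simp add: algebra_simps)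
    qed
    also have "\<dots> \<le> 2 * hmax * max_rate * (Q X / sqrt r + ?n * sqrt r)"
      using hp by (intro mult_left_mono fluct_le_sqrt) auto
    also have "\<dots> \<le> gap_const * (Q X / sqrt r) + gap_const * sqrt r"
    proof -
      have "2 * hmax * max_rate \<le> gap_const" "2 * hmax * max_rate * ?n \<le> gap_const"
        unfolding gap_const_def using hp n mult_left_mono[of 1 ?n "2 * hmax * max_rate"] by (auto simp: algebra_simps)
      then have "2 * hmax * max_rate * (Q X / sqrt r) \<le> gap_const * (Q X / sqrt r)"
        "2 * hmax * max_rate * ?n * sqrt r \<le> gap_const * sqrt r"
        using Q_nonneg[of X] sqrt_r(1) by (intro mult_right_mono divide_nonneg_nonneg; simp)+
      then show ?thesis by (simp add: algebra_simps)
    qed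
    finally have 2: "(\<Sum>i\<in>UNIV. - hmax * (mu i * dev i X)) + (\<Sum>i\<in>UNIV. mu0 * tokens i (rl X) * (2 * hmax))
       \<le> gap_const * (Q X / sqrt r) + gap_const * sqrt r" .
    have "(\<Sum>i\<in>UNIV. mu i * actual i (rl X)) \<le> (\<Sum>i\<in>UNIV. max_rate * (actual i (rl X) + tokens i (rl X)))"
    proof (rule sum_mono)
      fix i
      have "mu i * actual i (rl X) \<le> max_rate * actual i (rl X)" using mu_le actual_nonneg by (intro mult_right_mono) auto
      moreover have "0 \<le> max_rate * tokens i (rl X)" using hp tokens_nonneg by simp
      ultimately show "mu i * actual i (rl X) \<le> max_rate * (actual i (rl X) + tokens i (rl X))" by (simp add: algebra_simps)
    qed
    also have "\<dots> = max_rate * total (rl X)" by (simp add: total_def sum_distrib_left)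
    also have "\<dots> \<le> max_rate * ((1 + ?n) * (r + Q X))"
    proof (rule mult_left_mono)
      have "total (rl X) \<le> r + (Q X + ?n * r)" using total_le_fluct[of X] fluct_le_r[of X] by linarith
      also have "\<dots> \<le> (1 + ?n) * (r + Q X)" using Q_nonneg[of X] n by (simp add: algebra_simps)
      finally show "total (rl X) \<le> (1 + ?n) * (r + Q X)" .
    qed (use hp in simp)
    finally have "4 * e * (\<Sum>i\<in>UNIV. mu i * actual i (rl X)) \<le> 4 * e * (max_rate * ((1 + ?n) * (r + Q X)))"
      using e(2) by (intro mult_left_mono) auto
    also have "\<dots> = e * step_const * r + e * step_const * Q X" by (simp add: step_const_def algebra_simps)
    finally show ?thesis using 1 2 by (simp add: algebra_simps)
  next
    case False
    have s: "measure_pmf.expectation (serve X c j) token_pot \<le> token_pot X + hmax"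
      if c: "c \<in> CK" "X c > 0" "snd c $ j > 0" for c j
    proof (rule expectation_le_const[OF finite_serve[OF X c(1,2)]])
      fix X' assume X': "X' \<in> set_pmf (serve X c j)"
      show "token_pot X' \<le> token_pot X + hmax"
        using serve_pot_crude[OF X c X'] unfolding token_pot_serve[OF X c X'] by linarith
    qed
    have tr: "0 \<le> mu0 * tokens i (rl X) * hmax" "0 \<le> lam i * r" "0 \<le> mu i * actual i (rl X)" for i
      using mu0_pos tokens_nonneg hp lam_pos mu_pos r_pos actual_nonneg by (auto simp: less_imp_le)
    have "drift token_pot X \<le> (\<Sum>i\<in>UNIV. lam i * r * hmax) + (\<Sum>i\<in>UNIV. mu i * actual i (rl X) * hmax)
        + (\<Sum>i\<in>UNIV. mu0 * tokens i (rl X) * (2 * hmax))"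
      using drift_le[OF X a s t] unfolding sum_actual sum_tokens .
    also have "\<dots> \<le> 2 * hmax * total_rate X"
    proof -
      have "0 \<le> (\<Sum>i\<in>UNIV. lam i * r)" "0 \<le> (\<Sum>i\<in>UNIV. mu i * actual i (rl X))" using tr by (auto intro: sum_nonneg)
      then have "0 \<le> hmax * (\<Sum>i\<in>UNIV. lam i * r)" "0 \<le> hmax * (\<Sum>i\<in>UNIV. mu i * actual i (rl X))" using hp by auto
      then show ?thesis unfolding total_rate_def sum_distrib_right[symmetric] by (simp add: algebra_simps)
    qed
    also have "\<dots> \<le> 2 * hmax * (max_rate * (r + total (rl X)))"
      using hp total_rate_le by (intro mult_left_mono) auto
    finally have 1: "drift token_pot X \<le> 2 * hmax * max_rate * (r + total (rl X))" by (simp only: mult.assoc)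
    have "mu i * (served k i (rl X) * ?g) \<le> max_rate * (total (rl X) * (2 * hmax))"
      using mu_le[of i] mu_pos[of i] g hp served_le_total served_nonneg total_nonneg
      by (intro mult_mono mult_nonneg_nonneg) auto
    also have "\<dots> \<le> 2 * hmax * max_rate * (r + total (rl X))" using hp r_pos by (simp add: algebra_simps)
    finally have 2: "drift token_pot X + mu i * (served k i (rl X) * ?g) \<le> 4 * hmax * max_rate * (r + total (rl X))"
      using 1 by linarith
    have "r + total (rl X) \<le> 3 * fluct X" "fluct X > r" using total_le_fluct[of X] False by linarith+
    then have "r * fluct X \<le> fluct X * fluct X" using fluct_nonneg[of X] by (intro mult_right_mono) auto
    then have "r * fluct X \<le> 2 * ?n * Q X" using fluct_sq[of X] by (simp add: power2_eq_square)
    then have "fluct X \<le> 2 * ?n * Q X / r" using r_pos by (simp add: pos_le_divide_eq mult.commute)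
    also have "\<dots> \<le> 2 * ?n * Q X / sqrt r"
      using sqrt_r(1,2) Q_nonneg[of X] by (intro divide_left_mono) auto
    finally have "r + total (rl X) \<le> 3 * (2 * ?n * Q X / sqrt r)" using \<open>r + total (rl X) \<le> 3 * fluct X\<close> by linarith
    then have "4 * hmax * max_rate * (r + total (rl X)) \<le> 4 * hmax * max_rate * (3 * (2 * ?n * Q X / sqrt r))"
      using hp by (intro mult_left_mono) auto
    also have "\<dots> = gap_const / sqrt r * Q X" by (simp add: gap_const_def)
    finally have "drift token_pot X + mu i * (served k i (rl X) * ?g) \<le> gap_const / sqrt r * Q X" using 2 by linarith
    moreover have "0 \<le> gap_const * sqrt r" "0 \<le> e * step_const * r" "0 \<le> e * step_const * Q X"
      unfolding gap_const_def step_const_def using hp e(2) r_pos Q_nonneg[of X] sqrt_r by auto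
    ultimately show ?thesis by (simp add: algebra_simps)
  qed
qed

end

text \<open>The drift bound divided by \<open>mu i * r\<close>. The first error vanishes as
  \<open>r\<close> grows, and \<open>e\<close> can be chosen small in advance by
  \<open>h_step_small\<close>.\<close>

lemma (in stationary_greedy) gap_expectation:
  assumes e: "\<And>n::nat. h ((real n + 1) / r) \<le> h (real n / r) + e" "e \<ge> 0"
    and k': "k' \<in> K0" "k' + axis i 1 \<in> K0" and th: "2 \<le> \<theta> * r"
  shows "measure_pmf.expectation p (\<lambda>X. served k i (sc X) * gap \<theta> k i k' (sc X))
    \<le> (gap_const / sqrt r + e * step_const) * (1 + moment_const) / mu i"
    "integrable p (\<lambda>X. served k i (sc X) * gap \<theta> k i k' (sc X))"
proof -
  let ?g = "\<lambda>X. mu i * (served k i (rl X) * gap \<theta> k i k' (sc X))"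
  let ?n = "real CARD('i)"
  note hp = hmax_pos max_rate_pos
  have gb: "0 \<le> gap \<theta> k i k' (sc X)" "gap \<theta> k i k' (sc X) \<le> 2 * hmax" for X
    using gap_nonneg gap_le[of "sc X"] r_pos by auto
  have bound: "\<bar>?g X\<bar> \<le> max_rate * (2 * hmax) * (r + ?n * r) + max_rate * (2 * hmax) * Q X" for X
  proof -
    have "\<bar>?g X\<bar> = ?g X" using gb served_nonneg mu_pos[of i] by simp
    also have "\<dots> \<le> max_rate * (total (rl X) * (2 * hmax))"
      using mu_le[of i] mu_pos[of i] gb hp served_le_total served_nonneg total_nonneg
      by (intro mult_mono mult_nonneg_nonneg) auto
    also have "\<dots> \<le> max_rate * ((r + (Q X + ?n * r)) * (2 * hmax))"
      using hp total_le_fluct[of X] fluct_le_r[of X] by (intro mult_left_mono mult_right_mono) auto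
    finally show ?thesis by (simp add: algebra_simps)
  qed
  \<comment> \<open>The negative part of \<open>token_pot\<close> is at most \<open>hmax\<close>
    times the tokens, hence of order \<open>fluct\<close>, and \<open>fluct_le\<close> with
    \<open>s = d / hmax\<close> puts it below \<open>d * V\<close> up to a constant.\<close>
  have low: "\<exists>c. \<forall>X\<in>St. token_pot X \<ge> - c - d * V X" if d: "d > 0" for d
  proof (intro exI ballI)
    fix X assume "X \<in> St"
    have "(\<Sum>i\<in>UNIV. tokens i (rl X)) \<le> fluct X" unfolding fluct_def by (intro sum_mono) simp
    also have "\<dots> \<le> d / hmax * Q X + ?n / (2 * (d / hmax))" using d hp by (intro fluct_le) simp
    also have "\<dots> \<le> d / hmax * V X + ?n / (2 * (d / hmax))" using V_ge_Q[of X] d hp by (simp add: mult_left_mono divide_right_mono)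
    finally have "hmax * (\<Sum>i\<in>UNIV. tokens i (rl X)) \<le> hmax * (d / hmax * V X + ?n / (2 * (d / hmax)))"
      using hp by (intro mult_left_mono) auto
    also have "\<dots> = d * V X + hmax * (?n / (2 * (d / hmax)))" using hp by (simp add: distrib_left)
    finally show "token_pot X \<ge> - (hmax * (?n / (2 * (d / hmax)))) - d * V X"
      unfolding token_pot_def using pot_nonneg[of X] by linarith
  qed
  have "gap_const / sqrt r + e * step_const \<ge> 0"
    unfolding gap_const_def step_const_def using hp e(2) sqrt_r by auto
  from expected_gain_le[where f=token_pot and g="?g", OF low drift_token_pot[where \<theta>=\<theta> and k=k and k'=k' and i=i and e=e] bound this] e k' th
  have *: "measure_pmf.expectation p ?g \<le> gap_const * sqrt r + e * step_const * r + (gap_const / sqrt r + e * step_const) * (moment_const * r)"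
    by blast
  have sc: "served k i (sc X) * gap \<theta> k i k' (sc X) = inverse (mu i * r) * ?g X" for X
    using mu_pos[of i] r_pos by (simp add: served_def lin_scale field_simps)
  show "integrable p (\<lambda>X. served k i (sc X) * gap \<theta> k i k' (sc X))"
    unfolding sc by (intro integrable_mult_right integrable_Q_bound[OF bound])
  have "measure_pmf.expectation p (\<lambda>X. served k i (sc X) * gap \<theta> k i k' (sc X)) = inverse (mu i * r) * measure_pmf.expectation p ?g"
    unfolding sc by simp
  also have "\<dots> \<le> inverse (mu i * r) * (gap_const * sqrt r + e * step_const * r + (gap_const / sqrt r + e * step_const) * (moment_const * r))"
    using mu_pos[of i] r_pos * by (intro mult_left_mono) auto
  also have "gap_const * sqrt r = gap_const / sqrt r * r" using sqrt_r by (simp add: real_div_sqrt field_simps)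
  also have "inverse (mu i * r) * (gap_const / sqrt r * r + e * step_const * r + (gap_const / sqrt r + e * step_const) * (moment_const * r))
     = inverse (mu i * r) * ((gap_const / sqrt r + e * step_const) * (1 + moment_const) * r)"
    by (simp add: algebra_simps add_divide_distrib)
  also have "\<dots> = (gap_const / sqrt r + e * step_const) * (1 + moment_const) / mu i"
    using r_pos by (simp add: divide_inverse)
  finally show "measure_pmf.expectation p (\<lambda>X. served k i (sc X) * gap \<theta> k i k' (sc X))
    \<le> (gap_const / sqrt r + e * step_const) * (1 + moment_const) / mu i" .
qed

section \<open>Occupancy within an aggregate configuration\<close>

text \<open>Lets the bound for the mean of \<open>U\<close> after a placement enter the bound for
  its squared positive part: the slope \<open>u\<close> is fixed before the random choice is
  made.\<close>

lemma expectation_le_affine: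
  fixes f g :: "'a \<Rightarrow> real"
  assumes fin: "finite (set_pmf p)" and U: "0 \<le> u"
    and step: "\<And>x. x \<in> set_pmf p \<Longrightarrow> f x \<le> a + u * g x" and E: "measure_pmf.expectation p g \<le> m"
  shows "measure_pmf.expectation p f \<le> a + u * m"
proof -
  note int = integrable_measure_pmf_finite[OF fin]
  have "measure_pmf.expectation p f \<le> measure_pmf.expectation p (\<lambda>x. a + u * g x)"
    using step by (intro integral_mono_AE int) (auto simp: AE_measure_pmf_iff)
  also have "\<dots> = a + u * measure_pmf.expectation p g" by (simp add: int)
  also have "\<dots> \<le> a + u * m" using U E by (intro add_left_mono mult_left_mono)
  finally show ?thesis .
qed

lemma pos_part_square_step:
  fixes u d :: real
  shows "(max 0 (u + d))\<^sup>2 \<le> (max 0 u)\<^sup>2 + 2 * max 0 u * d + d\<^sup>2"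
proof -
  have "(max 0 (u + d))\<^sup>2 \<le> (max 0 u + d)\<^sup>2"
  proof (cases "u + d > 0")
    case True
    then show ?thesis by (intro power_mono) auto
  qed simp
  also have "\<dots> = (max 0 u)\<^sup>2 + 2 * max 0 u * d + d\<^sup>2" by (simp add: power2_sum)
  finally show ?thesis .
qed

locale spread = greedy B b lam mu rho mu0 \<alpha> r sel rep
  for B :: "'n::finite \<Rightarrow> real" and b :: "'i::finite \<Rightarrow> 'n \<Rightarrow> real"
  and lam mu rho :: "'i \<Rightarrow> real" and mu0 \<alpha> r :: real and sel rep +
  fixes \<kappa> :: "'i conf" and j :: 'i and M :: real
  assumes kappa: "\<kappa> \<in> confs B b" "\<kappa> + axis j 1 \<in> confs0 B b" and M_ge_1: "M \<ge> 1"
begin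

text \<open>Positive when \<open>\<kappa>\<close> makes up less than the fraction
  \<open>1 / M\<close> of its class.\<close>

definition U :: "'i state \<Rightarrow> real" where
  "U X = cnt (cls \<kappa>) (rl X) - M * cnt {\<kappa>} (rl X)"

definition f :: "'i state \<Rightarrow> real" where "f X = (max 0 (U X))\<^sup>2"

abbreviation "k \<equiv> \<kappa> + axis j 1"

lemma kappa_K0: "\<kappa> \<in> K0" using kappa by (simp add: K_iff)

lemma U_move:
  assumes "movable X c c'"
  shows "U (move_server c c' X) = U X - (if fst c \<in> cls \<kappa> then 1 else 0) + (if fst c' \<in> cls \<kappa> then 1 else 0)
     + M * (if fst c = \<kappa> then 1 else 0) - M * (if fst c' = \<kappa> then 1 else 0)"
proof -
  have "0 \<notin> cls \<kappa>" "0 \<notin> {\<kappa>}" using kappa cls_subset_K[OF kappa(1)] by (auto simp: K_iff)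
  then show ?thesis unfolding U_def using assms by (simp add: cnt_move algebra_simps)
qed

text \<open>A service consists of a departure and a placement, each of which changes
  \<open>U\<close> by at most \<open>1 + M\<close>; hence the factor 2.\<close>

lemma f_step: "\<bar>U X' - U X\<bar> \<le> 2 * (1 + M) \<Longrightarrow> f X' \<le> (f X + 4 * (1 + M)\<^sup>2) + 2 * max 0 (U X) * (U X' - U X)"
proof -
  assume "\<bar>U X' - U X\<bar> \<le> 2 * (1 + M)"
  then have "(U X' - U X)\<^sup>2 \<le> (2 * (1 + M))\<^sup>2" using M_ge_1 abs_le_square_iff[of "U X' - U X" "2 * (1 + M)"] by simp
  also have "\<dots> = 4 * (1 + M)\<^sup>2" by (simp only: power_mult_distrib) simp
  finally show ?thesis using pos_part_square_step[of "U X" "U X' - U X"] by (simp add: f_def)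
qed

lemma place_prob:
  assumes Y: "Y \<in> St" and sel: "sel Y i = cls \<kappa>"
  shows "cnt (cls \<kappa>) (rl Y) > 0"
    "measure_pmf.expectation (place Y i) (\<lambda>c. if fst c = \<kappa> then 1 else 0) = cnt {\<kappa>} (rl Y) / cnt (cls \<kappa>) (rl Y)"
proof -
  have nz: "cls \<kappa> \<noteq> aconf_zero B b" using kappa by (simp add: zero_cls cls_eq_zero_iff K_iff)
  have pos: "aconf_count Y (cls \<kappa>) > 0"
    using sel_candidate[OF Y, of i] nz unfolding sel ac_candidates_def available_def by auto
  then show "cnt (cls \<kappa>) (rl Y) > 0" using cn_cnt[OF Y, of \<kappa>] by linarith
  define C where "C = {c \<in> CK. fst c \<in> cls \<kappa>}"
  define A where "A = {(c, m). c \<in> CK \<and> fst c \<in> cls \<kappa> \<and> m < Y c}"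
  have A: "A = Sigma C (\<lambda>c. {..<Y c})" by (auto simp: A_def C_def)
  have fC: "finite C" using finite_CK by (simp add: C_def)
  have fA: "finite A" "A \<noteq> {}"
    unfolding A_def using pick_server_finite[OF Y] pick_server_nonempty[OF Y cls_subset pos] by blast+
  have sum_A: "(\<Sum>a\<in>A. g (fst a)) = (\<Sum>c\<in>C. real (Y c) * g c)" for g :: "'i cconf \<Rightarrow> real"
    unfolding A using fC by (subst sum.Sigma[symmetric, of C "\<lambda>c. {..<Y c}" "\<lambda>c _. g c", simplified split_def]) auto
  have "place Y i = map_pmf fst (pmf_of_set A)" using nz by (simp add: pick_server_def sel A_def)
  then have "measure_pmf.expectation (place Y i) (\<lambda>c. if fst c = \<kappa> then 1 else 0) =
     (\<Sum>a\<in>A. if fst (fst a) = \<kappa> then 1 else 0) / real (card A)"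
    using fA by (simp add: integral_pmf_of_set)
  also have "(\<Sum>a\<in>A. if fst (fst a) = \<kappa> then 1 else 0) = cnt {\<kappa>} (rl Y)"
    unfolding sum_A[of "\<lambda>c. if fst c = \<kappa> then 1 else 0"] cnt_def lin_def C_def
    using finite_CK kappa_K0 by (intro sum.mono_neutral_cong_left) (auto split: if_splits)
  also have "real (card A) = (\<Sum>a\<in>A. 1)" by simp
  also have "\<dots> = cnt (cls \<kappa>) (rl Y)"
    unfolding sum_A[of "\<lambda>_. 1"] cnt_def lin_def C_def
    using finite_CK by (intro sum.mono_neutral_cong_left) (auto split: if_splits)
  finally show "measure_pmf.expectation (place Y i) (\<lambda>c. if fst c = \<kappa> then 1 else 0) = cnt {\<kappa>} (rl Y) / cnt (cls \<kappa>) (rl Y)" .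
qed

text \<open>Uniform choice within the class removes servers of \<open>\<kappa>\<close> in proportion to their share, which is
  below \<open>1 / M\<close> when \<open>U\<close> is positive.\<close>

lemma place_U:
  assumes Y: "Y \<in> St" and l: "\<And>c. c \<in> set_pmf (place Y i) \<Longrightarrow> movable Y c (fst c + axis i 1, l c)"
  shows "measure_pmf.expectation (place Y i) (\<lambda>c. U (move_server c (fst c + axis i 1, l c) Y))
    \<le> U Y + 1 + (if U Y > 0 then 0 else M)"
proof (cases "sel Y i = cls \<kappa>")
  case True
  let ?N = "cnt (cls \<kappa>) (rl Y)" and ?Z = "cnt {\<kappa>} (rl Y)"
  note pr = place_prob[OF Y True]
  have "measure_pmf.expectation (place Y i) (\<lambda>c. U (move_server c (fst c + axis i 1, l c) Y)) \<le> (U Y - 1) + M * (?Z / ?N)"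
  proof (rule expectation_le_affine[OF finite_place[OF Y]])
    fix c assume c: "c \<in> set_pmf (place Y i)"
    note s = pick_server_support[OF Y sel_candidate[OF Y] c]
    have "fst c \<in> cls \<kappa>" using s True by simp
    moreover have "fst c + axis i 1 \<notin> cls \<kappa>"
      using cls_add_neq[OF s(5,3)] cls_eq calculation by metis
    moreover have "fst c + axis i 1 \<noteq> \<kappa>" using calculation kappa_K0 by auto
    ultimately show "U (move_server c (fst c + axis i 1, l c) Y) \<le> (U Y - 1) + M * (if fst c = \<kappa> then 1 else 0)"
      unfolding U_move[OF l[OF c]] by simp
  qed (use pr M_ge_1 in auto)
  also have "M * (?Z / ?N) \<le> 1 + (if U Y > 0 then 0 else M)"
  proof (cases "U Y > 0")
    case True
    then show ?thesis using pr by (simp add: U_def field_simps)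
  next
    case False
    have "?Z \<le> ?N" unfolding cnt_def using kappa_K0 by (intro lin_mono) auto
    then have "M * (?Z / ?N) \<le> M * 1" using pr M_ge_1 by (intro mult_left_mono) auto
    then show ?thesis using False by simp
  qed
  finally show ?thesis by (auto split: if_splits)
next
  case False
  have "measure_pmf.expectation (place Y i) (\<lambda>c. U (move_server c (fst c + axis i 1, l c) Y)) \<le> U Y + 1"
  proof (rule expectation_le_const[OF finite_place[OF Y]])
    fix c assume c: "c \<in> set_pmf (place Y i)"
    have "fst c \<noteq> \<kappa>" using placed_class[OF Y c] False by auto
    moreover have "M * (if fst c + axis i 1 = \<kappa> then 1 else 0) \<ge> 0" using M_ge_1 by simp
    ultimately show "U (move_server c (fst c + axis i 1, l c) Y) \<le> U Y + 1"
      unfolding U_move[OF l[OF c]] by simp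
  qed
  then show ?thesis using M_ge_1 by auto
qed

lemma U_move_abs:
  assumes "movable X c c'" shows "\<bar>U (move_server c c' X) - U X\<bar> \<le> 1 + M"
  unfolding U_move[OF assms] using M_ge_1 by auto

lemma f_arrive:
  assumes X: "X \<in> St"
  shows "measure_pmf.expectation (arrive X i) f \<le> f X + (2 * max 0 (U X) + 4 * (1 + M)\<^sup>2)"
proof (cases "tokens i (rl X) > 0")
  case True
  show ?thesis
  proof (rule expectation_le_const[OF finite_arrive[OF X]])
    fix X' assume "X' \<in> set_pmf (arrive X i)"
    with X have "U X' = U X"
    proof (cases rule: arrive_cases)
      case (replace c)
      then show ?thesis using U_move[OF replaced_movable[of c X i, OF replace(2-4)]] by simp
    qed (use True in auto)
    then show "f X' \<le> f X + (2 * max 0 (U X) + 4 * (1 + M)\<^sup>2)" by (simp add: f_def)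
  qed
next
  case False
  then have "token_places B b X i = {}" using tokens_pos_iff[OF X] by auto
  then have arr: "arrive X i = map_pmf (\<lambda>c. move_server c (fst c + axis i 1, snd c + axis i 1) X) (place X i)"
    by (simp add: after_arrival_def ac_place_actual_def case_prod_unfold)
  have "measure_pmf.expectation (arrive X i) f \<le>
     ((f X + 4 * (1 + M)\<^sup>2) - 2 * max 0 (U X) * U X) + 2 * max 0 (U X) * (U X + 1 + (if U X > 0 then 0 else M))"
    unfolding arr integral_map_pmf
  proof (rule expectation_le_affine[OF finite_place[OF X] _ _ place_U[OF X placed_movable(1)[OF X]]])
    fix c assume c: "c \<in> set_pmf (place X i)"
    have "\<bar>U (move_server c (fst c + axis i 1, snd c + axis i 1) X) - U X\<bar> \<le> 2 * (1 + M)"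
      using U_move_abs[OF placed_movable(1)[OF X c]] M_ge_1 by (smt (verit))
    from f_step[OF this] show "f (move_server c (fst c + axis i 1, snd c + axis i 1) X) \<le>
     ((f X + 4 * (1 + M)\<^sup>2) - 2 * max 0 (U X) * U X) + 2 * max 0 (U X) * U (move_server c (fst c + axis i 1, snd c + axis i 1) X)"
      by (simp add: algebra_simps)
  qed auto
  \<comment> \<open>The extra \<open>M\<close> that \<open>place_U\<close> allows for
    \<open>U X \<le> 0\<close> is multiplied by \<open>max 0 (U X) = 0\<close>.\<close>
  also have "\<dots> = f X + (2 * max 0 (U X) + 4 * (1 + M)\<^sup>2)"
    by (cases "U X > 0") (auto simp: algebra_simps)
  finally show ?thesis .
qed

text \<open>The decisive term is \<open>- M\<close>: a type \<open>j\<close> service in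
  \<open>\<kappa> + axis j 1\<close> hands a server to \<open>\<kappa>\<close>. The
  \<open>+ M\<close> stems from servers that leave \<open>\<kappa>\<close>, and the 2 allows one
  server to enter the class at the departure and one at the placement.\<close>

lemma f_serve:
  assumes X: "X \<in> St" and c: "c \<in> CK" "X c > 0" "snd c $ i > 0"
  shows "measure_pmf.expectation (serve X c i) f \<le> f X + (2 * max 0 (U X) *
     (2 + M * (if fst c = \<kappa> then 1 else 0) - (if fst c = k \<and> i = j then M else 0)) + 6 * (1 + M)\<^sup>2)"
proof -
  let ?Y = "departed c i X"
  note Y = departed_St[OF X c(1,2), of i]
  note mY = departed_movable[of c X i, OF c(1,2)]
  let ?u = "max 0 (U X)"
  let ?E = "U ?Y + 1 + (if U ?Y > 0 then 0 else M)"
  have "measure_pmf.expectation (serve X c i) f \<le> ((f X + 4 * (1 + M)\<^sup>2) - 2 * ?u * U X) + 2 * ?u * ?E"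
    unfolding serve_eq integral_map_pmf
  proof (rule expectation_le_affine[OF finite_place[OF Y] _ _ place_U[OF Y placed_movable(2)[OF Y]]])
    fix c' assume c': "c' \<in> set_pmf (place ?Y i)"
    have "\<bar>U (move_server c' (fst c' + axis i 1, snd c') ?Y) - U X\<bar> \<le> 2 * (1 + M)"
      using U_move_abs[OF placed_movable(2)[OF Y c']] U_move_abs[OF mY] M_ge_1 by (smt (verit))
    from f_step[OF this] show "f (move_server c' (fst c' + axis i 1, snd c') ?Y) \<le>
     ((f X + 4 * (1 + M)\<^sup>2) - 2 * ?u * U X) + 2 * ?u * U (move_server c' (fst c' + axis i 1, snd c') ?Y)"
      by (simp add: algebra_simps)
  qed auto
  also have "\<dots> = f X + 4 * (1 + M)\<^sup>2 + 2 * ?u * (U ?Y - U X + 1) + 2 * (?u * (if U ?Y > 0 then 0 else M))"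
    by (simp add: algebra_simps)
  \<comment> \<open>If the departure makes \<open>U\<close> non-positive, then \<open>U X\<close>
    was at most \<open>1 + M\<close>. This accounts for the two squares beyond the four from
    \<open>f_step\<close>.\<close>
  also have "?u * (if U ?Y > 0 then 0 else M) \<le> (1 + M)\<^sup>2"
  proof (cases "U ?Y > 0")
    case False
    then have "?u \<le> 1 + M" using U_move_abs[OF mY] M_ge_1 by linarith
    then have "?u * M \<le> (1 + M) * (1 + M)" using M_ge_1 by (intro mult_mono) auto
    then show ?thesis using False by (simp add: power2_eq_square)
  qed simp
  also have "2 * ?u * (U ?Y - U X + 1) \<le> 2 * ?u *
     (2 + M * (if fst c = \<kappa> then 1 else 0) - (if fst c = k \<and> i = j then M else 0))"
  proof (rule mult_left_mono)
    have "fst c = k \<and> i = j \<Longrightarrow> fst c - axis i 1 = \<kappa>" by (simp add: vec_eq_iff)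
    then have "(if fst c = k \<and> i = j then M else 0) \<le> M * (if fst c - axis i 1 = \<kappa> then 1 else 0)"
      using M_ge_1 by auto
    then show "U ?Y - U X + 1 \<le> 2 + M * (if fst c = \<kappa> then 1 else 0) - (if fst c = k \<and> i = j then M else 0)"
      unfolding U_move[OF mY] fst_conv by (smt (verit))
  qed simp
  finally show ?thesis by (simp add: algebra_simps)
qed

lemma f_expiry:
  assumes X: "X \<in> St" and c: "c \<in> CK" "X c > 0" "snd c $ i < fst c $ i"
  shows "f (after_token_expiry X c i) \<le> f X + (2 * max 0 (U X) * (2 + M * (if fst c = \<kappa> then 1 else 0)) + 6 * (1 + M)\<^sup>2)"
proof -
  let ?Y = "after_token_expiry X c i"
  note m = expired_movable[of c X i, OF c]
  have "\<bar>U ?Y - U X\<bar> \<le> 2 * (1 + M)" using U_move_abs[OF m] M_ge_1 unfolding expiry_eq by (smt (verit))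
  note f_step[OF this]
  also have "2 * max 0 (U X) * (U ?Y - U X) \<le> 2 * max 0 (U X) * (2 + M * (if fst c = \<kappa> then 1 else 0))"
  proof (rule mult_left_mono)
    have "0 \<le> M * (if fst c - axis i 1 = \<kappa> then 1 else 0)" using M_ge_1 by simp
    then show "U ?Y - U X \<le> 2 + M * (if fst c = \<kappa> then 1 else 0)"
      unfolding expiry_eq U_move[OF m] fst_conv by (smt (verit))
  qed simp
  finally have "f ?Y \<le> f X + 4 * (1 + M)\<^sup>2 + 2 * max 0 (U X) * (2 + M * (if fst c = \<kappa> then 1 else 0))" by simp
  moreover have "(1 + M)\<^sup>2 \<ge> 0" by simp
  ultimately show ?thesis by linarith
qed

definition size_kappa :: real where "size_kappa = (\<Sum>i\<in>UNIV. real (\<kappa> $ i))"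

text \<open>Events at servers in \<open>\<kappa>\<close> may cost \<open>M\<close> each. Where
  \<open>U\<close> is positive, \<open>M\<close> times the number of these servers is below the size
  of the class, so the total cost will be bounded independently of \<open>M\<close>.\<close>

lemma kappa_rate:
  "(\<Sum>i\<in>UNIV. \<Sum>c\<in>CK. mu i * real (snd c $ i) * real (X c) * (if fst c = \<kappa> then 1 else 0))
   + (\<Sum>i\<in>UNIV. \<Sum>c\<in>CK. mu0 * real (fst c $ i - snd c $ i) * real (X c) * (if fst c = \<kappa> then 1 else 0))
   \<le> max_rate * size_kappa * cnt {\<kappa>} (rl X)"
proof -
  have "(\<Sum>i\<in>UNIV. \<Sum>c\<in>CK. mu i * real (snd c $ i) * real (X c) * (if fst c = \<kappa> then 1 else 0))
   + (\<Sum>i\<in>UNIV. \<Sum>c\<in>CK. mu0 * real (fst c $ i - snd c $ i) * real (X c) * (if fst c = \<kappa> then 1 else 0))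
   \<le> (\<Sum>i\<in>UNIV. \<Sum>c\<in>CK. max_rate * real (\<kappa> $ i) * ((if fst c \<in> {\<kappa>} then 1 else 0) * real (X c)))"
    unfolding sum.distrib[symmetric]
  proof (intro sum_mono)
    fix i c assume c: "c \<in> CK"
    show "mu i * real (snd c $ i) * real (X c) * (if fst c = \<kappa> then 1 else 0) +
      mu0 * real (fst c $ i - snd c $ i) * real (X c) * (if fst c = \<kappa> then 1 else 0)
      \<le> max_rate * real (\<kappa> $ i) * ((if fst c \<in> {\<kappa>} then 1 else 0) * real (X c))"
    proof (cases "fst c = \<kappa>")
      case True
      have "mu i * real (snd c $ i) + mu0 * real (fst c $ i - snd c $ i)
         \<le> max_rate * real (snd c $ i) + max_rate * real (fst c $ i - snd c $ i)"
        using mu_le mu0_le by (intro add_mono mult_right_mono) auto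
      also have "\<dots> = max_rate * real (\<kappa> $ i)"
        using real_conf_split[OF c, of i] True by (simp add: distrib_left[symmetric])
      finally have "(mu i * real (snd c $ i) + mu0 * real (fst c $ i - snd c $ i)) * real (X c) \<le> max_rate * real (\<kappa> $ i) * real (X c)"
        by (rule mult_right_mono) simp
      then show ?thesis using True by (simp add: distrib_right)
    qed simp
  qed
  also have "\<dots> = max_rate * size_kappa * cnt {\<kappa>} (rl X)"
    by (simp add: size_kappa_def cnt_def lin_def sum_distrib_left[symmetric] sum_distrib_right[symmetric])
  finally show ?thesis .
qed

text \<open>Among the terms with \<open>max 0 (U X)\<close>, only the inflow into
  \<open>\<kappa>\<close> carries a factor \<open>M\<close>; it dominates as \<open>M\<close>
  grows.\<close>

lemma drift_f:
  assumes X: "X \<in> St"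
  shows "drift f X \<le> (2 * max 0 (U X) * (2 + size_kappa) + 6 * (1 + M)\<^sup>2) * (max_rate * (r + total (rl X)))
     - 2 * max 0 (U X) * M * (mu j * served k j (rl X))"
proof -
  let ?u = "max 0 (U X)" and ?c = "6 * (1 + M)\<^sup>2"
  let ?S = "\<Sum>i\<in>UNIV. \<Sum>c\<in>CK. mu i * real (snd c $ i) * real (X c) * (if fst c = \<kappa> then 1 else 0)"
  let ?T = "\<Sum>i\<in>UNIV. \<Sum>c\<in>CK. mu0 * real (fst c $ i - snd c $ i) * real (X c) * (if fst c = \<kappa> then 1 else 0)"
  let ?w = "2 * ?u * 2 + ?c"
  have a: "measure_pmf.expectation (arrive X i) f \<le> f X + ?w" for i
  proof -
    have "(1 + M)\<^sup>2 \<ge> 0" by simp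
    then show ?thesis using f_arrive[OF X, of i] by (smt (verit))
  qed
  have s: "measure_pmf.expectation (serve X c i) f \<le> f X + (?w + 2 * ?u * M * (if fst c = \<kappa> then 1 else 0) - (if fst c = k \<and> i = j then 2 * ?u * M else 0))"
    if "c \<in> CK" "X c > 0" "snd c $ i > 0" for c i
    using f_serve[OF X that] by (auto simp: algebra_simps split: if_splits)
  have t: "f (after_token_expiry X c i) \<le> f X + (?w + 2 * ?u * M * (if fst c = \<kappa> then 1 else 0))"
    if "c \<in> CK" "X c > 0" "snd c $ i < fst c $ i" for c i
    using f_expiry[OF X that] by (auto simp: algebra_simps split: if_splits)
  have pull: "(\<Sum>i\<in>UNIV. \<Sum>c\<in>CK. g i c * (2 * ?u * M * z c)) = 2 * ?u * M * (\<Sum>i\<in>UNIV. \<Sum>c\<in>CK. g i c * z c)"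
    for g :: "'i \<Rightarrow> 'i cconf \<Rightarrow> real" and z
    by (simp add: sum_distrib_left mult_ac)
  have "drift f X \<le> (\<Sum>i\<in>UNIV. lam i * r * ?w) + ((\<Sum>i\<in>UNIV. mu i * actual i (rl X) * ?w) + 2 * ?u * M * ?S
       - mu j * served k j (rl X) * (2 * ?u * M)) + ((\<Sum>i\<in>UNIV. mu0 * tokens i (rl X) * ?w) + 2 * ?u * M * ?T)"
    using drift_le[OF X a s t]
    unfolding distrib_left[of _ ?w] right_diff_distrib[of _ "?w + _"] sum.distrib sum_subtractf sum_served sum_actual sum_tokens pull .
  also have "\<dots> = ?w * total_rate X + 2 * ?u * (M * (?S + ?T)) - 2 * ?u * M * (mu j * served k j (rl X))"
    unfolding total_rate_def sum_distrib_right[symmetric] by (simp add: algebra_simps)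
  finally have 1: "drift f X \<le> ?w * total_rate X + 2 * ?u * (M * (?S + ?T)) - 2 * ?u * M * (mu j * served k j (rl X))" .
  have 2: "?w * total_rate X \<le> ?w * (max_rate * (r + total (rl X)))"
    using total_rate_le by (intro mult_left_mono) auto
  have sk: "size_kappa \<ge> 0" unfolding size_kappa_def by (intro sum_nonneg) auto
  note mr = max_rate_pos
  have 3: "2 * ?u * (M * (?S + ?T)) \<le> 2 * ?u * (size_kappa * (max_rate * (r + total (rl X))))"
  proof (cases "U X > 0")
    case True
    then have "M * cnt {\<kappa>} (rl X) \<le> cnt (cls \<kappa>) (rl X)" by (simp add: U_def)
    also have "\<dots> \<le> total (rl X)" by (rule cnt_le_total) auto
    also have "\<dots> \<le> r + total (rl X)" using r_pos by simp
    finally have "max_rate * size_kappa * (M * cnt {\<kappa>} (rl X)) \<le> max_rate * size_kappa * (r + total (rl X))"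
      using mr sk by (intro mult_left_mono) auto
    moreover have "M * (?S + ?T) \<le> M * (max_rate * size_kappa * cnt {\<kappa>} (rl X))"
      using kappa_rate M_ge_1 by (intro mult_left_mono) auto
    ultimately have "M * (?S + ?T) \<le> size_kappa * (max_rate * (r + total (rl X)))" by (simp add: mult_ac)
    then show ?thesis by (intro mult_left_mono) auto
  qed simp
  show ?thesis using 1 2 3 by (simp add: algebra_simps)
qed

end

context vector_packing
begin

text \<open>The coefficient of the part that decays like \<open>1 / M\<close> uniformly in
  \<open>r\<close>; the 8 comes from bounding the square of \<open>2 * r + fluct X\<close> by
  \<open>8 * r ^ 2\<close> plus twice the square of \<open>fluct X\<close>.\<close>

definition spread_const1 :: "'i conf \<Rightarrow> 'i \<Rightarrow> real" where
  "spread_const1 \<kappa> j = 8 * max_rate * (2 + (\<Sum>i\<in>UNIV. real (\<kappa> $ i))) / mu j"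

definition spread_const2 :: "'i conf \<Rightarrow> 'i \<Rightarrow> real \<Rightarrow> real" where
  "spread_const2 \<kappa> j M = max_rate / (M * mu j) * (3 * (1 + M)\<^sup>2 * (2 + real CARD('i)) +
     (4 * real CARD('i) * (2 + (\<Sum>i\<in>UNIV. real (\<kappa> $ i))) + 3 * (1 + M)\<^sup>2) * moment_const)"

end

text \<open>The drift bound divided by \<open>2 * M * mu j * r ^ 2\<close>. The second constant
  grows with \<open>M\<close> but is divided by \<open>r\<close>, so the mean becomes small if
  \<open>M\<close> is chosen first and \<open>r\<close> afterwards.\<close>

lemma (in stationary_greedy) spread_expectation:
  assumes kappa: "\<kappa> \<in> confs B b" "\<kappa> + axis j 1 \<in> confs0 B b" and M: "M \<ge> 1"
  shows "measure_pmf.expectation p (\<lambda>X. max 0 (cnt (cls \<kappa>) (sc X) - M * cnt {\<kappa>} (sc X)) * served (\<kappa> + axis j 1) j (sc X))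
     \<le> spread_const1 \<kappa> j / M + spread_const2 \<kappa> j M / r"
    "integrable p (\<lambda>X. max 0 (cnt (cls \<kappa>) (sc X) - M * cnt {\<kappa>} (sc X)) * served (\<kappa> + axis j 1) j (sc X))"
proof -
  interpret spread B b lam mu rho mu0 \<alpha> r sel rep \<kappa> j M
    by unfold_locales (use assms in auto)
  let ?n = "real CARD('i)"
  let ?g = "\<lambda>X. 2 * max 0 (U X) * M * (mu j * served k j (rl X))"
  note mr = max_rate_pos
  have sk: "size_kappa \<ge> 0" unfolding size_kappa_def by (intro sum_nonneg) auto
  have T1: "r + total (rl X) \<le> (2 + ?n) * r + Q X" for X
    using total_le_fluct[of X] fluct_le_r[of X] by (simp add: algebra_simps)
  have T2: "total (rl X) * (r + total (rl X)) \<le> 8 * r\<^sup>2 + 4 * ?n * Q X" for X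
  proof -
    have "total (rl X) * (r + total (rl X)) \<le> (r + total (rl X)) * (r + total (rl X))"
      using r_pos total_nonneg[of X] by (intro mult_right_mono) auto
    also have "\<dots> \<le> (2 * r + fluct X) * (2 * r + fluct X)"
      using r_pos total_nonneg[of X] total_le_fluct[of X] by (intro mult_mono) auto
    also have "\<dots> \<le> 8 * r\<^sup>2 + 2 * (fluct X)\<^sup>2"
      using zero_le_power2[of "2 * r - fluct X"] by (simp add: power2_eq_square algebra_simps)
    also have "\<dots> \<le> 8 * r\<^sup>2 + 4 * ?n * Q X" using fluct_sq[of X] by simp
    finally show ?thesis .
  qed
  have uT: "max 0 (U X) \<le> total (rl X)" for X
  proof -
    have "0 \<le> M * cnt {\<kappa>} (rl X)" using M by (intro mult_nonneg_nonneg cnt_nonneg) auto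
    moreover have "cnt (cls \<kappa>) (rl X) \<le> total (rl X)" by (rule cnt_le_total) auto
    ultimately show ?thesis using total_nonneg[of X] by (simp add: U_def)
  qed
  define c1 where "c1 = 2 * (2 + size_kappa) * max_rate * (8 * r\<^sup>2) + 6 * (1 + M)\<^sup>2 * max_rate * ((2 + ?n) * r)"
  define c2 where "c2 = 2 * (2 + size_kappa) * max_rate * (4 * ?n) + 6 * (1 + M)\<^sup>2 * max_rate"
  have c2: "c2 \<ge> 0" unfolding c2_def using sk mr by simp
  have drift: "drift f X \<le> c1 + c2 * Q X - ?g X" if "X \<in> St" for X
  proof -
    have "max 0 (U X) * (r + total (rl X)) \<le> total (rl X) * (r + total (rl X))"
      using uT[of X] r_pos total_nonneg[of X] by (intro mult_right_mono) auto
    also note T2[of X]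
    finally have "2 * (2 + size_kappa) * max_rate * (max 0 (U X) * (r + total (rl X))) \<le>
        2 * (2 + size_kappa) * max_rate * (8 * r\<^sup>2 + 4 * ?n * Q X)"
      using sk mr by (intro mult_left_mono) auto
    moreover have "6 * (1 + M)\<^sup>2 * max_rate * (r + total (rl X)) \<le> 6 * (1 + M)\<^sup>2 * max_rate * ((2 + ?n) * r + Q X)"
      using mr T1 by (intro mult_left_mono) auto
    ultimately show ?thesis using drift_f[OF that] unfolding c1_def c2_def by (simp add: algebra_simps)
  qed
  have bound: "\<bar>?g X\<bar> \<le> 2 * M * mu j * (8 * r\<^sup>2) + 2 * M * mu j * (4 * ?n) * Q X" for X
  proof -
    have "max 0 (U X) * served k j (rl X) \<le> total (rl X) * (r + total (rl X))"
      using uT[of X] r_pos total_nonneg[of X] served_le_total[of k j X] served_nonneg[of k j X] by (intro mult_mono) auto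
    also note T2[of X]
    finally have "2 * M * mu j * (max 0 (U X) * served k j (rl X)) \<le> 2 * M * mu j * (8 * r\<^sup>2 + 4 * ?n * Q X)"
      using M mu_pos[of j] by (intro mult_left_mono) auto
    moreover have "?g X \<ge> 0" using M mu_pos[of j] served_nonneg[of k j X] by simp
    ultimately show ?thesis by (simp add: algebra_simps)
  qed
  have low: "\<exists>c. \<forall>X\<in>St. f X \<ge> - c - e * V X" if "e > 0" for e
  proof (intro exI ballI)
    fix X
    have "f X \<ge> 0" "e * V X \<ge> 0" using that V_nonneg[of X] by (auto simp: f_def)
    then show "f X \<ge> - 0 - e * V X" by linarith
  qed
  have *: "measure_pmf.expectation p ?g \<le> c1 + c2 * (moment_const * r)"
    by (rule expected_gain_le[where f=f, OF low drift bound c2])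
  have eq: "max 0 (cnt (cls \<kappa>) (sc X) - M * cnt {\<kappa>} (sc X)) * served k j (sc X) = inverse (2 * M * mu j * r\<^sup>2) * ?g X" for X
  proof -
    have A: "cnt (cls \<kappa>) (sc X) - M * cnt {\<kappa>} (sc X) = U X / r"
      by (simp add: U_def cnt_scale diff_divide_distrib)
    have B: "max 0 (U X / r) = max 0 (U X) / r" using r_pos by (simp add: max_def field_simps)
    have C: "served k j (sc X) = served k j (rl X) / r" by (simp add: served_def lin_scale)
    show ?thesis unfolding A B C using M mu_pos[of j] r_pos by (simp add: field_simps power2_eq_square)
  qed
  show "integrable p (\<lambda>X. max 0 (cnt (cls \<kappa>) (sc X) - M * cnt {\<kappa>} (sc X)) * served k j (sc X))"
    unfolding eq by (intro integrable_mult_right integrable_Q_bound[OF bound])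
  have "measure_pmf.expectation p (\<lambda>X. max 0 (cnt (cls \<kappa>) (sc X) - M * cnt {\<kappa>} (sc X)) * served k j (sc X))
     = inverse (2 * M * mu j * r\<^sup>2) * measure_pmf.expectation p ?g"
    unfolding eq by (rule integral_mult_right_zero)
  also have "\<dots> \<le> inverse (2 * M * mu j * r\<^sup>2) * (c1 + c2 * (moment_const * r))"
    using * M mu_pos[of j] by (intro mult_left_mono) auto
  also have "\<dots> = spread_const1 \<kappa> j / M + spread_const2 \<kappa> j M / r"
    using M mu_pos[of j] r_pos unfolding c1_def c2_def spread_const1_def spread_const2_def size_kappa_def[symmetric]
    by (simp add: field_simps power2_eq_square)
  finally show "measure_pmf.expectation p (\<lambda>X. max 0 (cnt (cls \<kappa>) (sc X) - M * cnt {\<kappa>} (sc X)) * served k j (sc X))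
     \<le> spread_const1 \<kappa> j / M + spread_const2 \<kappa> j M / r" .
qed

section \<open>Local stability and optimality\<close>

lemma powr_above_tangent:
  fixes s t a :: real
  assumes s: "s \<ge> 0" and t: "t \<ge> 0" and a: "a > 0"
  shows "(1 + a) * (t powr a * (s - t)) \<le> s powr (1 + a) - t powr (1 + a)"
proof -
  have D: "((\<lambda>x. x powr (1 + a)) has_real_derivative (1 + a) * x powr a) (at x)" if "x > 0" for x :: real
    using has_real_derivative_powr[OF that, of "1 + a"] by simp
  \<comment> \<open>Points at 0 are treated apart because the derivative is taken at positive points
    only; otherwise the mean value theorem and monotonicity of the power apply.\<close>
  consider "t = 0" | "s = 0" "t > 0" | "s > 0" "t > 0" "s = t" | "s > 0" "t > 0" "s < t" | "s > 0" "t > 0" "t < s"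
    using s t by linarith
  then show ?thesis
  proof cases
    case 2
    have "t powr (1 + a) = t powr a * t" using 2 by (simp add: powr_add mult.commute)
    moreover have "0 \<le> a * (t powr a * t)" using 2 a by simp
    ultimately show ?thesis using 2 by (simp add: algebra_simps)
  next
    case 4
    obtain z where z: "s < z" "z < t" "t powr (1 + a) - s powr (1 + a) = (t - s) * ((1 + a) * z powr a)"
      using MVT2[of s t "\<lambda>x. x powr (1 + a)" "\<lambda>x. (1 + a) * x powr a"] 4 D by fastforce
    have "z powr a \<le> t powr a" using z 4 a by (intro powr_mono2) auto
    then have "(t - s) * ((1 + a) * z powr a) \<le> (t - s) * ((1 + a) * t powr a)"
      using 4 a by (intro mult_left_mono) auto
    then show ?thesis using z(3) by (simp add: algebra_simps)
  next
    case 5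
    obtain z where z: "t < z" "z < s" "s powr (1 + a) - t powr (1 + a) = (s - t) * ((1 + a) * z powr a)"
      using MVT2[of t s "\<lambda>x. x powr (1 + a)" "\<lambda>x. (1 + a) * x powr a"] 5 D by fastforce
    have "t powr a \<le> z powr a" using z 5 a by (intro powr_mono2) auto
    then have "(s - t) * ((1 + a) * t powr a) \<le> (s - t) * ((1 + a) * z powr a)"
      using 5 a by (intro mult_left_mono) auto
    then show ?thesis using z(3) by (simp add: algebra_simps)
  qed auto
qed

lemma finite_convergent_subsequence:
  fixes x :: "nat \<Rightarrow> 'a \<Rightarrow> real"
  assumes "finite A" "\<And>n a. a \<in> A \<Longrightarrow> \<bar>x n a\<bar> \<le> C"
  shows "\<exists>l s. strict_mono (s :: nat \<Rightarrow> nat) \<and> (\<forall>a\<in>A. (\<lambda>n. x (s n) a) \<longlonglongrightarrow> l a)"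
  using assms
proof (induction A rule: finite_induct)
  case empty
  show ?case by (rule exI, rule exI[of _ id]) (auto simp: strict_mono_def)
next
  case (insert a A)
  then obtain l s where ls: "strict_mono (s :: nat \<Rightarrow> nat)" "\<forall>a\<in>A. (\<lambda>n. x (s n) a) \<longlonglongrightarrow> l a" by auto
  have "bounded (range (\<lambda>n. x (s n) a))" using insert.prems by (auto simp: bounded_iff)
  then obtain l' s' where l': "strict_mono (s' :: nat \<Rightarrow> nat)" "((\<lambda>n. x (s n) a) \<circ> s') \<longlonglongrightarrow> l'"
    using bounded_imp_convergent_subsequence by blast
  have "strict_mono (s \<circ> s')" using ls(1) l'(1) by (rule strict_mono_o)
  moreover have "(\<lambda>n. x ((s \<circ> s') n) a') \<longlonglongrightarrow> (l(a := l')) a'" if "a' \<in> insert a A" for a'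
  proof (cases "a' = a")
    case True
    then show ?thesis using l'(2) by (simp add: o_def)
  next
    case False
    then have "(\<lambda>n. x (s n) a') \<longlonglongrightarrow> l a'" using ls(2) that by auto
    from LIMSEQ_subseq_LIMSEQ[OF this l'(1)] show ?thesis using False by (simp add: o_def)
  qed
  ultimately show ?case by blast
qed

lemma vec_setdist_le:
  assumes "u \<in> W"
  shows "0 \<le> vec_setdist A x W" "vec_setdist A x W \<le> L2_set (\<lambda>a. x a - u a) A"
proof -
  show "0 \<le> vec_setdist A x W" unfolding vec_setdist_def using assms by (intro cINF_greatest) auto
  show "vec_setdist A x W \<le> L2_set (\<lambda>a. x a - u a) A"
    unfolding vec_setdist_def using assms by (intro cINF_lower bdd_belowI2[of _ 0]) auto
qed

lemma tendsto_L2_set_zero: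
  assumes "\<And>a. a \<in> A \<Longrightarrow> (\<lambda>n. x n a) \<longlonglongrightarrow> u a"
  shows "(\<lambda>n. L2_set (\<lambda>a. x n a - u a) A) \<longlonglongrightarrow> 0"
proof -
  have "(\<lambda>n. L2_set (\<lambda>a. x n a - u a) A) \<longlonglongrightarrow> sqrt (\<Sum>a\<in>A. (u a - u a)\<^sup>2)"
    unfolding L2_set_def by (intro tendsto_intros assms)
  then show ?thesis by simp
qed

context vector_packing
begin

section \<open>Target sets and sufficient conditions for optimality\<close>

definition supported :: "('i cconf \<Rightarrow> real) \<Rightarrow> bool" where
  "supported x \<longleftrightarrow> (\<forall>c\<in>CK. x c \<ge> 0) \<and> (\<forall>c. c \<notin> CK \<longrightarrow> x c = 0)"

lemma balanced_iff:
  assumes "supported x"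
  shows "x \<in> balanced_set B b rho \<longleftrightarrow> (\<forall>i. actual i x = rho i \<and> tokens i x = 0)"
proof -
  have "(\<Sum>(k, kh)\<in>CK. real (k $ i) * x (k, kh)) = actual i x + tokens i x" for i
    unfolding actual_def tokens_def lin_def sum.distrib[symmetric] split_def
    by (intro sum.cong refl) (simp add: distrib_right[symmetric] real_conf_split)
  moreover have "(\<Sum>(k, kh)\<in>CK. real (kh $ i) * x (k, kh)) = actual i x" for i
    by (simp add: actual_def lin_def split_def)
  ultimately have "x \<in> balanced_set B b rho \<longleftrightarrow> (\<forall>i. actual i x + tokens i x = rho i \<and> actual i x = rho i)"
    using assms by (auto simp: balanced_set_def supported_def)
  also have "\<dots> \<longleftrightarrow> (\<forall>i. actual i x = rho i \<and> tokens i x = 0)"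
    by (intro all_cong1) auto
  finally show ?thesis .
qed

lemma marginal_feasible:
  assumes x: "x \<in> balanced_set B b rho"
  shows "marginal x \<in> feasible_set B b rho"
proof -
  have pos: "\<And>c. c \<in> CK \<Longrightarrow> x c \<ge> 0" and zero: "\<And>c. c \<notin> CK \<Longrightarrow> x c = 0"
    and bal: "\<And>i. (\<Sum>(k, kh)\<in>CK. real (k $ i) * x (k, kh)) = rho i"
    using x by (auto simp: balanced_set_def)
  have "marginal x k = 0" if "k \<notin> K" for k
    unfolding marginal_def using that by (intro sum.neutral) (auto intro!: zero simp: CK_iff)
  moreover have "marginal x k \<ge> 0" if "k \<in> K" for k
    unfolding marginal_def using that by (intro sum_nonneg) (auto intro!: pos simp: CK_iff)
  moreover have "(\<Sum>k\<in>K. real (k $ i) * marginal x k) = rho i" for i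
  proof -
    have "(\<Sum>k\<in>K. real (k $ i) * marginal x k) = (\<Sum>k\<in>K. marginal (\<lambda>c. real (fst c $ i) * x c) k)"
      by (simp add: marginal_def sum_distrib_left)
    also have "\<dots> = cnt K (\<lambda>c. real (fst c $ i) * x c)"
      by (rule sum_marginal_cnt) (auto simp: zero K_iff)
    also have "\<dots> = (\<Sum>(k, kh)\<in>CK. real (k $ i) * x (k, kh))"
      unfolding cnt_def lin_def split_def by (intro sum.cong) (auto simp: CK_iff)
    finally show ?thesis using bal by simp
  qed
  ultimately show ?thesis by (auto simp: feasible_set_def)
qed

text \<open>By convexity, \<open>Phi y - Phi z\<close> is at least the linear form of the gradient
  at \<open>z\<close>, applied to \<open>y - z\<close>. The form given by the multipliers
  \<open>\<eta>\<close> lies below it, with equality where \<open>z\<close> is positive, and it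
  vanishes on differences of feasible points.\<close>

lemma kkt_optimal:
  assumes z: "z \<in> feasible_set B b rho"
    and kkt: "\<And>k. k \<in> K \<Longrightarrow> (\<Sum>i\<in>UNIV. real (k $ i) * \<eta> i) \<le> (\<Sum>k'\<in>cls k. z k') powr \<alpha>"
    and slack: "\<And>k. k \<in> K \<Longrightarrow> z k > 0 \<Longrightarrow> (\<Sum>k'\<in>cls k. z k') powr \<alpha> = (\<Sum>i\<in>UNIV. real (k $ i) * \<eta> i)"
  shows "z \<in> optimal_set B b \<alpha> rho"
proof -
  have "Phi B b \<alpha> z \<le> Phi B b \<alpha> y" if y: "y \<in> feasible_set B b rho" for y
  proof -
    define w where "w k = (\<Sum>k'\<in>cls k. z k')" for k
    have nonneg: "\<And>k. k \<in> K \<Longrightarrow> z k \<ge> 0" "\<And>k. k \<in> K \<Longrightarrow> y k \<ge> 0" using z y by (auto simp: feasible_set_def)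
    have "(\<Sum>q\<in>aconfs B b. (\<Sum>k\<in>q. w k powr \<alpha> * (y k - z k))) \<le>
        (\<Sum>q\<in>aconfs B b. inverse (1 + \<alpha>) * (\<Sum>k\<in>q. y k) powr (1 + \<alpha>) - inverse (1 + \<alpha>) * (\<Sum>k\<in>q. z k) powr (1 + \<alpha>))"
    proof (rule sum_mono)
      fix q assume "q \<in> aconfs B b"
      then obtain k where k: "k \<in> K" "q = cls k" by (auto simp: aconfs_iff)
      have sub: "q \<subseteq> K" using cls_subset_K k by simp
      have "w k' = (\<Sum>k\<in>q. z k)" if "k' \<in> q" for k' using that cls_eq k by (simp add: w_def)
      then have "(\<Sum>k\<in>q. w k powr \<alpha> * (y k - z k)) = (\<Sum>k\<in>q. z k) powr \<alpha> * ((\<Sum>k\<in>q. y k) - (\<Sum>k\<in>q. z k))"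
        by (simp add: sum_distrib_left[symmetric] sum_subtractf[symmetric])
      moreover have "(1 + \<alpha>) * ((\<Sum>k\<in>q. z k) powr \<alpha> * ((\<Sum>k\<in>q. y k) - (\<Sum>k\<in>q. z k))) \<le>
          (\<Sum>k\<in>q. y k) powr (1 + \<alpha>) - (\<Sum>k\<in>q. z k) powr (1 + \<alpha>)"
        using nonneg sub by (intro powr_above_tangent alpha_pos sum_nonneg) auto
      ultimately have "inverse (1 + \<alpha>) * ((1 + \<alpha>) * (\<Sum>k\<in>q. w k powr \<alpha> * (y k - z k))) \<le>
          inverse (1 + \<alpha>) * ((\<Sum>k\<in>q. y k) powr (1 + \<alpha>) - (\<Sum>k\<in>q. z k) powr (1 + \<alpha>))"
        using alpha_pos by (intro mult_left_mono) auto
      moreover have "inverse (1 + \<alpha>) * ((1 + \<alpha>) * v) = v" for v :: real using alpha_pos by simp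
      ultimately show "(\<Sum>k\<in>q. w k powr \<alpha> * (y k - z k)) \<le>
          inverse (1 + \<alpha>) * (\<Sum>k\<in>q. y k) powr (1 + \<alpha>) - inverse (1 + \<alpha>) * (\<Sum>k\<in>q. z k) powr (1 + \<alpha>)"
        by (simp only: right_diff_distrib)
    qed
    also have "\<dots> = Phi B b \<alpha> y - Phi B b \<alpha> z" by (simp add: Phi_def sum_subtractf)
    also have "(\<Sum>q\<in>aconfs B b. (\<Sum>k\<in>q. w k powr \<alpha> * (y k - z k))) = (\<Sum>k\<in>K. w k powr \<alpha> * (y k - z k))"
    proof -
      have "aconfs B b = cls ` K" by (auto simp: aconfs_iff)
      moreover have "{k' \<in> K. cls k' = cls k} = cls k" if "k \<in> K" for k
      proof -
        have "cls k' = cls k \<longleftrightarrow> k' \<in> cls k" if "k' \<in> K" for k'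
          using cls_eq cls_self[of k'] that by (auto simp: K_iff)
        then show ?thesis using cls_subset_K[OF that] by auto
      qed
      ultimately have "(\<Sum>q\<in>aconfs B b. (\<Sum>k\<in>q. w k powr \<alpha> * (y k - z k))) =
          (\<Sum>q\<in>cls ` K. \<Sum>k\<in>{k \<in> K. cls k = q}. w k powr \<alpha> * (y k - z k))"
        by - (rule sum.cong, simp only:, rule sum.cong, erule imageE, simp only:, rule refl)
      then show ?thesis
        using sum.image_gen[OF finite_K, of "\<lambda>k. w k powr \<alpha> * (y k - z k)" cls] by simp
    qed
    finally have 1: "(\<Sum>k\<in>K. w k powr \<alpha> * (y k - z k)) \<le> Phi B b \<alpha> y - Phi B b \<alpha> z" .
    have "(\<Sum>k\<in>K. (\<Sum>i\<in>UNIV. real (k $ i) * \<eta> i) * (y k - z k)) \<le> (\<Sum>k\<in>K. w k powr \<alpha> * (y k - z k))"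
    proof (rule sum_mono)
      fix k assume k: "k \<in> K"
      show "(\<Sum>i\<in>UNIV. real (k $ i) * \<eta> i) * (y k - z k) \<le> w k powr \<alpha> * (y k - z k)"
      proof (cases "z k > 0")
        case True
        then show ?thesis using slack[OF k] by (simp add: w_def)
      next
        case False
        then have "y k - z k \<ge> 0" using nonneg k by force
        then show ?thesis using kkt[OF k] by (intro mult_right_mono) (auto simp: w_def)
      qed
    qed
    moreover have "(\<Sum>k\<in>K. (\<Sum>i\<in>UNIV. real (k $ i) * \<eta> i) * (y k - z k)) = 0"
    proof -
      have *: "(\<Sum>k\<in>K. (\<Sum>i\<in>UNIV. real (k $ i) * \<eta> i) * v k) = (\<Sum>i\<in>UNIV. \<eta> i * rho i)"
        if "v \<in> feasible_set B b rho" for v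
      proof -
        have "(\<Sum>k\<in>K. (\<Sum>i\<in>UNIV. real (k $ i) * \<eta> i) * v k) = (\<Sum>i\<in>UNIV. \<Sum>k\<in>K. \<eta> i * (real (k $ i) * v k))"
          unfolding sum_distrib_right by (subst sum.swap) (simp only: mult_ac)
        also have "\<dots> = (\<Sum>i\<in>UNIV. \<eta> i * (\<Sum>k\<in>K. real (k $ i) * v k))" by (simp add: sum_distrib_left)
        finally show ?thesis using that by (simp add: feasible_set_def)
      qed
      show ?thesis using *[OF y] *[OF z] by (simp add: right_diff_distrib sum_subtractf)
    qed
    ultimately show ?thesis using 1 by linarith
  qed
  then show ?thesis using z by (force simp: optimal_set_def is_arg_min_def)
qed

section \<open>From local stability to the optimality conditions\<close>

definition pairing :: "('i \<Rightarrow> real) \<Rightarrow> 'i conf \<Rightarrow> real" where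
  "pairing \<eta> k = (\<Sum>i\<in>UNIV. real (k $ i) * \<eta> i)"

lemma pairing_add_axis: "pairing \<eta> (k + axis i 1) = pairing \<eta> k + \<eta> i"
proof -
  have "pairing \<eta> (k + axis i 1) = (\<Sum>j\<in>UNIV. real (k $ j) * \<eta> j + (if j = i then \<eta> i else 0))"
    unfolding pairing_def by (intro sum.cong) (auto simp: axis_component algebra_simps)
  then show ?thesis by (simp add: pairing_def sum.distrib)
qed

lemma conf_induct [case_names zero add]:
  assumes "P 0" and "\<And>k. k \<noteq> 0 \<Longrightarrow> (\<And>i. k $ i > 0 \<Longrightarrow> P (k - axis i 1)) \<Longrightarrow> P (k :: 'i conf)"
  shows "P k"
proof (induction "\<Sum>i\<in>UNIV. k $ i" arbitrary: k rule: less_induct)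
  case less
  show ?case
  proof (cases "k = 0")
    case False
    show ?thesis
    proof (rule assms(2)[OF False], rule less)
      fix i assume i: "k $ i > 0"
      show "(\<Sum>j\<in>UNIV. (k - axis i 1) $ j) < (\<Sum>j\<in>UNIV. k $ j)"
        using i by (intro sum_strict_mono_ex1) (auto simp: axis_component)
    qed
  qed (use assms(1) in simp)
qed

lemma pairing_pos:
  assumes "k \<noteq> 0" "\<And>i. k $ i > 0 \<Longrightarrow> \<eta> i > 0"
  shows "pairing \<eta> k > 0"
proof -
  obtain i where "k $ i \<noteq> 0" using assms(1) unfolding vec_eq_zero_iff_nat by blast
  then have i: "k $ i > 0" by (simp only: neq0_conv)
  have nonneg: "0 \<le> real (k $ i) * \<eta> i" for i
    using assms(2)[of i] by (cases "k $ i = 0") (auto simp: less_imp_le)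
  have "0 < real (k $ i) * \<eta> i" using i assms(2) by simp
  also have "\<dots> \<le> pairing \<eta> k" unfolding pairing_def using nonneg by (intro member_le_sum) auto
  finally show ?thesis .
qed

text \<open>\<open>\<eta> i\<close> is the smallest increment available to type \<open>i\<close>.
  Building a configuration \<open>k\<close> up from the empty one, with the types of positive \<open>\<eta>\<close> first, shows
  \<open>pairing \<eta> k \<le> h (w k)\<close>. Taking it apart, one customer at a time and always passing through
  occupied configurations, gives the converse inequality for occupied \<open>k\<close>.\<close>

lemma locally_stable_optimal:
  assumes x: "x \<in> balanced_set B b rho"
    and stable: "\<And>k i k'. k \<in> K \<Longrightarrow> k' \<in> K0 \<Longrightarrow> k' + axis i 1 \<in> K0 \<Longrightarrow> served k i x > 0 \<Longrightarrow>
       k' = 0 \<or> cnt (cls k') x > 0 \<Longrightarrow> inc x (k - axis i 1) i \<le> inc x k' i"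
    and spread: "\<And>\<kappa> j. \<kappa> \<in> K \<Longrightarrow> \<kappa> + axis j 1 \<in> K0 \<Longrightarrow> served (\<kappa> + axis j 1) j x > 0 \<Longrightarrow>
       cnt (cls \<kappa>) x > 0 \<Longrightarrow> cnt {\<kappa>} x > 0"
  shows "marginal x \<in> optimal_set B b \<alpha> rho"
proof -
  have pos: "\<And>c. c \<in> CK \<Longrightarrow> x c \<ge> 0" and zero: "\<And>c. c \<notin> CK \<Longrightarrow> x c = 0"
    using x by (auto simp: balanced_set_def)
  have sup: "supported x" using pos zero by (simp add: supported_def)
  define w where "w k = cnt (cls k) x" for k
  have w0: "w 0 = 0" by (simp add: w_def cnt_zero_cls)
  have w_nonneg: "w k \<ge> 0" for k unfolding w_def by (rule cnt_nonneg[OF pos])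
  have tok: "tokens i x = 0" "actual i x = rho i" for i using x balanced_iff[OF sup] by auto
  have no_token: "fst c = snd c" if "c \<in> CK" "x c > 0" for c
  proof -
    have "real (fst c $ i - snd c $ i) * x c = 0" for i
      using tok(1)[of i] that finite_CK pos unfolding tokens_def lin_def by (subst (asm) sum_nonneg_eq_0_iff) auto
    then have "fst c \<le> snd c" using that by (auto simp: less_eq_vec_def)
    then show ?thesis using that by (auto simp: CK_iff)
  qed
  \<comment> \<open>\<open>served\<close> counts actual customers only; without tokens every
    customer of an occupied configuration is actual.\<close>
  have served_pos: "served k i x > 0" if k: "k \<in> K0" "cnt {k} x > 0" "k $ i > 0" for k i
  proof -
    have "(\<Sum>c\<in>CK. (if fst c \<in> {k} then 1 else 0) * x c) \<noteq> 0" using k by (simp add: cnt_def lin_def)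
    then obtain c where c: "c \<in> CK" "(if fst c \<in> {k} then 1 else 0) * x c \<noteq> 0"
      by (rule sum.not_neutral_contains_not_neutral)
    then have c': "fst c = k" "x c > 0" using pos[OF c(1)] by (auto split: if_splits)
    then have "snd c = k" using no_token c by simp
    have "0 < (if fst c = k then real (snd c $ i) else 0) * x c" using c' \<open>snd c = k\<close> k by simp
    also have "\<dots> \<le> served k i x"
      unfolding served_def lin_def using c finite_CK pos by (intro member_le_sum) auto
    finally show ?thesis .
  qed
  \<comment> \<open>The total mass is 1, so the cut-off in \<open>h\<close> is never active
    here.\<close>
  have w_le_1: "w k \<le> 2" for k
  proof -
    have "w k \<le> total x" unfolding w_def by (rule cnt_le_total[OF pos])
    also have "\<dots> = 1" using tok rho_sum by (simp add: total_def)
    finally show ?thesis by simp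
  qed
  have h_pos: "h (w k) > 0 \<longleftrightarrow> w k > 0" for k using w_nonneg[of k] by (auto simp: h_def min_def)
  \<comment> \<open>The places available to type \<open>i\<close>. The empty server is always among
    them, so the minimum \<open>\<eta> i\<close> exists; it may be negative.\<close>
  define A where "A i = {k' \<in> K0. k' + axis i 1 \<in> K0 \<and> (k' = 0 \<or> w k' > 0)}" for i
  have fA: "finite (A i)" "0 \<in> A i" for i
    using finite_K0 unit_conf by (auto simp: A_def)
  define \<eta> where "\<eta> i = Min ((\<lambda>k'. inc x k' i) ` A i)" for i
  have eta_le: "\<eta> i \<le> inc x k' i" if "k' \<in> A i" for i k' unfolding \<eta>_def using fA that by (intro Min_le) auto
  have eta_attained: "\<exists>k'\<in>A i. \<eta> i = inc x k' i" for i
    using Min_in[of "(\<lambda>k'. inc x k' i) ` A i"] fA unfolding \<eta>_def by blast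
  have inc_w: "inc x k i = h (w (k + axis i 1)) - h (w k)" for k i by (simp add: inc_def w_def)
  \<comment> \<open>Positivity of the pairing is carried through the induction because it makes the
    class of the predecessor occupied, hence one of the places over which \<open>\<eta> i\<close> is
    the minimum.\<close>
  have up: "pairing \<eta> k \<le> h (w k)" if "k \<in> K0" "pairing \<eta> k > 0" for k
    using that
  proof (induction k rule: conf_induct)
    case zero
    then show ?case by (simp add: pairing_def)
  next
    case (add k)
    have step: "pairing \<eta> k \<le> h (w k)" if i: "k $ i > 0" and g: "pairing \<eta> (k - axis i 1) > 0" for i
    proof -
      let ?l = "k - axis i 1"
      have l: "?l + axis i 1 = k" "?l \<in> K0" using diff_add_axis[OF i] minus_K0 add.prems by auto
      have le: "pairing \<eta> ?l \<le> h (w ?l)" using add.IH[OF i l(2) g] .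
      then have "w ?l > 0" using g h_pos by force
      then have "?l \<in> A i" using l add.prems by (simp add: A_def)
      from eta_le[OF this] have "\<eta> i \<le> h (w k) - h (w ?l)" by (simp add: inc_w l)
      then show ?thesis using le pairing_add_axis[of \<eta> ?l i] l by simp
    qed
    show ?case
    \<comment> \<open>Removing a type with \<open>\<eta> i \<le> 0\<close> keeps the pairing
      positive. If there is none, every nonempty predecessor has a positive pairing anyway.\<close>
    proof (cases "\<exists>i. k $ i > 0 \<and> \<eta> i \<le> 0")
      case True
      then obtain i where i: "k $ i > 0" "\<eta> i \<le> 0" by blast
      then have "pairing \<eta> (k - axis i 1) > 0"
        using pairing_add_axis[of \<eta> "k - axis i 1" i] diff_add_axis[OF i(1)] add.prems by simp
      then show ?thesis using step i by blast
    next
      case False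
      then have eta_pos: "\<eta> i > 0" if "k $ i > 0" for i using that False not_le by blast
      obtain i where i: "k $ i > 0" using add.hyps by (auto simp: vec_eq_zero_iff_nat)
      let ?l = "k - axis i 1"
      have l: "?l + axis i 1 = k" using diff_add_axis[OF i] .
      show ?thesis
      proof (cases "?l = 0")
        case True
        have "\<eta> i \<le> h (w k) - h (w 0)" using eta_le[OF fA(2), of i] l True by (simp add: inc_w)
        moreover have "pairing \<eta> k = \<eta> i" using pairing_add_axis[of \<eta> 0 i] l True by (simp add: pairing_def)
        ultimately show ?thesis by (simp add: w0 h_zero)
      next
        case False
        have "k $ j > 0" if "?l $ j > 0" for j using that by simp
        then have "pairing \<eta> ?l > 0" using False eta_pos by (intro pairing_pos) auto
        then show ?thesis using step[OF i] by blast
      qed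
    qed
  qed
  \<comment> \<open>The induction runs over \<open>cnt {k} x > 0\<close> and not
    \<open>w k > 0\<close>, since \<open>stable\<close> speaks about customers in servers of
    configuration \<open>k\<close> itself; \<open>spread\<close> passes this on to a predecessor
    whose class is occupied.\<close>
  have down: "h (w k) \<le> pairing \<eta> k" if "k \<in> K0" "cnt {k} x > 0" for k
    using that
  proof (induction k rule: conf_induct)
    case zero
    then show ?case by (simp add: w0 h_zero pairing_def)
  next
    case (add k)
    have kK: "k \<in> K" using add by (simp add: K_iff)
    have le: "h (w k) \<le> h (w (k - axis i 1)) + \<eta> i" if i: "k $ i > 0" for i
    proof -
      obtain k' where k': "k' \<in> A i" "\<eta> i = inc x k' i" using eta_attained by blast
      have "inc x (k - axis i 1) i \<le> inc x k' i"
        using k' served_pos[OF add.prems i] by (intro stable kK) (auto simp: A_def w_def)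
      then show ?thesis using k' diff_add_axis[OF i] by (simp add: inc_w)
    qed
    have wk: "w k > 0"
    proof -
      have "cnt {k} x \<le> w k" unfolding w_def cnt_def using add.prems by (intro lin_mono pos) auto
      then show ?thesis using add.prems by simp
    qed
    obtain i where i: "k $ i > 0" using add.hyps by (auto simp: vec_eq_zero_iff_nat)
    have good: "h (w k) \<le> pairing \<eta> k" if j: "k $ j > 0" and alt: "k - axis j 1 = 0 \<or> w (k - axis j 1) > 0" for j
    proof -
      let ?l = "k - axis j 1"
      have l: "?l + axis j 1 = k" "?l \<in> K0" using diff_add_axis[OF j] minus_K0 add.prems by auto
      have "h (w ?l) \<le> pairing \<eta> ?l"
      proof (cases "?l = 0")
        case True
        then show ?thesis by (simp add: w0 h_zero pairing_def)
      next
        case False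
        have "cnt {?l} x > 0"
          using spread[of ?l j] l False alt served_pos[OF add.prems j] add.prems(1) by (simp add: K_iff w_def)
        then show ?thesis using add.IH[OF j l(2)] by blast
      qed
      then show ?thesis using le[OF j] pairing_add_axis[of \<eta> ?l j] l by simp
    qed
    show ?case
    proof (cases "\<exists>j. k $ j > 0 \<and> (k - axis j 1 = 0 \<or> w (k - axis j 1) > 0)")
      case True
      then show ?thesis using good by blast
    next
      \<comment> \<open>If every predecessor is nonempty with an unoccupied class, \<open>le\<close>
        forces \<open>\<eta> j > 0\<close> for all types in \<open>k\<close>. Then \<open>up\<close>
        makes the class of a predecessor occupied after all.\<close>
      case False
      have nz: "k - axis j 1 \<noteq> 0" "w (k - axis j 1) = 0" if j: "k $ j > 0" for j
      proof -
        have "k - axis j 1 \<noteq> 0 \<and> \<not> w (k - axis j 1) > 0" using False j by blast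
        then show "k - axis j 1 \<noteq> 0" "w (k - axis j 1) = 0"
          using w_nonneg[of "k - axis j 1"] by linarith+
      qed
      have eta_pos: "\<eta> j > 0" if "k $ j > 0" for j
        using le[OF that] nz[OF that] wk h_pos[of k] by (simp add: h_zero)
      let ?l = "k - axis i 1"
      have "k $ j > 0" if "?l $ j > 0" for j using that by simp
      then have "pairing \<eta> ?l > 0" using nz(1)[OF i] eta_pos by (intro pairing_pos) auto
      then have "h (w ?l) > 0" using up[of ?l] minus_K0 add.prems by force
      then show ?thesis using nz[OF i] by (simp add: h_zero)
    qed
  qed
  have sum_cls: "(\<Sum>k'\<in>cls k. marginal x k') powr \<alpha> = h (w k)" for k
    using sum_marginal_cnt[where q="cls k", OF zero cls_subset] w_le_1[of k] by (simp add: h_def w_def)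
  have kkt: "pairing \<eta> k \<le> h (w k)" if "k \<in> K" for k
    using up[of k] that h_nonneg[of "w k"] by (cases "pairing \<eta> k > 0") (auto simp: K_iff)
  show ?thesis
  proof (rule kkt_optimal[OF marginal_feasible[OF x], of \<eta>])
    fix k assume k: "k \<in> K"
    show "(\<Sum>i\<in>UNIV. real (k $ i) * \<eta> i) \<le> (\<Sum>k'\<in>cls k. marginal x k') powr \<alpha>"
      using kkt[OF k] unfolding sum_cls pairing_def .
    assume "marginal x k > 0"
    then have "cnt {k} x > 0" using marginal_cnt[where k=k, OF zero] k by (simp add: K_iff)
    then show "(\<Sum>k'\<in>cls k. marginal x k') powr \<alpha> = (\<Sum>i\<in>UNIV. real (k $ i) * \<eta> i)"
      using kkt[OF k] down[of k] k unfolding sum_cls pairing_def by (simp add: K_iff)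
  qed
qed

text \<open>A version with finite precision of the hypotheses of
  \<open>locally_stable_optimal\<close>. Strict positivity is replaced by the levels
  \<open>1 / (m + 1)\<close>. Only levels \<open>m \<le> n\<close> are tested at precision
  \<open>n\<close>, and \<open>T\<close> does not depend on \<open>n\<close>, so a limit of vectors
  of growing precision satisfies the conditions at every level.\<close>

definition good :: "(nat \<Rightarrow> real) \<Rightarrow> nat \<Rightarrow> ('i cconf \<Rightarrow> real) \<Rightarrow> bool" where
  "good T n x \<longleftrightarrow> supported x \<and>
     (\<forall>i. \<bar>actual i x - rho i\<bar> \<le> 1 / (real n + 1) \<and> tokens i x \<le> 1 / (real n + 1)) \<and>
     (\<forall>m\<le>n. \<forall>k\<in>K. \<forall>i. \<forall>k'\<in>K0. k' + axis i 1 \<in> K0 \<longrightarrow>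
        served k i x * gap (1 / (real m + 1)) k i k' x \<le> 1 / (real n + 1)) \<and>
     (\<forall>m\<le>n. \<forall>\<kappa>\<in>K. \<forall>j. \<kappa> + axis j 1 \<in> K0 \<longrightarrow> served (\<kappa> + axis j 1) j x \<ge> 1 / (real m + 1) \<longrightarrow>
        cnt (cls \<kappa>) x \<ge> 1 / (real m + 1) \<longrightarrow> cnt {\<kappa>} x \<ge> T m)"

text \<open>Otherwise vectors of growing precision would stay away from the targets. They are
  bounded, so a subsequence converges, and its limit satisfies the exact hypotheses and thus yields
  points of both targets arbitrarily near, a contradiction.\<close>

lemma good_near_targets:
  assumes T: "\<And>m. T m > 0" and eps: "\<epsilon> > 0"
  shows "\<exists>n. \<forall>x. good T n x \<longrightarrow>
    \<bar>vec_setdist CK x (balanced_set B b rho)\<bar> < \<epsilon> \<and> \<bar>vec_setdist K (marginal x) (optimal_set B b \<alpha> rho)\<bar> < \<epsilon>"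
proof (rule ccontr)
  assume "\<not> ?thesis"
  then have "\<forall>n. \<exists>x. good T n x \<and> \<not> (\<bar>vec_setdist CK x (balanced_set B b rho)\<bar> < \<epsilon> \<and>
     \<bar>vec_setdist K (marginal x) (optimal_set B b \<alpha> rho)\<bar> < \<epsilon>)" by blast
  then obtain x where x: "\<And>n. good T n (x n)"
    and far: "\<And>n. \<not> (\<bar>vec_setdist CK (x n) (balanced_set B b rho)\<bar> < \<epsilon> \<and>
     \<bar>vec_setdist K (marginal (x n)) (optimal_set B b \<alpha> rho)\<bar> < \<epsilon>)" by metis
  have sup: "supported (x n)" for n using x[of n] unfolding good_def by (rule conjunct1)
  have pos: "\<And>n c. c \<in> CK \<Longrightarrow> x n c \<ge> 0" and zero: "\<And>n c. c \<notin> CK \<Longrightarrow> x n c = 0"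
    using sup unfolding supported_def by blast+
  have act: "\<bar>actual i (x n) - rho i\<bar> \<le> 1 / (real n + 1)"
    and tok: "tokens i (x n) \<le> 1 / (real n + 1)" for n i
    using x[of n, unfolded good_def, THEN conjunct2, THEN conjunct1] by auto
  have stable: "\<And>n m k i k'. m \<le> n \<Longrightarrow> k \<in> K \<Longrightarrow> k' \<in> K0 \<Longrightarrow> k' + axis i 1 \<in> K0 \<Longrightarrow>
        served k i (x n) * gap (1 / (real m + 1)) k i k' (x n) \<le> 1 / (real n + 1)"
    using x unfolding good_def by blast
  have spread: "\<And>n m \<kappa> j. m \<le> n \<Longrightarrow> \<kappa> \<in> K \<Longrightarrow> \<kappa> + axis j 1 \<in> K0 \<Longrightarrow> served (\<kappa> + axis j 1) j (x n) \<ge> 1 / (real m + 1) \<Longrightarrow>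
        cnt (cls \<kappa>) (x n) \<ge> 1 / (real m + 1) \<Longrightarrow> cnt {\<kappa>} (x n) \<ge> T m"
    using x unfolding good_def by blast
  have "\<bar>x n c\<bar> \<le> 1 + 2 * real CARD('i)" if c: "c \<in> CK" for n c
  proof -
    have "x n c \<le> (\<Sum>c\<in>CK. x n c)" using c finite_CK pos by (intro member_le_sum) auto
    also have "\<dots> \<le> total (x n)" by (rule sum_le_total[OF pos])
    also have "\<dots> \<le> (\<Sum>i\<in>UNIV. rho i + 2)"
      unfolding total_def
    proof (rule sum_mono)
      fix i
      have "1 / (real n + 1) \<le> 1" by simp
      then show "actual i (x n) + tokens i (x n) \<le> rho i + 2" using act[of i n] tok[of i n] by linarith
    qed
    also have "\<dots> = 1 + 2 * real CARD('i)" using rho_sum by (simp add: sum.distrib)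
    finally show ?thesis using pos[OF c, of n] by simp
  qed
  from finite_convergent_subsequence[where x=x, OF finite_CK this]
  obtain l s where s: "strict_mono (s :: nat \<Rightarrow> nat)" "\<forall>c\<in>CK. (\<lambda>n. x (s n) c) \<longlonglongrightarrow> l c" by blast
  define u where "u c = (if c \<in> CK then l c else 0)" for c
  have conv: "(\<lambda>n. x (s n) c) \<longlonglongrightarrow> u c" for c using s(2) zero by (cases "c \<in> CK") (auto simp: u_def)
  have lin: "(\<lambda>n. lin a (x (s n))) \<longlonglongrightarrow> lin a u" for a
    unfolding lin_def by (intro tendsto_intros conv)
  have cnt: "(\<lambda>n. cnt q (x (s n))) \<longlonglongrightarrow> cnt q u" for q unfolding cnt_def by (rule lin)
  have serv: "(\<lambda>n. served k i (x (s n))) \<longlonglongrightarrow> served k i u" for k i unfolding served_def by (rule lin)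
  have upos: "u c \<ge> 0" for c
  proof (cases "c \<in> CK")
    case True
    then show ?thesis using pos[OF True] by (intro LIMSEQ_le_const[OF conv]) auto
  qed (simp add: u_def)
  have "u c = 0" if "c \<notin> CK" for c using that by (simp add: u_def)
  then have usup: "supported u" unfolding supported_def using upos by blast
  have cnt_pos: "cnt q (x n) \<ge> 0" for q n by (rule cnt_nonneg[OF pos])
  have hconv: "(\<lambda>n. h (cnt q (x (s n)))) \<longlonglongrightarrow> h (cnt q u)" for q
    unfolding h_def using alpha_pos cnt_pos by (intro tendsto_powr' tendsto_min tendsto_intros cnt) auto
  have iconv: "(\<lambda>n. inc (x (s n)) k i) \<longlonglongrightarrow> inc u k i" for k i
    unfolding inc_def by (intro tendsto_diff hconv)
  have sn: "s n \<ge> n" for n using s(1) by (rule seq_suble)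
  have inv: "(\<lambda>n. 1 / (real (s n) + 1)) \<longlonglongrightarrow> 0"
  proof (rule tendsto_sandwich[OF _ _ tendsto_const])
    show "\<forall>\<^sub>F n in sequentially. 1 / (real (s n) + 1) \<le> 1 / (real n + 1)"
      using sn by (intro always_eventually allI divide_left_mono) auto
    show "(\<lambda>n. 1 / (real n + 1)) \<longlonglongrightarrow> 0"
      using LIMSEQ_Suc[OF lim_1_over_n] by (simp add: add.commute)
  qed auto
  have bal: "u \<in> balanced_set B b rho"
    unfolding balanced_iff[OF usup]
  proof (intro allI conjI)
    fix i
    have "(\<lambda>n. actual i (x (s n)) - rho i) \<longlonglongrightarrow> 0"
      by (rule Lim_null_comparison[OF _ inv]) (use act in auto)
    moreover have "(\<lambda>n. actual i (x (s n)) - rho i) \<longlonglongrightarrow> actual i u - rho i"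
      unfolding actual_def by (intro tendsto_intros lin)
    ultimately show "actual i u = rho i" using LIMSEQ_unique by fastforce
    have "tokens i (x n) \<ge> 0" for n unfolding tokens_def using pos by (intro lin_nonneg) auto
    then have "(\<lambda>n. tokens i (x (s n))) \<longlonglongrightarrow> 0"
      by (intro Lim_null_comparison[OF _ inv]) (use tok in auto)
    moreover have "(\<lambda>n. tokens i (x (s n))) \<longlonglongrightarrow> tokens i u" unfolding tokens_def by (rule lin)
    ultimately show "tokens i u = 0" using LIMSEQ_unique by blast
  qed
  have threshold: "\<exists>m. 1 / (real m + 1) < v \<and> 1 / (real m + 1) < v'" if vs: "v > 0" "v' > 0" for v v' :: real
  proof -
    obtain m where "1 / (real m + 1) < min v v'"
      using reals_Archimedean[of "min v v'"] vs by (auto simp: inverse_eq_divide add.commute)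
    then show ?thesis by auto
  qed
  have opt: "marginal u \<in> optimal_set B b \<alpha> rho"
  proof (rule locally_stable_optimal[OF bal])
    fix k i k' assume k: "k \<in> K" "k' \<in> K0" "k' + axis i 1 \<in> K0" and sp: "served k i u > 0"
      and av: "k' = 0 \<or> cnt (cls k') u > 0"
    define v where "v = (if k' = 0 then 1 else cnt (cls k') u)"
    have "v > 0" using av by (auto simp: v_def)
    then obtain m where m: "1 / (real m + 1) < v" using threshold[of v v] by blast
    have ev: "\<forall>\<^sub>F n in sequentially. served k i (x (s n)) * max 0 (inc (x (s n)) (k - axis i 1) i - inc (x (s n)) k' i) \<le> 1 / (real (s n) + 1)"
    proof -
      have "\<forall>\<^sub>F n in sequentially. k' = 0 \<or> cnt (cls k') (x (s n)) > 1 / (real m + 1)"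
      proof (cases "k' = 0")
        case False
        then have "1 / (real m + 1) < cnt (cls k') u" using m by (simp add: v_def)
        from order_tendstoD(1)[OF cnt this] show ?thesis by (auto elim: eventually_mono)
      qed simp
      then show ?thesis
        using eventually_ge_at_top[of m]
      proof eventually_elim
        case (elim n)
        have "m \<le> s n" using sn[of n] elim by linarith
        from stable[OF this k] show ?case using elim(1) by (auto simp: gap_def)
      qed
    qed
    have "(\<lambda>n. served k i (x (s n)) * max 0 (inc (x (s n)) (k - axis i 1) i - inc (x (s n)) k' i))
        \<longlonglongrightarrow> served k i u * max 0 (inc u (k - axis i 1) i - inc u k' i)"
      by (intro tendsto_intros tendsto_max serv iconv)
    then have "served k i u * max 0 (inc u (k - axis i 1) i - inc u k' i) \<le> 0"
      by (rule tendsto_le[OF sequentially_bot inv _ ev])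
    then have "max 0 (inc u (k - axis i 1) i - inc u k' i) \<le> 0" using sp by (simp add: mult_le_0_iff)
    then show "inc u (k - axis i 1) i \<le> inc u k' i" by simp
  next
    fix \<kappa> j assume k: "\<kappa> \<in> K" "\<kappa> + axis j 1 \<in> K0" and sp: "served (\<kappa> + axis j 1) j u > 0" "cnt (cls \<kappa>) u > 0"
    obtain m where m: "1 / (real m + 1) < served (\<kappa> + axis j 1) j u" "1 / (real m + 1) < cnt (cls \<kappa>) u"
      using threshold[OF sp] by blast
    have "\<forall>\<^sub>F n in sequentially. T m \<le> cnt {\<kappa>} (x (s n))"
      using order_tendstoD(1)[OF serv m(1)] order_tendstoD(1)[OF cnt m(2)] eventually_ge_at_top[of m]
    proof eventually_elim
      case (elim n)
      then show ?case using spread[of m "s n", OF _ k] sn[of n] by linarith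
    qed
    then have "T m \<le> cnt {\<kappa>} u" by (intro tendsto_lowerbound[OF cnt]) auto
    then show "cnt {\<kappa>} u > 0" using T[of m] by linarith
  qed
  have mconv: "(\<lambda>n. marginal (x (s n)) k) \<longlonglongrightarrow> marginal u k" for k
    unfolding marginal_def by (intro tendsto_intros conv)
  have "\<forall>\<^sub>F n in sequentially. L2_set (\<lambda>c. x (s n) c - u c) CK < \<epsilon>"
    using order_tendstoD(2)[OF tendsto_L2_set_zero[of CK "\<lambda>n. x (s n)" u, OF conv] eps] .
  moreover have "\<forall>\<^sub>F n in sequentially. L2_set (\<lambda>k. marginal (x (s n)) k - marginal u k) K < \<epsilon>"
    using order_tendstoD(2)[OF tendsto_L2_set_zero[of K "\<lambda>n. marginal (x (s n))" "marginal u", OF mconv] eps] .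
  ultimately have "\<forall>\<^sub>F n in sequentially. False"
  proof eventually_elim
    case (elim n)
    have "\<bar>vec_setdist CK (x (s n)) (balanced_set B b rho)\<bar> < \<epsilon>"
      using vec_setdist_le[OF bal, of CK "x (s n)"] elim by linarith
    moreover have "\<bar>vec_setdist K (marginal (x (s n))) (optimal_set B b \<alpha> rho)\<bar> < \<epsilon>"
      using vec_setdist_le[OF opt, of K "marginal (x (s n))"] elim by linarith
    ultimately show ?case using far[of "s n"] by blast
  qed
  then show False by simp
qed

end

section \<open>Convergence\<close>

text \<open>Convergence in probability to a constant. At \<open>x = 0\<close> the limiting
  distribution function jumps, so this point is excluded by the continuity condition in weak
  convergence.\<close>

lemma weak_conv_to_zero:
  fixes p :: "nat \<Rightarrow> 's pmf" and f :: "nat \<Rightarrow> 's \<Rightarrow> real"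
  assumes small: "\<And>\<epsilon> \<delta>. \<epsilon> > 0 \<Longrightarrow> \<delta> > 0 \<Longrightarrow> \<forall>\<^sub>F m in sequentially. measure_pmf.prob (p m) {X. \<bar>f m X\<bar> \<ge> \<epsilon>} \<le> \<delta>"
  shows "weak_conv_m (\<lambda>m. distr (measure_pmf (p m)) borel (f m)) (return borel 0)"
  unfolding weak_conv_m_def weak_conv_def
proof (intro allI impI)
  fix x assume cont: "isCont (cdf (return borel (0::real))) x"
  have lim: "cdf (return borel (0::real)) y = (if 0 \<le> y then 1 else 0)" for y
    by (simp add: cdf_def measure_return)
  have cdf: "cdf (distr (measure_pmf (p m)) borel (f m)) x = measure_pmf.prob (p m) {X. f m X \<le> x}" for m
    unfolding cdf_def by (subst measure_distr) (auto simp: vimage_def)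
  have zero: "(\<lambda>m. measure_pmf.prob (p m) {X. \<bar>f m X\<bar> \<ge> \<epsilon>}) \<longlonglongrightarrow> 0" if e: "\<epsilon> > 0" for \<epsilon>
  proof (rule LIMSEQ_I)
    fix d :: real assume d: "d > 0"
    have "\<forall>\<^sub>F m in sequentially. measure_pmf.prob (p m) {X. \<bar>f m X\<bar> \<ge> \<epsilon>} \<le> d / 2"
      using small[OF e, of "d / 2"] d by simp
    then obtain N where "\<forall>m\<ge>N. measure_pmf.prob (p m) {X. \<bar>f m X\<bar> \<ge> \<epsilon>} \<le> d / 2"
      by (auto simp: eventually_sequentially)
    then show "\<exists>N. \<forall>m\<ge>N. norm (measure_pmf.prob (p m) {X. \<bar>f m X\<bar> \<ge> \<epsilon>} - 0) < d"
      using d by (intro exI[of _ N]) (auto intro: le_less_trans)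
  qed
  consider "x > 0" | "x < 0" | "x = 0" by linarith
  then show "(\<lambda>m. cdf (distr (measure_pmf (p m)) borel (f m)) x) \<longlonglongrightarrow> cdf (return borel 0) x"
    unfolding cdf lim
  proof cases
    case 1
    have "1 - measure_pmf.prob (p m) {X. \<bar>f m X\<bar> \<ge> x} \<le> measure_pmf.prob (p m) {X. f m X \<le> x}" for m
    proof -
      have "1 - measure_pmf.prob (p m) {X. \<bar>f m X\<bar> \<ge> x} = measure_pmf.prob (p m) (UNIV - {X. \<bar>f m X\<bar> \<ge> x})"
        by (subst measure_pmf.prob_compl[simplified]) auto
      also have "\<dots> \<le> measure_pmf.prob (p m) {X. f m X \<le> x}"
        by (intro measure_pmf.finite_measure_mono) auto
      finally show ?thesis .
    qed
    note lower = this
    have "(\<lambda>m. 1 - measure_pmf.prob (p m) {X. \<bar>f m X\<bar> \<ge> x}) \<longlonglongrightarrow> 1"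
      using tendsto_diff[OF tendsto_const[of 1] zero[OF 1]] by simp
    from tendsto_sandwich[OF _ _ this tendsto_const]
    have "(\<lambda>m. measure_pmf.prob (p m) {X. f m X \<le> x}) \<longlonglongrightarrow> 1" using lower by (simp add: always_eventually)
    then show "(\<lambda>m. measure_pmf.prob (p m) {X. f m X \<le> x}) \<longlonglongrightarrow> (if 0 \<le> x then 1 else 0)" using 1 by simp
  next
    case 2
    have "measure_pmf.prob (p m) {X. f m X \<le> x} \<le> measure_pmf.prob (p m) {X. \<bar>f m X\<bar> \<ge> - x}" for m
      using 2 by (intro measure_pmf.finite_measure_mono) auto
    note upper = this
    have "(\<lambda>m. measure_pmf.prob (p m) {X. \<bar>f m X\<bar> \<ge> - x}) \<longlonglongrightarrow> 0" using zero[of "- x"] 2 by simp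
    from tendsto_sandwich[OF _ _ tendsto_const this]
    have "(\<lambda>m. measure_pmf.prob (p m) {X. f m X \<le> x}) \<longlonglongrightarrow> 0" using upper by (simp add: always_eventually)
    then show "(\<lambda>m. measure_pmf.prob (p m) {X. f m X \<le> x}) \<longlonglongrightarrow> (if 0 \<le> x then 1 else 0)" using 2 by simp
  next
    case 3
    have "(cdf (return borel (0::real)) \<longlongrightarrow> 1) (at_left 0)"
      using cont 3 lim[of 0] unfolding isCont_def by (auto intro: filterlim_mono[OF _ order_refl at_le])
    moreover have "(cdf (return borel (0::real)) \<longlongrightarrow> 0) (at_left 0)"
      by (rule tendsto_eventually) (auto simp: lim eventually_at_left_field intro!: exI[of _ "-1"])
    ultimately have "(1::real) = 0" by (intro tendsto_unique[of "at_left (0::real)"]) auto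
    then show "(\<lambda>m. measure_pmf.prob (p m) {X. f m X \<le> x}) \<longlonglongrightarrow> (if 0 \<le> x then 1 else 0)" by simp
  qed
qed

lemma pmf_Markov:
  fixes g :: "'s \<Rightarrow> real"
  assumes "integrable (measure_pmf p) g" "\<And>X. g X \<ge> 0" "d > 0" "measure_pmf.expectation p g \<le> c"
    "\<And>X. X \<in> A \<Longrightarrow> g X \<ge> d"
  shows "measure_pmf.prob p A \<le> c / d"
proof -
  have "measure_pmf.prob p A \<le> measure_pmf.prob p {X \<in> space (measure_pmf p). g X \<ge> d}"
    using assms(5) by (intro measure_pmf.finite_measure_mono) auto
  also have "\<dots> \<le> measure_pmf.expectation p g / d"
    by (rule integral_Markov_inequality_measure[where A="UNIV"]) (use assms in auto)
  also have "\<dots> \<le> c / d" using assms by (intro divide_right_mono) auto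
  finally show ?thesis .
qed

lemma eventually_prob_union:
  fixes p :: "nat \<Rightarrow> 's pmf"
  assumes "finite I" "\<And>a. a \<in> I \<Longrightarrow> \<forall>\<^sub>F m in sequentially. measure_pmf.prob (p m) (E a m) \<le> d a"
  shows "\<forall>\<^sub>F m in sequentially. measure_pmf.prob (p m) (\<Union>a\<in>I. E a m) \<le> (\<Sum>a\<in>I. d a)"
proof -
  have "\<forall>\<^sub>F m in sequentially. \<forall>a\<in>I. measure_pmf.prob (p m) (E a m) \<le> d a"
    using assms by (simp add: eventually_ball_finite_distrib)
  then show ?thesis
  proof eventually_elim
    case (elim m)
    have "measure_pmf.prob (p m) (\<Union>a\<in>I. E a m) \<le> (\<Sum>a\<in>I. measure_pmf.prob (p m) (E a m))"
      using assms(1) by (intro measure_pmf.finite_measure_subadditive_finite) auto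
    also have "\<dots> \<le> (\<Sum>a\<in>I. d a)" using elim by (intro sum_mono) auto
    finally show ?case .
  qed
qed

lemma eventually_prob_union_small:
  fixes p :: "nat \<Rightarrow> 's pmf"
  assumes "finite I" "\<And>a \<delta>. a \<in> I \<Longrightarrow> \<delta> > 0 \<Longrightarrow> \<forall>\<^sub>F m in sequentially. measure_pmf.prob (p m) (E a m) \<le> \<delta>" "\<delta> > 0"
  shows "\<forall>\<^sub>F m in sequentially. measure_pmf.prob (p m) (\<Union>a\<in>I. E a m) \<le> \<delta>"
proof -
  have "\<forall>\<^sub>F m in sequentially. measure_pmf.prob (p m) (\<Union>a\<in>I. E a m) \<le> (\<Sum>a\<in>I. \<delta> / (real (card I) + 1))"
    using assms by (intro eventually_prob_union) auto
  moreover have "(\<Sum>a\<in>I. \<delta> / (real (card I) + 1)) \<le> \<delta>" using assms(3) by (simp add: field_simps)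
  ultimately show ?thesis by (auto elim: eventually_mono)
qed

section \<open>The sequence of systems and its failure probabilities\<close>

locale greedy_sequence = vector_packing B b lam mu rho mu0 \<alpha>
  for B :: "'n::finite \<Rightarrow> real" and b :: "'i::finite \<Rightarrow> 'n \<Rightarrow> real"
  and lam mu rho :: "'i \<Rightarrow> real" and mu0 \<alpha> :: real +
  fixes r :: "nat \<Rightarrow> real" and sel :: "nat \<Rightarrow> 'i state \<Rightarrow> 'i \<Rightarrow> 'i conf set"
    and rep :: "nat \<Rightarrow> 'i state \<Rightarrow> 'i \<Rightarrow> 'i cconf pmf"
    and P :: "nat \<Rightarrow> real \<Rightarrow> 'i state \<Rightarrow> 'i state pmf" and stat :: "nat \<Rightarrow> 'i state pmf"
  assumes member: "\<And>m. stationary_greedy B b lam mu rho mu0 \<alpha> (r m) (sel m) (rep m) (P m) (stat m)"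
    and r_at_top: "filterlim r at_top sequentially"
begin

abbreviation sX :: "nat \<Rightarrow> 'i state \<Rightarrow> 'i cconf \<Rightarrow> real" where "sX m X \<equiv> (\<lambda>c. real (X c) / r m)"

lemma r_ge: "\<forall>\<^sub>F m in sequentially. r m \<ge> R"
  using r_at_top by (simp add: filterlim_at_top)

text \<open>Chebyshev's inequality: a second moment of order \<open>r\<close> against squared
  deviations of order \<open>r ^ 2\<close>.\<close>

lemma counts_concentrate:
  assumes d: "d > 0" and \<delta>: "\<delta> > 0"
  shows "\<forall>\<^sub>F m in sequentially. measure_pmf.prob (stat m) {X. \<bar>actual i (sX m X) - rho i\<bar> > d \<or> tokens i (sX m X) > d} \<le> \<delta>"
  using r_ge[of "moment_const / (d\<^sup>2 * \<delta>)"]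
proof eventually_elim
  case (elim m)
  interpret stationary_greedy B b lam mu rho mu0 \<alpha> "r m" "sel m" "rep m" "P m" "stat m" by (rule member)
  have "measure_pmf.prob (stat m) {X. \<bar>actual i (sX m X) - rho i\<bar> > d \<or> tokens i (sX m X) > d}
     \<le> (moment_const * r m) / (d\<^sup>2 * (r m)\<^sup>2)"
  proof (rule pmf_Markov[OF second_moment(1) Q_nonneg _ second_moment(2)])
    show "d\<^sup>2 * (r m)\<^sup>2 > 0" using d r_pos by simp
    fix X assume "X \<in> {X. \<bar>actual i (sX m X) - rho i\<bar> > d \<or> tokens i (sX m X) > d}"
    moreover have "\<bar>actual i (sX m X) - rho i\<bar> = \<bar>dev i X\<bar> / r m"
    proof -
      have "actual i (sX m X) - rho i = dev i X / r m"
        using r_pos by (simp add: actual_def lin_scale dev_def diff_divide_distrib)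
      then show ?thesis using r_pos by simp
    qed
    moreover have "tokens i (sX m X) = \<bar>tokens i (rl X)\<bar> / r m"
      using tokens_nonneg[of i X] by (simp add: tokens_def lin_scale)
    ultimately have "d * r m \<le> \<bar>dev i X\<bar> \<or> d * r m \<le> \<bar>tokens i (rl X)\<bar>"
      using r_pos by (auto simp: field_simps)
    then have "(d * r m)\<^sup>2 \<le> (dev i X)\<^sup>2 \<or> (d * r m)\<^sup>2 \<le> (tokens i (rl X))\<^sup>2"
      using d r_pos by (auto simp: abs_le_square_iff[symmetric])
    moreover have "(dev i X)\<^sup>2 + (tokens i (rl X))\<^sup>2 \<le> Q X" unfolding Q_def by (rule member_le_sum) auto
    moreover have "0 \<le> (dev i X)\<^sup>2" "0 \<le> (tokens i (rl X))\<^sup>2" by auto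
    ultimately show "d\<^sup>2 * (r m)\<^sup>2 \<le> Q X" unfolding power_mult_distrib by linarith
  qed
  also have "\<dots> = moment_const / d\<^sup>2 / r m" using r_pos by (simp add: power2_eq_square)
  also have "\<dots> \<le> \<delta>" using elim d \<delta> r_pos by (simp add: field_simps)
  finally show ?case .
qed

lemma gap_vanishes:
  assumes k': "k' \<in> K0" "k' + axis i 1 \<in> K0" and d: "d > 0" and \<theta>: "\<theta> > 0" and \<delta>: "\<delta> > 0"
  shows "\<forall>\<^sub>F m in sequentially. measure_pmf.prob (stat m) {X. served k i (sX m X) * gap \<theta> k i k' (sX m X) > d} \<le> \<delta>"
proof -
  define C where "C = (1 + moment_const) / mu i / d"
  have C: "C > 0" unfolding C_def using moment_const_nonneg mu_pos[of i] d by simp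
  have sc0: "step_const > 0" unfolding step_const_def using max_rate_pos by (simp add: add_pos_nonneg)
  \<comment> \<open>Makes the part of the bound that does not shrink with \<open>r\<close> equal to
    \<open>\<delta> / 2\<close>; the third lower bound on \<open>r m\<close> handles the other
    half.\<close>
  define e where "e = \<delta> / (2 * step_const * C)"
  have e: "e > 0" unfolding e_def using sc0 C \<delta> by simp
  obtain R where R: "\<And>r n. r \<ge> R \<Longrightarrow> r > 0 \<Longrightarrow> h ((real n + 1) / r) \<le> h (real n / r) + e"
    using h_step_small[OF e] by blast
  have gc: "gap_const \<ge> 0" unfolding gap_const_def using hmax_pos max_rate_pos by simp
  show ?thesis
    using r_ge[of R] r_ge[of "2 / \<theta>"] r_ge[of "(2 * gap_const * C / \<delta>)\<^sup>2"]
  proof eventually_elim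
    case (elim m)
    interpret stationary_greedy B b lam mu rho mu0 \<alpha> "r m" "sel m" "rep m" "P m" "stat m" by (rule member)
    have th: "2 \<le> \<theta> * r m" using elim(2) \<theta> by (simp add: field_simps)
    note E = gap_expectation[of e k' i \<theta> k, OF R[OF elim(1) r_pos] less_imp_le[OF e] k' th]
    have "measure_pmf.prob (stat m) {X. served k i (sX m X) * gap \<theta> k i k' (sX m X) > d}
       \<le> ((gap_const / sqrt (r m) + e * step_const) * (1 + moment_const) / mu i) / d"
    proof (rule pmf_Markov[OF E(2) _ d E(1)])
      fix X
      have "served k i (sX m X) = served k i (rl X) / r m" by (simp add: served_def lin_scale)
      then show "0 \<le> served k i (sX m X) * gap \<theta> k i k' (sX m X)"
        using served_nonneg[of k i X] r_pos gap_nonneg by simp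
    qed auto
    also have "\<dots> = gap_const * C / sqrt (r m) + e * step_const * C"
      unfolding C_def by (simp add: algebra_simps add_divide_distrib)
    also have "e * step_const * C = \<delta> / 2" unfolding e_def using sc0 C by simp
    also have "gap_const * C / sqrt (r m) \<le> \<delta> / 2"
    proof -
      have "2 * gap_const * C / \<delta> \<le> sqrt (r m)" using elim(3) by (rule real_le_rsqrt)
      then show ?thesis using \<delta> sqrt_r(1) by (simp add: field_simps)
    qed
    finally show ?case by simp
  qed
qed

lemma spread_threshold:
  assumes kappa: "\<kappa> \<in> K" "\<kappa> + axis j 1 \<in> K0" and \<theta>: "\<theta> > 0" and \<delta>: "\<delta> > 0"
  shows "\<exists>\<tau>>0. \<forall>\<^sub>F m in sequentially. measure_pmf.prob (stat m)
     {X. served (\<kappa> + axis j 1) j (sX m X) \<ge> \<theta> \<and> cnt (cls \<kappa>) (sX m X) \<ge> \<theta> \<and> cnt {\<kappa>} (sX m X) < \<tau>} \<le> \<delta>"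
proof -
  \<comment> \<open>On the event considered, the positive part in \<open>spread_expectation\<close>
    is at least \<open>\<theta> / 2\<close> and \<open>served\<close> at least
    \<open>\<theta>\<close>. So \<open>d\<close> is the level for Markov's inequality.\<close>
  define d where "d = \<theta>\<^sup>2 / 2"
  have d: "d > 0" using \<theta> by (simp add: d_def)
  define M where "M = 1 + 2 * spread_const1 \<kappa> j / (d * \<delta>)"
  have "spread_const1 \<kappa> j \<ge> 0"
    unfolding spread_const1_def using max_rate_pos mu_pos[of j]
    by (intro divide_nonneg_nonneg mult_nonneg_nonneg add_nonneg_nonneg sum_nonneg) auto
  then have M: "M \<ge> 1" "spread_const1 \<kappa> j / M \<le> d * \<delta> / 2"
    unfolding M_def using d \<delta> by (auto simp: field_simps add_pos_nonneg)
  show ?thesis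
  proof (intro exI conjI)
    show "\<theta> / (2 * M) > 0" using \<theta> M by simp
    show "\<forall>\<^sub>F m in sequentially. measure_pmf.prob (stat m)
     {X. served (\<kappa> + axis j 1) j (sX m X) \<ge> \<theta> \<and> cnt (cls \<kappa>) (sX m X) \<ge> \<theta> \<and> cnt {\<kappa>} (sX m X) < \<theta> / (2 * M)} \<le> \<delta>"
      using r_ge[of "2 * spread_const2 \<kappa> j M / (d * \<delta>)"]
    proof eventually_elim
      case (elim m)
      interpret stationary_greedy B b lam mu rho mu0 \<alpha> "r m" "sel m" "rep m" "P m" "stat m" by (rule member)
      note E = spread_expectation[OF kappa M(1)]
      have "measure_pmf.prob (stat m)
         {X. served (\<kappa> + axis j 1) j (sX m X) \<ge> \<theta> \<and> cnt (cls \<kappa>) (sX m X) \<ge> \<theta> \<and> cnt {\<kappa>} (sX m X) < \<theta> / (2 * M)}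
         \<le> (spread_const1 \<kappa> j / M + spread_const2 \<kappa> j M / r m) / d"
      proof (rule pmf_Markov[OF E(2) _ d E(1)])
        fix X
        have "served (\<kappa> + axis j 1) j (sX m X) = served (\<kappa> + axis j 1) j (rl X) / r m" by (simp add: served_def lin_scale)
        then show "0 \<le> max 0 (cnt (cls \<kappa>) (sX m X) - M * cnt {\<kappa>} (sX m X)) * served (\<kappa> + axis j 1) j (sX m X)"
          using served_nonneg[of "\<kappa> + axis j 1" j X] r_pos by simp
      next
        fix X assume "X \<in> {X. served (\<kappa> + axis j 1) j (sX m X) \<ge> \<theta> \<and> cnt (cls \<kappa>) (sX m X) \<ge> \<theta> \<and> cnt {\<kappa>} (sX m X) < \<theta> / (2 * M)}"
        then have X: "served (\<kappa> + axis j 1) j (sX m X) \<ge> \<theta>" "cnt (cls \<kappa>) (sX m X) \<ge> \<theta>" "cnt {\<kappa>} (sX m X) < \<theta> / (2 * M)"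
          by auto
        have "M * cnt {\<kappa>} (sX m X) \<le> M * (\<theta> / (2 * M))" using X(3) M by (intro mult_left_mono) auto
        also have "\<dots> = \<theta> / 2" using M by simp
        finally have "\<theta> / 2 \<le> cnt (cls \<kappa>) (sX m X) - M * cnt {\<kappa>} (sX m X)" using X(2) by linarith
        then have "\<theta> / 2 \<le> max 0 (cnt (cls \<kappa>) (sX m X) - M * cnt {\<kappa>} (sX m X))"
          by (rule order_trans) (rule max.cobounded2)
        then have "\<theta> / 2 * \<theta> \<le> max 0 (cnt (cls \<kappa>) (sX m X) - M * cnt {\<kappa>} (sX m X)) * served (\<kappa> + axis j 1) j (sX m X)"
          by (rule mult_mono[OF _ X(1)]) (use \<theta> in simp_all)
        then show "d \<le> max 0 (cnt (cls \<kappa>) (sX m X) - M * cnt {\<kappa>} (sX m X)) * served (\<kappa> + axis j 1) j (sX m X)"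
          by (simp add: d_def power2_eq_square)
      qed
      also have "\<dots> \<le> (d * \<delta> / 2 + d * \<delta> / 2) / d"
      proof (intro divide_right_mono add_mono M)
        show "spread_const2 \<kappa> j M / r m \<le> d * \<delta> / 2" using elim d \<delta> r_pos by (simp add: field_simps)
      qed (use d in simp)
      also have "\<dots> = \<delta>" using d by simp
      finally show ?case .
    qed
  qed
qed

lemma near_targets:
  assumes eps: "\<epsilon> > 0" and \<delta>: "\<delta> > 0"
  shows "\<forall>\<^sub>F m in sequentially. measure_pmf.prob (stat m)
    {X. \<not> (\<bar>vec_setdist CK (sX m X) (balanced_set B b rho)\<bar> < \<epsilon> \<and>
        \<bar>vec_setdist K (marginal (sX m X)) (optimal_set B b \<alpha> rho)\<bar> < \<epsilon>)} \<le> \<delta>"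
proof -
  define J where "J = {(\<kappa>, j). \<kappa> \<in> K \<and> \<kappa> + axis j (1::nat) \<in> K0}"
  have fJ: "finite J" by (rule finite_subset[of _ "K \<times> UNIV"]) (use finite_K in \<open>auto simp: J_def\<close>)
  define bad where "bad l \<tau> a m = {X. served (fst a + axis (snd a) 1) (snd a) (sX m X) \<ge> 1 / (real l + 1) \<and>
     cnt (cls (fst a)) (sX m X) \<ge> 1 / (real l + 1) \<and> cnt {fst a} (sX m X) < \<tau>}" for l \<tau> a m
  define N where "N = real (card J) + 1"
  have N: "N > 0" by (simp add: N_def)
  \<comment> \<open>The thresholds must be fixed at all levels before
    \<open>good_near_targets\<close> yields \<open>n\<close>. Level \<open>l\<close> therefore
    receives the failure probability \<open>\<delta> / 2 * (1 / 2) ^ (l + 1)\<close>, and the sum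
    over \<open>l \<le> n\<close> stays below \<open>\<delta> / 2\<close> whatever \<open>n\<close>
    turns out to be.\<close>
  have "\<exists>\<tau>>0. \<forall>\<^sub>F m in sequentially. measure_pmf.prob (stat m) (\<Union>a\<in>J. bad l \<tau> a m) \<le> \<delta> / 2 * (1 / 2) ^ (l + 1)" for l
  proof -
    have "\<forall>a\<in>J. \<exists>\<tau>>0. \<forall>\<^sub>F m in sequentially. measure_pmf.prob (stat m) (bad l \<tau> a m) \<le> \<delta> / 2 * (1 / 2) ^ (l + 1) / N"
      unfolding bad_def by (intro ballI spread_threshold) (use \<delta> N in \<open>auto simp: J_def\<close>)
    from bchoice[OF this] obtain \<tau> where \<tau>: "\<And>a. a \<in> J \<Longrightarrow> \<tau> a > 0"
      "\<And>a. a \<in> J \<Longrightarrow> \<forall>\<^sub>F m in sequentially. measure_pmf.prob (stat m) (bad l (\<tau> a) a m) \<le> \<delta> / 2 * (1 / 2) ^ (l + 1) / N"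
      by blast
    \<comment> \<open>The 1 covers an empty \<open>J\<close>; lowering a threshold only shrinks the
      bad event.\<close>
    define t where "t = Min (insert 1 (\<tau> ` J))"
    have t: "t > 0" "\<And>a. a \<in> J \<Longrightarrow> t \<le> \<tau> a" unfolding t_def using fJ \<tau>(1) by auto
    have ev: "\<forall>\<^sub>F m in sequentially. measure_pmf.prob (stat m) (\<Union>a\<in>J. bad l t a m) \<le> (\<Sum>a\<in>J. \<delta> / 2 * (1 / 2) ^ (l + 1) / N)"
    proof (rule eventually_prob_union[OF fJ])
      fix a assume a: "a \<in> J"
      have "measure_pmf.prob (stat m) (bad l t a m) \<le> measure_pmf.prob (stat m) (bad l (\<tau> a) a m)" for m
        using t(2)[OF a] by (intro measure_pmf.finite_measure_mono) (auto simp: bad_def)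
      then show "\<forall>\<^sub>F m in sequentially. measure_pmf.prob (stat m) (bad l t a m) \<le> \<delta> / 2 * (1 / 2) ^ (l + 1) / N"
        using \<tau>(2)[OF a] by (auto elim!: eventually_mono intro: order_trans)
    qed
    have le: "(\<Sum>a\<in>J. \<delta> / 2 * (1 / 2) ^ (l + 1) / N) \<le> \<delta> / 2 * (1 / 2) ^ (l + 1)"
    proof -
      have "(\<Sum>a\<in>J. v / N) \<le> v" if "v \<ge> 0" for v
        using that N by (simp add: N_def field_simps)
      then show ?thesis using \<delta> by simp
    qed
    show ?thesis
    proof (intro exI conjI)
      show "t > 0" by (rule t)
      show "\<forall>\<^sub>F m in sequentially. measure_pmf.prob (stat m) (\<Union>a\<in>J. bad l t a m) \<le> \<delta> / 2 * (1 / 2) ^ (l + 1)"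
        using ev by (rule eventually_mono) (rule order_trans[OF _ le])
    qed
  qed
  then have "\<forall>l. \<exists>\<tau>>0. \<forall>\<^sub>F m in sequentially. measure_pmf.prob (stat m) (\<Union>a\<in>J. bad l \<tau> a m) \<le> \<delta> / 2 * (1 / 2) ^ (l + 1)"
    by (rule allI)
  from choice[OF this] obtain T where T: "\<And>l. T l > 0"
    "\<And>l. \<forall>\<^sub>F m in sequentially. measure_pmf.prob (stat m) (\<Union>a\<in>J. bad l (T l) a m) \<le> \<delta> / 2 * (1 / 2) ^ (l + 1)"
    by blast
  obtain n where n: "\<And>x. good T n x \<Longrightarrow> \<bar>vec_setdist CK x (balanced_set B b rho)\<bar> < \<epsilon> \<and>
     \<bar>vec_setdist K (marginal x) (optimal_set B b \<alpha> rho)\<bar> < \<epsilon>"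
    using good_near_targets[where T=T, OF T(1) eps] by blast
  define d where "d = 1 / (real n + 1)"
  have d: "d > 0" by (simp add: d_def)
  define E1 where "E1 i m = {X. \<bar>actual i (sX m X) - rho i\<bar> > d \<or> tokens i (sX m X) > d}" for i m
  define J2 where "J2 = {(l, k, i, k'). l \<le> n \<and> k \<in> K \<and> k' \<in> K0 \<and> k' + axis i (1::nat) \<in> K0}"
  have fJ2: "finite J2"
    by (rule finite_subset[of _ "{..n} \<times> K \<times> UNIV \<times> K0"]) (use finite_K finite_K0 in \<open>auto simp: J2_def\<close>)
  define E2 where "E2 = (\<lambda>(l, k, i, k') m. {X. served k i (sX m X) * gap (1 / (real l + 1)) k i k' (sX m X) > d})"
  have ev1: "\<forall>\<^sub>F m in sequentially. measure_pmf.prob (stat m) (\<Union>i. E1 i m) \<le> \<delta> / 4"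
    unfolding E1_def by (rule eventually_prob_union_small) (use counts_concentrate[OF d] \<delta> in auto)
  have ev2: "\<forall>\<^sub>F m in sequentially. measure_pmf.prob (stat m) (\<Union>a\<in>J2. E2 a m) \<le> \<delta> / 4"
    by (rule eventually_prob_union_small[OF fJ2])
      (use gap_vanishes[OF _ _ d] \<delta> in \<open>auto simp: J2_def E2_def\<close>)
  have geo: "(\<Sum>l\<le>n. \<delta> / 2 * (1 / 2) ^ (l + 1)) \<le> \<delta> / 2"
  proof -
    have "(\<Sum>l\<le>n. (1 / 2 :: real) ^ (l + 1)) = 1 - (1 / 2) ^ (n + 1)" by (induction n) auto
    then have "(\<Sum>l\<le>n. (1 / 2 :: real) ^ (l + 1)) \<le> 1" by simp
    then have "\<delta> / 2 * (\<Sum>l\<le>n. (1 / 2 :: real) ^ (l + 1)) \<le> \<delta> / 2 * 1" using \<delta> by (intro mult_left_mono) auto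
    then show ?thesis by (simp add: sum_distrib_left)
  qed
  have ev3: "\<forall>\<^sub>F m in sequentially. measure_pmf.prob (stat m) (\<Union>l\<in>{..n}. \<Union>a\<in>J. bad l (T l) a m) \<le> \<delta> / 2"
    using eventually_prob_union[OF finite_atMost, where E="\<lambda>l m. \<Union>a\<in>J. bad l (T l) a m", OF T(2)]
    by (rule eventually_mono) (rule order_trans[OF _ geo])
  show ?thesis using ev1 ev2 ev3
  proof eventually_elim
    case (elim m)
    interpret stationary_greedy B b lam mu rho mu0 \<alpha> "r m" "sel m" "rep m" "P m" "stat m" by (rule member)
    let ?far = "{X. \<not> (\<bar>vec_setdist CK (sX m X) (balanced_set B b rho)\<bar> < \<epsilon> \<and>
        \<bar>vec_setdist K (marginal (sX m X)) (optimal_set B b \<alpha> rho)\<bar> < \<epsilon>)}"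
    let ?E = "(\<Union>i. E1 i m) \<union> ((\<Union>a\<in>J2. E2 a m) \<union> (\<Union>l\<in>{..n}. \<Union>a\<in>J. bad l (T l) a m))"
    \<comment> \<open>Membership in the support gives \<open>X \<in> St\<close>, which
      \<open>good\<close> requires; so the inclusion of events holds only almost surely.\<close>
    have "X \<in> ?E" if far: "X \<in> ?far" and X: "X \<in> set_pmf (stat m)" for X
    proof (rule ccontr)
      assume nE: "X \<notin> ?E"
      have "X \<in> St" using X chain.set_pmf_stationary by blast
      then have "supported (sX m X)" using St_zero r_pos by (auto simp: supported_def)
      moreover have "\<bar>actual i (sX m X) - rho i\<bar> \<le> d \<and> tokens i (sX m X) \<le> d" for i
      proof -
        have "X \<notin> E1 i m" using nE by blast
        then show ?thesis by (auto simp: E1_def)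
      qed
      moreover have "served k i (sX m X) * gap (1 / (real l + 1)) k i k' (sX m X) \<le> d"
        if "l \<le> n" "k \<in> K" "k' \<in> K0" "k' + axis i 1 \<in> K0" for l k i k'
      proof -
        have "(l, k, i, k') \<in> J2" using that by (simp add: J2_def)
        then have "X \<notin> E2 (l, k, i, k') m" using nE by blast
        then show ?thesis by (simp add: E2_def not_less)
      qed
      moreover have "cnt {\<kappa>} (sX m X) \<ge> T l"
        if "l \<le> n" "\<kappa> \<in> K" "\<kappa> + axis j 1 \<in> K0" "served (\<kappa> + axis j 1) j (sX m X) \<ge> 1 / (real l + 1)"
          "cnt (cls \<kappa>) (sX m X) \<ge> 1 / (real l + 1)" for l \<kappa> j
      proof -
        have "(\<kappa>, j) \<in> J" using that by (simp add: J_def)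
        then have "X \<notin> bad l (T l) (\<kappa>, j) m" using nE that(1) by blast
        then show ?thesis using that by (simp add: bad_def not_less)
      qed
      ultimately have "good T n (sX m X)" unfolding good_def d_def by blast
      then show False using n[of "sX m X"] far by blast
    qed
    then have "measure_pmf.prob (stat m) ?far \<le> measure_pmf.prob (stat m) ?E"
      by (intro measure_pmf.finite_measure_mono_AE) (auto simp: AE_measure_pmf_iff)
    also have "\<dots> \<le> measure_pmf.prob (stat m) (\<Union>i. E1 i m) + (measure_pmf.prob (stat m) (\<Union>a\<in>J2. E2 a m)
        + measure_pmf.prob (stat m) (\<Union>l\<in>{..n}. \<Union>a\<in>J. bad l (T l) a m))"
      by (intro order_trans[OF measure_Un_le] add_left_mono measure_Un_le) auto
    also have "\<dots> \<le> \<delta>" using elim by simp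
    finally show ?case .
  qed
qed

end

theorem theorem21:
  fixes B :: "'n::finite \<Rightarrow> real" and b :: "'i::finite \<Rightarrow> 'n \<Rightarrow> real"
    and lam mu rho :: "'i \<Rightarrow> real" and mu0 \<alpha> :: real
    and r :: "nat \<Rightarrow> real"
    and sel :: "nat \<Rightarrow> 'i state \<Rightarrow> 'i \<Rightarrow> 'i conf set"
    and rep :: "nat \<Rightarrow> 'i state \<Rightarrow> 'i \<Rightarrow> 'i cconf pmf"
    and P :: "nat \<Rightarrow> real \<Rightarrow> 'i state \<Rightarrow> 'i state pmf"
    and stat :: "nat \<Rightarrow> 'i state pmf"
  assumes "\<And>n. B n > 0" and "\<And>i n. b i n > 0"
    and "\<And>i. axis i 1 \<in> confs0 B b"
    and "\<And>i. lam i > 0" and "\<And>i. mu i > 0" and "\<And>i. rho i = lam i / mu i"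
    and "(\<Sum>i\<in>UNIV. rho i) = 1"
    and "mu0 > 0" and "\<alpha> > 0"
    and "\<And>m. r m \<ge> 1" and "incseq r" and "filterlim r at_top sequentially"
    and "\<And>m. ac_rule B b \<alpha> (sel m)"
    and "\<And>m. replacement_rule B b (rep m)"
    and "\<And>m. markov_transition_function (states B b) (P m)"
    and "\<And>m. has_transition_rates (states B b) (P m)
               (greedy_rate B b lam mu mu0 (r m) (sel m) (rep m))"
    and "\<And>m. stationary_distribution (states B b) (P m) (stat m)"
  shows "weak_conv_m
           (\<lambda>m. distr (measure_pmf (stat m)) borel
                  (\<lambda>X. vec_setdist (cconfs B b) (\<lambda>c. real (X c) / r m) (balanced_set B b rho)))
           (return borel 0) \<and>
         weak_conv_m
           (\<lambda>m. distr (measure_pmf (stat m)) borel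
                  (\<lambda>X. vec_setdist (confs B b) (marginal (\<lambda>c. real (X c) / r m))
                         (optimal_set B b \<alpha> rho)))
           (return borel 0)"
proof -
  interpret greedy_sequence B b lam mu rho mu0 \<alpha> r sel rep P stat
    by unfold_locales (use assms in auto)
  have "\<forall>\<^sub>F m in sequentially. measure_pmf.prob (stat m) {X. \<bar>vec_setdist CK (sX m X) (balanced_set B b rho)\<bar> \<ge> \<epsilon>} \<le> \<delta>"
    if "\<epsilon> > 0" "\<delta> > 0" for \<epsilon> \<delta>
    using near_targets[OF that]
    by (rule eventually_mono) (erule order_trans[rotated], intro measure_pmf.finite_measure_mono, auto)
  moreover have "\<forall>\<^sub>F m in sequentially. measure_pmf.prob (stat m)
      {X. \<bar>vec_setdist K (marginal (sX m X)) (optimal_set B b \<alpha> rho)\<bar> \<ge> \<epsilon>} \<le> \<delta>"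
    if "\<epsilon> > 0" "\<delta> > 0" for \<epsilon> \<delta>
    using near_targets[OF that]
    by (rule eventually_mono) (erule order_trans[rotated], intro measure_pmf.finite_measure_mono, auto)
  ultimately show ?thesis by (intro conjI weak_conv_to_zero)
qed

end
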